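(* Let $\alpha\in[0,2)\setminus\{1\}$ and $\mu\le\mu(\alpha):=\frac{(1-\alpha)^2}{4}$, and let $u$ be the mild solution, with initial data $(u_0,u_1)\in H^{1,\mu}_{\alpha,0}(0,1)\times L^2(0,1)$, of $$\begin{cases}u_{tt}-(x^\alpha u_x)_x-\frac{\mu}{x^{2-\alpha}}u=0,&(t,x)\in(0,T)\times(0,1),\\ u(t,0)=0\ \text{ if }0\le\alpha<1,\qquad(x^\alpha u_x)(t,0)=0\ \text{ if }1<\alpha<2,&t\in(0,T),\\ u(t,1)=0,&t\in(0,T),\\ u(0,x)=u_0(x),\quad u_t(0,x)=u_1(x),&x\in(0,1).\end{cases}$$ Then, for every $T>0$, $$\int_0^Tu_x^2(t,1)\,dt\ \ge\ \{(2-\alpha)T-4\}\,E_u(0),$$ where $E_u(t)=\frac12\int_0^1\big\{u_t^2(t,x)+x^\alpha u_x^2(t,x)-\frac{\mu}{x^{2-\alpha}}u^2(t,x)\big\}dx$.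
   Context: Function spaces. By the Hardy inequality $\mu(\alpha)\int_0^1 x^{\alpha-2}u^2dx\le\int_0^1x^\alpha u_x^2dx$, the form $a_\mu(u,v)=\int_0^1\big(x^\alpha u_xv_x-\frac{\mu}{x^{2-\alpha}}uv\big)dx$ is nonnegative on $C_c^\infty(0,1)$, and moreover $\int_0^1u^2dx\le\frac{16}{(2-\alpha)^2}a_\mu(u,u)$ there. The space $H^{1,\mu}_{\alpha,0}(0,1)$ is the closure of $C^\infty_c(0,1)$ for the norm $a_\mu(u,u)^{1/2}$; it consists of functions of $L^2(0,1)\cap H^1_{loc}((0,1])$ vanishing at $x=1$ (and at $x=0$ if $\alpha<1$). It is a Hilbert space for the form $a_\mu$ extended by continuity, still written as the integral above; in particular $\int_0^1(x^\alpha u_x^2-\frac{\mu}{x^{2-\alpha}}u^2)dx$ means $a_\mu(u,u)=\|u\|^2_{H^{1,\mu}_{\alpha,0}}$, so that $E_u(t)=\frac12\big[\|u_t(t)\|^2_{L^2(0,1)}+\|u(t)\|^2_{H^{1,\mu}_{\alpha,0}}\big]$. Operator and solutions. $A^\mu_\alpha u=(x^\alpha u_x)_x+\frac{\mu}{x^{2-\alpha}}u$ (distributions on $(0,1)$), with domain $D^\mu_\alpha=\{u\in H^{1,\mu}_{\alpha,0}(0,1)\cap H^2_{loc}((0,1]): A^\mu_\alpha u\in L^2(0,1)\}$. The operator $\mathcal A(u,v)=(v,A^\mu_\alpha u)$ with domain $D^\mu_\alpha\times H^{1,\mu}_{\alpha,0}(0,1)$ generates a $C_0$-semigroup on $\mathcal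 H=H^{1,\mu}_{\alpha,0}(0,1)\times L^2(0,1)$. The mild solution with data $(u_0,u_1)\in\mathcal H$ is given by $(u(t),u_t(t))=e^{t\mathcal A}(u_0,u_1)$, so $u\in C([0,T];H^{1,\mu}_{\alpha,0}(0,1))\cap C^1([0,T];L^2(0,1))$ for every $T>0$; it is classical if $(u_0,u_1)\in D^\mu_\alpha\times H^{1,\mu}_{\alpha,0}(0,1)$. Trace. For a classical solution $u_x(t,1)$ is well defined since $u(t)\in H^2_{loc}((0,1])$. For a mild solution, $u_x(\cdot,1)\in L^2(0,T)$ is the $L^2(0,T)$-limit of the traces of classical solutions whose data converge to $(u_0,u_1)$ in $\mathcal H$ (well defined and continuous in the data). *)

theory Defs
  imports "HOL-Analysis.Analysis"
begin

section \<open>Square integrable functions and the Hilbert space \<open>L\<^sup>2(0,1)\<close>\<close>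

definition square_integrable_on :: "(real \<Rightarrow> real) \<Rightarrow> real set \<Rightarrow> bool"
  (infix "square'_integrable'_on" 50) where
  "f square_integrable_on S \<longleftrightarrow>
     f \<in> borel_measurable (lebesgue_on S) \<and> integrable (lebesgue_on S) (\<lambda>x. (f x)\<^sup>2)"

lemma square_integrable_on_mult:
  assumes "f square_integrable_on S" "g square_integrable_on S"
  shows "integrable (lebesgue_on S) (\<lambda>x. f x * g x)"
proof (rule Bochner_Integration.integrable_bound)
  show "integrable (lebesgue_on S) (\<lambda>x. (f x)\<^sup>2 + (g x)\<^sup>2)"
    using assms by (auto simp: square_integrable_on_def)
  show "(\<lambda>x. f x * g x) \<in> borel_measurable (lebesgue_on S)"
    using assms by (auto simp: square_integrable_on_def)
  show "AE x in lebesgue_on S. norm (f x * g x) \<le> norm ((f x)\<^sup>2 + (g x)\<^sup>2)"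
  proof (rule AE_I2)
    fix x
    have "2 * (\<bar>f x\<bar> * \<bar>g x\<bar>) \<le> (f x)\<^sup>2 + (g x)\<^sup>2"
      using sum_squares_bound[of "\<bar>f x\<bar>" "\<bar>g x\<bar>"] by (simp add: mult.assoc)
    moreover have "0 \<le> \<bar>f x\<bar> * \<bar>g x\<bar>" by simp
    ultimately have "\<bar>f x\<bar> * \<bar>g x\<bar> \<le> (f x)\<^sup>2 + (g x)\<^sup>2" by linarith
    then show "norm (f x * g x) \<le> norm ((f x)\<^sup>2 + (g x)\<^sup>2)"
      by (simp add: abs_mult)
  qed
qed

lemma square_integrable_on_add:
  assumes "f square_integrable_on S" "g square_integrable_on S"
  shows "(\<lambda>x. f x + g x) square_integrable_on S"
  using assms square_integrable_on_mult[OF assms]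
  by (auto simp: square_integrable_on_def power2_sum mult.assoc)

lemma square_integrable_on_scale:
  assumes "f square_integrable_on S"
  shows "(\<lambda>x. c * f x) square_integrable_on S"
  using assms by (auto simp: square_integrable_on_def power_mult_distrib)

lemma square_integrable_on_zero: "(\<lambda>x. 0) square_integrable_on S"
  by (simp add: square_integrable_on_def)

abbreviation lebesgue01 :: "real measure" where
  "lebesgue01 \<equiv> lebesgue_on {0<..<1}"

quotient_type L2 = "real \<Rightarrow> real" / partial:
  "\<lambda>f g. f square_integrable_on {0<..<1} \<and> g square_integrable_on {0<..<1} \<and>
         (AE x in lebesgue01. f x = g x)"
proof (rule part_equivpI)
  show "\<exists>f. f square_integrable_on {0<..<1} \<and> f square_integrable_on {0<..<1} \<and>
          (AE x in lebesgue01. f x = f x)"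
    using square_integrable_on_zero by auto
qed (auto intro!: sympI transpI simp: eq_commute elim: eventually_elim2)

instantiation L2 :: real_vector
begin

lift_definition zero_L2 :: L2 is "\<lambda>x. 0"
  by (simp add: square_integrable_on_zero)

lift_definition plus_L2 :: "L2 \<Rightarrow> L2 \<Rightarrow> L2" is "\<lambda>f g x. f x + g x"
  by (auto intro: square_integrable_on_add)

lift_definition uminus_L2 :: "L2 \<Rightarrow> L2" is "\<lambda>f x. - f x"
  using square_integrable_on_scale[of _ _ "-1"] by auto

definition minus_L2 :: "L2 \<Rightarrow> L2 \<Rightarrow> L2" where
  "minus_L2 f g = f + - g"

lift_definition scaleR_L2 :: "real \<Rightarrow> L2 \<Rightarrow> L2" is "\<lambda>c f x. c * f x"
  by (auto intro: square_integrable_on_scale)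

instance
proof
  fix a b :: real and x y z :: L2
  show "x - y = x + - y" by (simp add: minus_L2_def)
  show "x + y + z = x + (y + z)"
    by transfer (auto intro!: square_integrable_on_add simp: add.assoc)
  show "x + y = y + x"
    by transfer (auto intro!: square_integrable_on_add simp: add.commute)
  show "0 + x = x" by transfer auto
  have "- x + x = 0"
    by transfer (auto simp: square_integrable_on_zero)
  then show "- x + x = 0" .
  show "a *\<^sub>R (x + y) = a *\<^sub>R x + a *\<^sub>R y"
    by transfer (auto intro!: square_integrable_on_add square_integrable_on_scale simp: distrib_left)
  show "(a + b) *\<^sub>R x = a *\<^sub>R x + b *\<^sub>R x"
    by transfer
      (auto intro!: square_integrable_on_add[of "\<lambda>x. _ * _ x", OF square_integrable_on_scale square_integrable_on_scale]
        square_integrable_on_scale simp: distrib_right)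
  show "a *\<^sub>R b *\<^sub>R x = (a * b) *\<^sub>R x"
    by transfer (auto simp flip: mult.assoc intro!: square_integrable_on_scale)
  show "1 *\<^sub>R x = x" by transfer auto
qed

end

instantiation L2 :: real_inner
begin

lift_definition inner_L2 :: "L2 \<Rightarrow> L2 \<Rightarrow> real" is "\<lambda>f g. LINT x|lebesgue01. f x * g x"
proof -
  fix f f' g g' :: "real \<Rightarrow> real"
  assume f: "f square_integrable_on {0<..<1} \<and> f' square_integrable_on {0<..<1} \<and>
        (AE x in lebesgue01. f x = f' x)"
    and g: "g square_integrable_on {0<..<1} \<and> g' square_integrable_on {0<..<1} \<and>
        (AE x in lebesgue01. g x = g' x)"
  show "(LINT x|lebesgue01. f x * g x) = (LINT x|lebesgue01. f' x * g' x)"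
  proof (rule integral_cong_AE)
    show "AE x in lebesgue01. f x * g x = f' x * g' x"
      using f g by (auto elim: eventually_elim2)
  qed (use f g square_integrable_on_mult in \<open>blast dest: borel_measurable_integrable\<close>)+
qed

definition norm_L2 :: "L2 \<Rightarrow> real" where
  "norm_L2 f = sqrt (inner f f)"

definition dist_L2 :: "L2 \<Rightarrow> L2 \<Rightarrow> real" where
  "dist_L2 f g = norm (f - g)"

definition sgn_L2 :: "L2 \<Rightarrow> L2" where
  "sgn_L2 f = f /\<^sub>R norm f"

definition uniformity_L2 :: "(L2 \<times> L2) filter" where
  "uniformity_L2 = (INF e\<in>{0<..}. principal {(x, y). dist x y < e})"

definition open_L2 :: "L2 set \<Rightarrow> bool" where
  "open_L2 U \<longleftrightarrow> (\<forall>x\<in>U. \<forall>\<^sub>F (x', y) in uniformity. x' = x \<longrightarrow> y \<in> U)"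

instance
proof
  fix a :: real and x y z :: L2
  show "dist x y = norm (x - y)" by (simp add: dist_L2_def)
  show "sgn x = x /\<^sub>R norm x" by (simp add: sgn_L2_def)
  show "uniformity = (INF e\<in>{0<..}. principal {(x :: L2, y). dist x y < e})"
    by (simp add: uniformity_L2_def)
  show "open U \<longleftrightarrow> (\<forall>x\<in>U. \<forall>\<^sub>F (x', y) in uniformity. x' = x \<longrightarrow> y \<in> U)" for U :: "L2 set"
    by (simp add: open_L2_def)
  show "inner x y = inner y x" by transfer (simp add: mult.commute)
  show "inner (x + y) z = inner x z + inner y z"
    by transfer (simp add: distrib_right square_integrable_on_mult)
  show "inner (a *\<^sub>R x) y = a * inner x y"
    by transfer (simp add: mult.assoc)
  show "0 \<le> inner x x" by transfer simp
  show "inner x x = 0 \<longleftrightarrow> x = 0"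
  proof transfer
    fix f :: "real \<Rightarrow> real"
    assume f: "f square_integrable_on {0<..<1} \<and> f square_integrable_on {0<..<1} \<and>
        (AE x in lebesgue01. f x = f x)"
    then have "integrable lebesgue01 (\<lambda>x. f x * f x)"
      using square_integrable_on_mult by blast
    then have "(LINT x|lebesgue01. f x * f x) = 0 \<longleftrightarrow> (AE x in lebesgue01. f x * f x = 0)"
      by (intro integral_nonneg_eq_0_iff_AE) auto
    then show "(LINT x|lebesgue01. f x * f x) = 0 \<longleftrightarrow>
        f square_integrable_on {0<..<1} \<and> (\<lambda>x. 0) square_integrable_on {0<..<1} \<and>
        (AE x in lebesgue01. f x = 0)"
      using f square_integrable_on_zero by simp
  qed
  show "norm x = sqrt (inner x x)" by (simp add: norm_L2_def)
qed

end


section \<open>Test functions, the form \<open>a\<^sub>\<mu>\<close> and its closure\<close>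

text \<open>\<open>C\<^sub>c\<^sup>\<infinity>(0,1)\<close>; the test functions are extended by \<open>0\<close> to the real line.\<close>

definition test_functions :: "(real \<Rightarrow> real) set" where
  "test_functions =
     {\<phi>. (\<forall>n x. ((deriv ^^ n) \<phi>) differentiable (at x)) \<and>
         (\<exists>K. compact K \<and> K \<subseteq> {0<..<1} \<and> (\<forall>x. x \<notin> K \<longrightarrow> \<phi> x = 0))}"

definition a_form :: "real \<Rightarrow> real \<Rightarrow> (real \<Rightarrow> real) \<Rightarrow> (real \<Rightarrow> real) \<Rightarrow> real" where
  "a_form \<alpha> \<mu> \<phi> \<psi> =
     (LINT x|lebesgue01. x powr \<alpha> * deriv \<phi> x * deriv \<psi> x - \<mu> / x powr (2 - \<alpha>) * \<phi> x * \<psi> x)"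

text \<open>Because of \<open>\<parallel>\<phi>\<parallel>\<^sup>2 \<le> 16 / (2 - \<alpha>)\<^sup>2 a\<^sub>\<mu>(\<phi>,\<phi>)\<close> on test functions, a Cauchy sequence for
  \<open>a\<^sub>\<mu>(\<cdot>,\<cdot>)\<^sup>1\<^sup>/\<^sup>2\<close> converges in \<open>L\<^sup>2(0,1)\<close>, and the closure of the test functions for this norm is
  realised as the subspace of \<open>L\<^sup>2(0,1)\<close> of the limits of such sequences.\<close>

definition approximates :: "real \<Rightarrow> real \<Rightarrow> (nat \<Rightarrow> real \<Rightarrow> real) \<Rightarrow> L2 \<Rightarrow> bool" where
  "approximates \<alpha> \<mu> \<phi> u \<longleftrightarrow>
     (\<forall>n. \<phi> n \<in> test_functions) \<and>
     (\<forall>e>0. \<exists>N. \<forall>m\<ge>N. \<forall>n\<ge>N.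
        sqrt (a_form \<alpha> \<mu> (\<lambda>x. \<phi> m x - \<phi> n x) (\<lambda>x. \<phi> m x - \<phi> n x)) < e) \<and>
     (\<lambda>n. abs_L2 (\<phi> n)) \<longlonglongrightarrow> u"

definition H_space :: "real \<Rightarrow> real \<Rightarrow> L2 set" where
  "H_space \<alpha> \<mu> = {u. \<exists>\<phi>. approximates \<alpha> \<mu> \<phi> u}"

text \<open>The extension of \<open>a\<^sub>\<mu>\<close> by continuity; the limit does not depend on the approximating sequences.\<close>

definition H_inner :: "real \<Rightarrow> real \<Rightarrow> L2 \<Rightarrow> L2 \<Rightarrow> real" where
  "H_inner \<alpha> \<mu> u v =
     (THE c. \<exists>\<phi> \<psi>. approximates \<alpha> \<mu> \<phi> u \<and> approximates \<alpha> \<mu> \<psi> v \<and>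
        (\<lambda>n. a_form \<alpha> \<mu> (\<phi> n) (\<psi> n)) \<longlonglongrightarrow> c)"

definition H_norm :: "real \<Rightarrow> real \<Rightarrow> L2 \<Rightarrow> real" where
  "H_norm \<alpha> \<mu> u = sqrt (H_inner \<alpha> \<mu> u u)"


section \<open>The operator\<close>

definition locally_integrable01 :: "(real \<Rightarrow> real) \<Rightarrow> bool" where
  "locally_integrable01 f \<longleftrightarrow> (\<forall>a b. 0 < a \<and> b < 1 \<longrightarrow> integrable (lebesgue_on {a..b}) f)"

text \<open>\<open>u\<^sub>x = w\<close> as distributions on \<open>(0,1)\<close>.\<close>

definition weak_deriv :: "(real \<Rightarrow> real) \<Rightarrow> (real \<Rightarrow> real) \<Rightarrow> bool" where
  "weak_deriv u w \<longleftrightarrow> locally_integrable01 u \<and> locally_integrable01 w \<and>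
     (\<forall>\<phi>\<in>test_functions.
        (LINT x|lebesgue01. u x * deriv \<phi> x) = - (LINT x|lebesgue01. w x * \<phi> x))"

definition L2_loc :: "(real \<Rightarrow> real) \<Rightarrow> bool" where
  "L2_loc f \<longleftrightarrow> (\<forall>e. 0 < e \<and> e < 1 \<longrightarrow> f square_integrable_on {e<..<1})"

text \<open>\<open>H\<^sup>2\<^bsub>loc\<^esub>((0,1])\<close>: the endpoint \<open>1\<close> is included.\<close>

definition H2_loc :: "(real \<Rightarrow> real) \<Rightarrow> bool" where
  "H2_loc u \<longleftrightarrow> (\<exists>w z. weak_deriv u w \<and> weak_deriv w z \<and> L2_loc u \<and> L2_loc w \<and> L2_loc z)"

text \<open>\<open>A_rel \<alpha> \<mu> u f\<close> means \<open>(x\<^sup>\<alpha> u\<^sub>x)\<^sub>x + \<mu> x\<^sup>\<alpha>\<^sup>-\<^sup>2 u = f\<close> as distributions on \<open>(0,1)\<close>.\<close>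

definition A_rel :: "real \<Rightarrow> real \<Rightarrow> L2 \<Rightarrow> L2 \<Rightarrow> bool" where
  "A_rel \<alpha> \<mu> u f \<longleftrightarrow>
     (\<exists>w z. weak_deriv (rep_L2 u) w \<and> weak_deriv (\<lambda>x. x powr \<alpha> * w x) z \<and>
        (AE x in lebesgue01. rep_L2 f x = z x + \<mu> / x powr (2 - \<alpha>) * rep_L2 u x))"

definition D_space :: "real \<Rightarrow> real \<Rightarrow> L2 set" where
  "D_space \<alpha> \<mu> = {u \<in> H_space \<alpha> \<mu>. H2_loc (rep_L2 u) \<and> (\<exists>f. A_rel \<alpha> \<mu> u f)}"

definition state_space :: "real \<Rightarrow> real \<Rightarrow> (L2 \<times> L2) set" where
  "state_space \<alpha> \<mu> = H_space \<alpha> \<mu> \<times> UNIV"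

definition state_norm :: "real \<Rightarrow> real \<Rightarrow> L2 \<times> L2 \<Rightarrow> real" where
  "state_norm \<alpha> \<mu> U = sqrt ((H_norm \<alpha> \<mu> (fst U))\<^sup>2 + (norm (snd U))\<^sup>2)"

text \<open>The graph of \<open>\<A>(u,v) = (v, A u)\<close>.\<close>

definition wave_operator :: "real \<Rightarrow> real \<Rightarrow> ((L2 \<times> L2) \<times> (L2 \<times> L2)) set" where
  "wave_operator \<alpha> \<mu> =
     {((u, v), (v, f)) | u v f. u \<in> D_space \<alpha> \<mu> \<and> v \<in> H_space \<alpha> \<mu> \<and> A_rel \<alpha> \<mu> u f}"


section \<open>Strongly continuous semigroups on a normed space with carrier \<open>X\<close> and norm \<open>N\<close>\<close>

definition C0_semigroup ::
  "'a::real_vector set \<Rightarrow> ('a \<Rightarrow> real) \<Rightarrow> (real \<Rightarrow> 'a \<Rightarrow> 'a) \<Rightarrow> bool" where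
  "C0_semigroup X N S \<longleftrightarrow>
     (\<forall>t\<ge>0. \<forall>x\<in>X. S t x \<in> X) \<and>
     (\<forall>t\<ge>0. \<forall>x\<in>X. \<forall>y\<in>X. S t (x + y) = S t x + S t y) \<and>
     (\<forall>t\<ge>0. \<forall>c. \<forall>x\<in>X. S t (c *\<^sub>R x) = c *\<^sub>R S t x) \<and>
     (\<forall>t\<ge>0. \<exists>M. \<forall>x\<in>X. N (S t x) \<le> M * N x) \<and>
     (\<forall>x\<in>X. S 0 x = x) \<and>
     (\<forall>s\<ge>0. \<forall>t\<ge>0. \<forall>x\<in>X. S (s + t) x = S s (S t x)) \<and>
     (\<forall>x\<in>X. ((\<lambda>t. N (S t x - x)) \<longlongrightarrow> 0) (at_right 0))"

definition generator ::
  "'a::real_vector set \<Rightarrow> ('a \<Rightarrow> real) \<Rightarrow> (real \<Rightarrow> 'a \<Rightarrow> 'a) \<Rightarrow> ('a \<times> 'a) set" where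
  "generator X N S =
     {(x, y). x \<in> X \<and> y \<in> X \<and> ((\<lambda>h. N ((S h x - x) /\<^sub>R h - y)) \<longlongrightarrow> 0) (at_right 0)}"


section \<open>Solutions, boundary trace, energy\<close>

text \<open>The mild solution is \<open>(u(t), u\<^sub>t(t)) = exp(t\<A>)(u\<^sub>0, u\<^sub>1)\<close>, where \<open>exp(t\<A>)\<close> is the unique
  semigroup \<open>S\<close> with generator \<open>\<A>\<close>; the component \<open>ut\<close> is the time derivative of \<open>u\<close>.
  The boundary conditions are contained in \<open>H_space\<close> and \<open>D_space\<close>.\<close>

definition mild_solution ::
  "real \<Rightarrow> real \<Rightarrow> L2 \<Rightarrow> L2 \<Rightarrow> (real \<Rightarrow> L2) \<Rightarrow> (real \<Rightarrow> L2) \<Rightarrow> bool" where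
  "mild_solution \<alpha> \<mu> u0 u1 u ut \<longleftrightarrow>
     (u0, u1) \<in> state_space \<alpha> \<mu> \<and>
     (\<exists>S. C0_semigroup (state_space \<alpha> \<mu>) (state_norm \<alpha> \<mu>) S \<and>
          generator (state_space \<alpha> \<mu>) (state_norm \<alpha> \<mu>) S = wave_operator \<alpha> \<mu> \<and>
          (\<forall>t\<ge>0. (u t, ut t) = S t (u0, u1)))"

definition classical_solution ::
  "real \<Rightarrow> real \<Rightarrow> L2 \<Rightarrow> L2 \<Rightarrow> (real \<Rightarrow> L2) \<Rightarrow> (real \<Rightarrow> L2) \<Rightarrow> bool" where
  "classical_solution \<alpha> \<mu> u0 u1 u ut \<longleftrightarrow>
     mild_solution \<alpha> \<mu> u0 u1 u ut \<and> u0 \<in> D_space \<alpha> \<mu> \<and> u1 \<in> H_space \<alpha> \<mu>"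

text \<open>\<open>u\<^sub>x(1) = d\<close>, read off the representative of \<open>u\<close> that is \<open>C\<^sup>1\<close> on \<open>(0,1]\<close>; every
  \<open>u\<close> in \<open>H\<^sup>2\<^bsub>loc\<^esub>((0,1])\<close> has one.\<close>

definition deriv_at_1 :: "L2 \<Rightarrow> real \<Rightarrow> bool" where
  "deriv_at_1 u d \<longleftrightarrow>
     (\<exists>p q. (AE x in lebesgue01. rep_L2 u x = p x) \<and>
        (\<forall>x\<in>{0<..1}. (p has_real_derivative q x) (at x within {0<..1})) \<and>
        continuous_on {0<..1} q \<and> q 1 = d)"

text \<open>\<open>g = u\<^sub>x(\<cdot>,1)\<close> in \<open>L\<^sup>2(0,T)\<close> for the mild solution with data \<open>(u0, u1)\<close>: \<open>g\<close> is the
  \<open>L\<^sup>2(0,T)\<close>-limit of the traces \<open>\<tau> n\<close> of classical solutions whose data converge to \<open>(u0, u1)\<close>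
  in \<open>state_space\<close>.  The limit is the same for all such sequences of data.\<close>

definition boundary_trace ::
  "real \<Rightarrow> real \<Rightarrow> real \<Rightarrow> L2 \<Rightarrow> L2 \<Rightarrow> (real \<Rightarrow> real) \<Rightarrow> bool" where
  "boundary_trace \<alpha> \<mu> T u0 u1 g \<longleftrightarrow>
     g square_integrable_on {0<..<T} \<and>
     (\<exists>v0 v1 v vt \<tau>.
        (\<forall>n. classical_solution \<alpha> \<mu> (v0 n) (v1 n) (v n) (vt n)) \<and>
        (\<lambda>n::nat. state_norm \<alpha> \<mu> (v0 n - u0, v1 n - u1)) \<longlonglongrightarrow> 0 \<and>
        (\<forall>n. \<forall>t\<in>{0<..<T}. deriv_at_1 (v n t) (\<tau> n t)) \<and>
        (\<forall>n. \<tau> n square_integrable_on {0<..<T}) \<and>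
        (\<lambda>n. LINT t|lebesgue_on {0<..<T}. (\<tau> n t - g t)\<^sup>2) \<longlonglongrightarrow> 0)"

text \<open>\<open>E\<^sub>u(t)\<close>; the integral of \<open>x\<^sup>\<alpha> u\<^sub>x\<^sup>2 - \<mu> x\<^sup>\<alpha>\<^sup>-\<^sup>2 u\<^sup>2\<close> is by convention the squared norm
  of \<open>u(t)\<close> in \<open>H_space\<close>.\<close>

definition energy ::
  "real \<Rightarrow> real \<Rightarrow> (real \<Rightarrow> L2) \<Rightarrow> (real \<Rightarrow> L2) \<Rightarrow> real \<Rightarrow> real" where
  "energy \<alpha> \<mu> u ut t = ((norm (ut t))\<^sup>2 + (H_norm \<alpha> \<mu> (u t))\<^sup>2) / 2"

definition mu_crit :: "real \<Rightarrow> real" where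
  "mu_crit \<alpha> = (1 - \<alpha>)\<^sup>2 / 4"

end

theory Submission
  imports Defs
begin

text \<open>
  Put \<open>k = (1 - \<alpha>)/2\<close>, \<open>C \<phi> = x\<^sup>\<alpha>\<^sup>/\<^sup>2 (\<phi>' - k\<phi>/x)\<close> and \<open>D \<phi> = (k\<^sup>2 - \<mu>)\<^sup>1\<^sup>/\<^sup>2 x\<^sup>\<alpha>\<^sup>/\<^sup>2\<^sup>-\<^sup>1 \<phi>\<close>.
  On test functions \<open>a\<^sub>\<mu>(\<phi>,\<psi>) = \<langle>C \<phi>, C \<psi>\<rangle> + \<langle>D \<phi>, D \<psi>\<rangle>\<close>, so closing \<open>(C, D)\<close> in
  \<open>L\<^sup>2\<close> identifies the energy space isometrically with a subspace of a Hilbert space, on which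
  the semigroup preserves the norm. The multiplier \<open>B u = x u\<^sub>x + (\<alpha>/4) u\<close> satisfies
  \<open>\<parallel>B u\<parallel>\<^sup>2 \<le> a\<^sub>\<mu>(u,u)\<close>, and for a classical solution
  \<open>d/dt \<langle>u\<^sub>t, B u\<rangle> = u\<^sub>x(t,1)\<^sup>2/2 - (2 - \<alpha>)/2 E\<^sub>u\<close>.
  Integrating over \<open>(0,T)\<close> and using \<open>\<bar>\<langle>u\<^sub>t, B u\<rangle>\<bar> \<le> E\<^sub>u\<close> at both ends gives the inequality, which
  passes to mild solutions by density.
\<close>

text \<open>The weight \<alpha>/4 balances the two halves of the energy. Multiplication by x u_x
  alone yields -1/2 times the squared norm of u_t and -(1 - \<alpha>)/2 times the form of u; adding
  c u shifts these coefficients by +c and -c, and c = \<alpha>/4 makes both equal to -(2 -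
  \<alpha>)/4, so that the conserved energy appears. The bounds at the two ends cost 2 E_u, and
  clearing the 1/2 in front of the squared trace turns this into the 4 of the claim. The obstacle is
  the critical \<mu>: for elements of the closure x^\<alpha> u_x^2 and x^(\<alpha>-2) u^2 need not
  be separately integrable, so only the combinations \<open>C\<close> and \<open>D\<close> may be
  estimated. Boundary terms at 0 are removed by one principle: if F has a limit at 0 and F/x is
  integrable, the limit is 0. The definition of a semigroup bounds each S t separately. The locally
  uniform bound that differentiation of orbits requires has to be extracted from completeness of the
  energy space, hence from completeness of \<open>L2\<close>.\<close>

section \<open>Completeness of \<open>L\<^sup>2(0,1)\<close>\<close>

lemma measure_lebesgue01: "measure lebesgue01 (space lebesgue01) = 1" "finite_measure lebesgue01"
proof -
  have "finite_measure lebesgue01"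
    by (rule finite_measure_lebesgue_on) (simp add: lmeasurable_interval)
  then show "finite_measure lebesgue01" .
  show "measure lebesgue01 (space lebesgue01) = 1"
    by (simp add: measure_restrict_space)
qed

lemma square_integrable_on_integrable:
  assumes "f square_integrable_on {0<..<1}"
  shows "integrable lebesgue01 f"
proof -
  have "(\<lambda>x. 1::real) square_integrable_on {0<..<1}"
    unfolding square_integrable_on_def
    using finite_measure.integrable_const[OF measure_lebesgue01(2), of "1::real"] by simp
  from square_integrable_on_mult[OF assms this] show ?thesis by simp
qed

lemma rep_L2_square_integrable [simp, intro]: "rep_L2 u square_integrable_on {0<..<1}"
  using Quotient3_rep_reflp[OF Quotient3_L2] by blast

lemma abs_L2_eq_iff:
  assumes "f square_integrable_on {0<..<1}" "g square_integrable_on {0<..<1}"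
  shows "abs_L2 f = abs_L2 g \<longleftrightarrow> (AE x in lebesgue01. f x = g x)"
  using Quotient3_rel[OF Quotient3_L2, of f g] assms by auto

lemma abs_L2_rep_L2 [simp]: "abs_L2 (rep_L2 u) = u"
  using Quotient3_abs_rep[OF Quotient3_L2] by blast

lemma rep_L2_abs_L2:
  assumes "f square_integrable_on {0<..<1}"
  shows "AE x in lebesgue01. rep_L2 (abs_L2 f) x = f x"
  using abs_L2_eq_iff[of "rep_L2 (abs_L2 f)" f] assms by auto

lemma L2_eqI: "(AE x in lebesgue01. rep_L2 u x = rep_L2 v x) \<Longrightarrow> u = v"
  using abs_L2_eq_iff[of "rep_L2 u" "rep_L2 v"] by auto

lemma inner_abs_L2:
  assumes "f square_integrable_on {0<..<1}" "g square_integrable_on {0<..<1}"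
  shows "inner (abs_L2 f) (abs_L2 g) = (LINT x|lebesgue01. f x * g x)"
  using assms by (simp add: inner_L2.abs_eq)

lemma inner_L2_rep:
  "inner u v = (LINT x|lebesgue01. rep_L2 u x * rep_L2 v x)"
  using inner_abs_L2[of "rep_L2 u" "rep_L2 v"] by simp

lemma inner_L2_rep_abs:
  assumes "f square_integrable_on {0<..<1}"
  shows "inner u (abs_L2 f) = (LINT x|lebesgue01. rep_L2 u x * f x)"
  using inner_abs_L2[of "rep_L2 u" f] assms by simp

lemma abs_L2_add:
  assumes "f square_integrable_on {0<..<1}" "g square_integrable_on {0<..<1}"
  shows "abs_L2 f + abs_L2 g = abs_L2 (\<lambda>x. f x + g x)"
  using assms by (simp add: plus_L2.abs_eq)

lemma abs_L2_scaleR: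
  assumes "f square_integrable_on {0<..<1}"
  shows "c *\<^sub>R abs_L2 f = abs_L2 (\<lambda>x. c * f x)"
  using assms by (simp add: scaleR_L2.abs_eq)

lemma square_integrable_on_diff:
  assumes "f square_integrable_on S" "g square_integrable_on S"
  shows "(\<lambda>x. f x - g x) square_integrable_on S"
  using square_integrable_on_add[OF assms(1) square_integrable_on_scale[OF assms(2), of "-1"]] by simp

lemma abs_L2_diff:
  assumes "f square_integrable_on {0<..<1}" "g square_integrable_on {0<..<1}"
  shows "abs_L2 f - abs_L2 g = abs_L2 (\<lambda>x. f x - g x)"
proof -
  have "abs_L2 f - abs_L2 g = abs_L2 f + (-1) *\<^sub>R abs_L2 g" by simp
  then show ?thesis
    using assms by (simp only: abs_L2_scaleR abs_L2_add square_integrable_on_scale) simp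
qed

lemma rep_L2_diff: "AE x in lebesgue01. rep_L2 (u - v) x = rep_L2 u x - rep_L2 v x"
  using rep_L2_abs_L2[OF square_integrable_on_diff[of "rep_L2 u" _ "rep_L2 v"]]
  by (simp flip: abs_L2_diff)

lemma norm_L2_rep: "(norm u)\<^sup>2 = (LINT x|lebesgue01. (rep_L2 u x)\<^sup>2)" for u :: L2
  using power2_norm_eq_inner[of u] inner_L2_rep[of u u] by (simp add: power2_eq_square)

lemma norm_abs_L2:
  assumes "f square_integrable_on {0<..<1}"
  shows "(norm (abs_L2 f))\<^sup>2 = (LINT x|lebesgue01. (f x)\<^sup>2)"
  using power2_norm_eq_inner[of "abs_L2 f"] inner_abs_L2[OF assms assms] by (simp add: power2_eq_square)

text \<open>Cauchy-Schwarz against the constant 1, which has norm 1 because the interval has length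
  1.\<close>

lemma integral_abs_le_norm_L2:
  "(LINT x|lebesgue01. \<bar>rep_L2 u x\<bar>) \<le> norm u" 
proof -
  define f where "f = (\<lambda>x. \<bar>rep_L2 u x\<bar>)"
  have r: "rep_L2 u square_integrable_on {0<..<1}" by simp
  then have f: "f square_integrable_on {0<..<1}"
    unfolding square_integrable_on_def f_def by auto
  have one: "(\<lambda>x. 1::real) square_integrable_on {0<..<1}"
    unfolding square_integrable_on_def
    using finite_measure.integrable_const[OF measure_lebesgue01(2), of "1::real"] by simp
  have "(norm (abs_L2 f))\<^sup>2 = (norm u)\<^sup>2"
    unfolding norm_abs_L2[OF f] norm_L2_rep[of u] by (simp add: f_def)
  then have nf: "norm (abs_L2 f) = norm u" by simp
  have "(norm (abs_L2 (\<lambda>x. 1::real)))\<^sup>2 = 1"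
    unfolding norm_abs_L2[OF one] using measure_lebesgue01 by simp
  then have n1: "norm (abs_L2 (\<lambda>x. 1::real)) = 1"
    by (metis abs_norm_cancel abs_square_eq_1)
  have "inner (abs_L2 f) (abs_L2 (\<lambda>x. 1)) \<le> norm (abs_L2 f) * norm (abs_L2 (\<lambda>x. 1::real))"
    by (rule norm_cauchy_schwarz)
  then show ?thesis unfolding nf n1 inner_abs_L2[OF f one] by (simp add: f_def)
qed

text \<open>Riesz-Fischer: the absolute increments \<open>d n\<close> have geometrically small
  integrals, so they are summable almost everywhere; their sum \<open>g\<close> is square integrable
  and dominates the distance of \<open>f n\<close> to the pointwise limit, which dominated
  convergence turns into a limit in norm.\<close>

lemma L2_rapidly_Cauchy_convergent:
  fixes X :: "nat \<Rightarrow> L2"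
  assumes X: "\<And>n. norm (X (Suc n) - X n) \<le> (1/2)^n"
  shows "\<exists>l. X \<longlonglongrightarrow> l"
proof -
  define f where "f n = rep_L2 (X n)" for n
  define d where "d n x = \<bar>rep_L2 (X (Suc n) - X n) x\<bar>" for n x
  have f: "f n square_integrable_on {0<..<1}" for n by (simp add: f_def)
  have d: "d n square_integrable_on {0<..<1}" for n
    using rep_L2_square_integrable[of "X (Suc n) - X n"]
    unfolding square_integrable_on_def d_def by auto
  have nd: "norm (abs_L2 (d n)) \<le> (1/2)^n" for n
  proof -
    have "(norm (abs_L2 (d n)))\<^sup>2 = (norm (X (Suc n) - X n))\<^sup>2"
      unfolding norm_abs_L2[OF d] norm_L2_rep[of "X (Suc n) - X n"] by (simp add: d_def)
    then show ?thesis using X[of n] by simp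
  qed
  have dAE: "AE x in lebesgue01. \<forall>n. d n x = \<bar>f (Suc n) x - f n x\<bar>"
    unfolding AE_all_countable
  proof
    show "AE x in lebesgue01. d n x = \<bar>f (Suc n) x - f n x\<bar>" for n
      using rep_L2_diff[of "X (Suc n)" "X n"] by eventually_elim (simp add: d_def f_def)
  qed
  have id: "integrable lebesgue01 (d n)" for n
    using d square_integrable_on_integrable by blast
  have sumd: "(LINT x|lebesgue01. d n x) \<le> (1/2)^n" for n
    using order_trans[OF integral_abs_le_norm_L2 X[of n]] by (simp add: d_def)
  \<comment> \<open>A nonnegative series whose integrals have a finite sum is finite almost
    everywhere.\<close>
  have AEsum: "AE x in lebesgue01. summable (\<lambda>n. d n x)"
  proof -
    have "(\<integral>\<^sup>+x. (\<Sum>n. ennreal (d n x)) \<partial>lebesgue01) = (\<Sum>n. \<integral>\<^sup>+x. ennreal (d n x) \<partial>lebesgue01)"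
      using id by (intro nn_integral_suminf) auto
    also have "\<dots> = (\<Sum>n. ennreal (LINT x|lebesgue01. d n x))"
      using id by (intro suminf_cong nn_integral_eq_integral AE_I2) (simp_all add: d_def[abs_def])
    also have "\<dots> \<le> (\<Sum>n. ennreal ((1/2)^n))"
      using sumd by (intro suminf_le) (auto intro!: ennreal_leI)
    also have "\<dots> = ennreal (\<Sum>n. (1/2)^n)"
      by (intro suminf_ennreal2) (auto intro: summable_geometric)
    also have "\<dots> < \<infinity>" by simp
    finally have "(\<integral>\<^sup>+x. (\<Sum>n. ennreal (d n x)) \<partial>lebesgue01) \<noteq> \<infinity>" by auto
    moreover have "(\<lambda>x. \<Sum>n. ennreal (d n x)) \<in> borel_measurable lebesgue01"
      using id by (auto intro!: borel_measurable_suminf)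
    ultimately have "AE x in lebesgue01. (\<Sum>n. ennreal (d n x)) \<noteq> \<infinity>"
      by (intro nn_integral_PInf_AE)
    then show ?thesis
    proof eventually_elim
      case (elim x)
      then show ?case
        by (intro summable_suminf_not_top) (auto simp: d_def)
    qed
  qed
  define G where "G n x = (\<Sum>i<n. d i x)" for n x
  have G: "G n square_integrable_on {0<..<1}" for n
    unfolding G_def by (induction n) (auto intro: square_integrable_on_zero square_integrable_on_add d)
  have absG: "abs_L2 (G n) = (\<Sum>i<n. abs_L2 (d i))" for n
  proof (induction n)
    case (Suc n)
    have "abs_L2 (G (Suc n)) = abs_L2 (G n) + abs_L2 (d n)"
      unfolding abs_L2_add[OF G d] by (simp add: G_def[abs_def])
    then show ?case using Suc by simp
  next
    case 0
    then show ?case by (simp add: G_def[abs_def] zero_L2_def)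
  qed
  have nG: "norm (abs_L2 (G n)) \<le> 2" for n
  proof -
    have "norm (abs_L2 (G n)) \<le> (\<Sum>i<n. norm (abs_L2 (d i)))"
      unfolding absG by (rule norm_sum)
    also have "\<dots> \<le> (\<Sum>i<n. (1/2)^i)"
      by (intro sum_mono nd)
    also have "\<dots> \<le> (\<Sum>i. (1/2::real)^i)"
      by (intro sum_le_suminf) (auto intro: summable_geometric)
    also have "\<dots> = 2" by (subst suminf_geometric) auto
    finally show ?thesis .
  qed
  define g where "g x = (\<Sum>i. d i x)" for x
  have intG: "integrable lebesgue01 (\<lambda>x. (G n x)\<^sup>2)" for n
    using G by (auto simp: square_integrable_on_def)
  have Gmono: "G m x \<le> G n x" "0 \<le> G m x" if "m \<le> n" for m n x
    using that unfolding G_def by (auto intro!: sum_mono2 sum_nonneg simp: d_def)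
  define h where "h n = (LINT x|lebesgue01. (G n x)\<^sup>2)" for n
  have hm: "incseq h"
    unfolding h_def by (intro incseq_SucI integral_mono intG power_mono Gmono) auto
  have hb: "h n \<le> 4" for n
  proof -
    have "h n = (norm (abs_L2 (G n)))\<^sup>2" by (simp add: h_def norm_abs_L2[OF G])
    also have "\<dots> \<le> 2\<^sup>2" by (intro power_mono nG) auto
    finally show ?thesis by simp
  qed
  obtain L where L: "h \<longlonglongrightarrow> L"
    using incseq_convergent[OF hm, of 4] hb by blast
  have AEG: "AE x in lebesgue01. (\<lambda>n. G n x) \<longlonglongrightarrow> g x"
    using AEsum
  proof eventually_elim
    case (elim x)
    then show ?case unfolding G_def g_def by (rule summable_LIMSEQ)
  qed
  have gm: "g \<in> borel_measurable lebesgue01"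
    unfolding g_def using id by (intro borel_measurable_suminf) auto
  \<comment> \<open>The partial sums \<open>G n\<close> have norm at most 2 by the triangle
    inequality, so monotone convergence of their squares makes the limit square integrable.\<close>
  have g2: "integrable lebesgue01 (\<lambda>x. (g x)\<^sup>2)"
  proof (rule integrable_monotone_convergence[OF intG])
    show "AE x in lebesgue01. mono (\<lambda>n. (G n x)\<^sup>2)"
      by (intro AE_I2 monoI power_mono Gmono) auto
    show "AE x in lebesgue01. (\<lambda>n. (G n x)\<^sup>2) \<longlonglongrightarrow> (g x)\<^sup>2"
      using AEG by eventually_elim (intro tendsto_intros)
    show "(\<lambda>n. LINT x|lebesgue01. (G n x)\<^sup>2) \<longlonglongrightarrow> L" using L unfolding h_def .
  qed (use gm in measurable)
  \<comment> \<open>Telescoping makes \<open>F\<close> the pointwise limit almost everywhere; on the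
    null set where the series diverges its value is arbitrary.\<close>
  define F where "F x = f 0 x + (\<Sum>i. f (Suc i) x - f i x)" for x
  have fm: "f n \<in> borel_measurable lebesgue01" for n
    using f by (auto simp: square_integrable_on_def)
  have Fm: "F \<in> borel_measurable lebesgue01"
    unfolding F_def using fm by (intro borel_measurable_add borel_measurable_suminf borel_measurable_diff) auto
  have conv: "AE x in lebesgue01. (\<lambda>n. f n x) \<longlonglongrightarrow> F x \<and> (\<forall>n. \<bar>f n x - F x\<bar> \<le> g x)"
    using AEsum dAE
  proof eventually_elim
    case (elim x)
    then have s: "summable (\<lambda>n. norm (f (Suc n) x - f n x))" by simp
    then have s': "summable (\<lambda>n. f (Suc n) x - f n x)" by (rule summable_norm_cancel)
    have tel: "f n x = f 0 x + (\<Sum>i<n. f (Suc i) x - f i x)" for n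
      using sum_lessThan_telescope[of "\<lambda>i. f i x" n] by simp
    have l: "(\<lambda>n. f n x) \<longlonglongrightarrow> F x"
      unfolding F_def by (subst tel) (intro tendsto_intros summable_LIMSEQ s')
    have "\<bar>f n x - F x\<bar> \<le> g x" for n
    proof -
      have "F x - f n x = (\<Sum>i. f (Suc (i + n)) x - f (i + n) x)"
        unfolding F_def using suminf_minus_initial_segment[OF s', of n] tel[of n] by simp
      then have "\<bar>f n x - F x\<bar> = norm (\<Sum>i. f (Suc (i + n)) x - f (i + n) x)" 
        by (simp add: abs_minus_commute)
      also have "\<dots> \<le> (\<Sum>i. norm (f (Suc (i + n)) x - f (i + n) x))"
        using summable_ignore_initial_segment[OF s, of n] by (intro summable_norm) simp
      also have "\<dots> = (\<Sum>i. d (i + n) x)" using elim by simp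
      also have "\<dots> = g x - (\<Sum>i<n. d i x)"
        unfolding g_def using suminf_minus_initial_segment[OF elim(1), of n] by simp
      also have "\<dots> \<le> g x" using Gmono(2)[of n n x] by (simp add: G_def)
      finally show ?thesis .
    qed
    with l show ?case by blast
  qed
  have Fsq: "F square_integrable_on {0<..<1}"
  proof -
    have g0: "AE x in lebesgue01. 0 \<le> g x"
      using AEsum unfolding g_def by eventually_elim (auto intro!: suminf_nonneg simp: d_def)
    have "(\<lambda>x. F x - f 0 x) square_integrable_on {0<..<1}"
      unfolding square_integrable_on_def
    proof
      show "integrable lebesgue01 (\<lambda>x. (F x - f 0 x)\<^sup>2)"
      proof (rule Bochner_Integration.integrable_bound[OF g2])
        show "AE x in lebesgue01. norm ((F x - f 0 x)\<^sup>2) \<le> norm ((g x)\<^sup>2)"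
          using conv g0
          by eventually_elim (auto simp: abs_minus_commute abs_le_square_iff[symmetric])
      qed (use Fm fm in measurable)
    qed (use Fm fm in measurable)
    from square_integrable_on_add[OF this f[of 0]] show ?thesis by simp
  qed
  have "(\<lambda>n. LINT x|lebesgue01. (f n x - F x)\<^sup>2) \<longlonglongrightarrow> (LINT x|lebesgue01. 0)"
  proof (rule integral_dominated_convergence[OF _ _ g2])
    show "AE x in lebesgue01. (\<lambda>n. (f n x - F x)\<^sup>2) \<longlonglongrightarrow> 0"
      using conv by eventually_elim (auto intro!: tendsto_eq_intros)
    show "AE x in lebesgue01. norm ((f n x - F x)\<^sup>2) \<le> (g x)\<^sup>2" for n
      using conv by eventually_elim (auto, metis abs_ge_zero abs_le_square_iff abs_of_nonneg order_trans)
  qed (use Fm fm in measurable)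
  moreover have "(LINT x|lebesgue01. (f n x - F x)\<^sup>2) = (norm (X n - abs_L2 F))\<^sup>2" for n
  proof -
    have "X n - abs_L2 F = abs_L2 (\<lambda>x. f n x - F x)"
      unfolding abs_L2_diff[OF f Fsq, symmetric] by (simp add: f_def)
    then show ?thesis using norm_abs_L2[OF square_integrable_on_diff[OF f Fsq]] by simp
  qed
  ultimately have "(\<lambda>n. (norm (X n - abs_L2 F))\<^sup>2) \<longlonglongrightarrow> 0" by simp
  then have "(\<lambda>n. sqrt ((norm (X n - abs_L2 F))\<^sup>2)) \<longlonglongrightarrow> sqrt 0" by (rule tendsto_real_sqrt)
  then have "(\<lambda>n. norm (X n - abs_L2 F)) \<longlonglongrightarrow> 0" by simp
  then show ?thesis using LIM_zero_cancel tendsto_norm_zero_iff by blast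
qed

instance L2 :: complete_space
proof
  fix X :: "nat \<Rightarrow> L2"
  assume C: "Cauchy X"
  have "\<exists>N. \<forall>m\<ge>N. \<forall>n\<ge>N. norm (X m - X n) < (1/2)^k" for k
    using CauchyD[OF C, of "(1/2)^k"] by simp
  then obtain N where N: "\<And>k m n. m \<ge> N k \<Longrightarrow> n \<ge> N k \<Longrightarrow> norm (X m - X n) < (1/2)^k" by metis
  \<comment> \<open>Summing makes \<open>r k\<close> dominate \<open>N k\<close>, and the added
    \<open>k\<close> makes \<open>r\<close> strictly increasing.\<close>
  define r where "r k = (\<Sum>i\<le>k. N i) + k" for k
  have r: "strict_mono r" "N k \<le> r k" for k
  proof -
    show "strict_mono r" by (intro strict_monoI_Suc) (simp add: r_def)
    have "N k \<le> (\<Sum>i\<le>k. N i)" by (rule member_le_sum) auto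
    then show "N k \<le> r k" by (simp add: r_def)
  qed
  have "norm ((X \<circ> r) (Suc n) - (X \<circ> r) n) \<le> (1/2)^n" for n
    using N[of n "r (Suc n)" "r n"] r(2)[of n] strict_monoD[OF r(1), of n "Suc n"] by fastforce
  from L2_rapidly_Cauchy_convergent[of "X \<circ> r", OF this] obtain l where "(X \<circ> r) \<longlonglongrightarrow> l" by blast
  then have "X \<longlonglongrightarrow> l" using C r(1) by (metis Cauchy_converges_subseq)
  then show "convergent X" by (auto simp: convergent_def)
qed

section \<open>Test functions\<close>

inductive_set linear_hull :: "(real \<Rightarrow> real) set \<Rightarrow> (real \<Rightarrow> real) set" for G where
  base: "g \<in> G \<Longrightarrow> g \<in> linear_hull G"
| add: "f \<in> linear_hull G \<Longrightarrow> g \<in> linear_hull G \<Longrightarrow> (\<lambda>x. f x + g x) \<in> linear_hull G"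
| scale: "f \<in> linear_hull G \<Longrightarrow> (\<lambda>x. c * f x) \<in> linear_hull G"

text \<open>A way to prove smoothness without formulas for higher derivatives: if derivatives of
  generators fall back into the hull, so do derivatives of all its members, and every iterated
  derivative is again differentiable.\<close>

lemma linear_hull_test_functions:
  assumes deriv: "\<And>g. g \<in> G \<Longrightarrow> \<exists>g'\<in>linear_hull G. \<forall>x. (g has_real_derivative g' x) (at x)"
    and K: "compact K" "K \<subseteq> {0<..<1}" "\<And>g x. g \<in> G \<Longrightarrow> x \<notin> K \<Longrightarrow> g x = 0"
    and f: "f \<in> linear_hull G"
  shows "f \<in> test_functions"
proof -
  have 1: "\<exists>f'\<in>linear_hull G. \<forall>x. (f has_real_derivative f' x) (at x)" if "f \<in> linear_hull G" for f
    using that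
  proof induction
    case (add f g)
    then obtain f' g' where "f' \<in> linear_hull G" "g' \<in> linear_hull G"
      "\<forall>x. (f has_real_derivative f' x) (at x)" "\<forall>x. (g has_real_derivative g' x) (at x)" by blast
    then show ?case
      by (intro bexI[of _ "\<lambda>x. f' x + g' x"] linear_hull.add) (auto intro: DERIV_add)
  next
    case (scale f c)
    then obtain f' where "f' \<in> linear_hull G" "\<forall>x. (f has_real_derivative f' x) (at x)" by blast
    then show ?case
      by (intro bexI[of _ "\<lambda>x. c * f' x"] linear_hull.scale) (auto intro: DERIV_cmult)
  qed (use deriv in blast)
  have 2: "deriv f \<in> linear_hull G" "f differentiable (at x)" if "f \<in> linear_hull G" for f x
  proof -
    from 1[OF that] obtain f' where f': "f' \<in> linear_hull G" "\<forall>x. (f has_real_derivative f' x) (at x)"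
      by blast
    then have "deriv f = f'" using DERIV_imp_deriv by blast
    with f' show "deriv f \<in> linear_hull G" by simp
    show "f differentiable (at x)" using f' real_differentiable_def by blast
  qed
  have 3: "(deriv ^^ n) f \<in> linear_hull G" for n
    using f 2 by (induction n) auto
  have "x \<notin> K \<Longrightarrow> f x = 0" for x
    using f K(3) by (induction) auto
  then show ?thesis using 2 3 K(1,2) by (auto simp: test_functions_def)
qed

lemma deriv_eq_0_outside:
  fixes f :: "real \<Rightarrow> real"
  assumes "closed K" "\<And>x. x \<notin> K \<Longrightarrow> f x = 0" "x \<notin> K"
  shows "deriv f x = 0"
proof -
  have "(f has_real_derivative 0) (at x)"
    by (rule has_field_derivative_transform_within_open[of "\<lambda>x. 0" 0 x "- K"]) (use assms in auto)
  then show ?thesis by (rule DERIV_imp_deriv)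
qed

lemma test_function_deriv:
  assumes "\<phi> \<in> test_functions"
  shows "(\<phi> has_real_derivative deriv \<phi> x) (at x)"
proof -
  have "((deriv ^^ 0) \<phi>) differentiable (at x)" using assms unfolding test_functions_def by blast
  then show ?thesis by (simp add: DERIV_deriv_iff_real_differentiable)
qed

lemma test_function_support:
  assumes "\<phi> \<in> test_functions"
  obtains a b where "0 < a" "a < b" "b < 1" "\<And>x. x \<notin> {a..b} \<Longrightarrow> \<phi> x = 0" "\<And>x. x \<notin> {a..b} \<Longrightarrow> deriv \<phi> x = 0"
proof -
  obtain K where K: "compact K" "K \<subseteq> {0<..<1}" "\<And>x. x \<notin> K \<Longrightarrow> \<phi> x = 0"
    using assms by (force simp: test_functions_def)
  have d0: "deriv \<phi> x = 0" if "x \<notin> K" for x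
    using that K by (intro deriv_eq_0_outside[of K]) (auto intro: compact_imp_closed)
  show ?thesis
  proof (cases "K = {}")
    case True
    then show ?thesis using K d0 that[of "1/3" "2/3"] by auto
  next
    case False
    then obtain l u where lu: "l \<in> K" "u \<in> K" "\<forall>x\<in>K. l \<le> x \<and> x \<le> u"
      using compact_attains_inf[OF K(1) False] compact_attains_sup[OF K(1) False] by blast
    show ?thesis
    \<comment> \<open>Halving the distances to 0 and to 1 keeps the interval inside (0,1) and makes
      a < b strict even when \<open>K\<close> is a single point.\<close>
    proof (rule that[of "l/2" "(1 + u)/2"])
      have "0 < l" "l < 1" "0 < u" "u < 1" "l \<le> u" using lu K(2) by auto
      then show "0 < l/2" "l/2 < (1 + u)/2" "(1 + u)/2 < 1" by auto
      then show "x \<notin> {l/2..(1+u)/2} \<Longrightarrow> \<phi> x = 0" "x \<notin> {l/2..(1+u)/2} \<Longrightarrow> deriv \<phi> x = 0" for x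
        using lu(3) \<open>0 < l\<close> \<open>u < 1\<close> by (force intro!: K(3) d0)+
    qed
  qed
qed

lemma deriv_test_function:
  assumes "\<phi> \<in> test_functions"
  shows "deriv \<phi> \<in> test_functions"
proof -
  obtain a b where ab: "0 < a" "a < b" "b < 1" "\<And>x. x \<notin> {a..b} \<Longrightarrow> deriv \<phi> x = 0"
    using test_function_support[OF assms] by metis
  have "(deriv ^^ n) (deriv \<phi>) differentiable (at x)" for n x
  proof -
    have "(deriv ^^ Suc n) \<phi> differentiable (at x)" using assms unfolding test_functions_def by blast
    then show ?thesis by (simp add: funpow_swap1)
  qed
  then show ?thesis
    using ab unfolding test_functions_def by (auto intro!: exI[of _ "{a..b}"])
qed

text \<open>Test functions with a common support interval form a family closed under
  \<open>deriv\<close>, which is all that the hull criterion asks for.\<close>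

lemma linear_hull_of_test_functions:
  assumes "0 < a" "b < 1" "f \<in> linear_hull {g \<in> test_functions. \<forall>x. x \<notin> {a..b} \<longrightarrow> g x = 0}"
  shows "f \<in> test_functions"
proof (rule linear_hull_test_functions[OF _ _ _ _ assms(3), of "{a..b}"])
  fix g assume g: "g \<in> {g \<in> test_functions. \<forall>x. x \<notin> {a..b} \<longrightarrow> g x = 0}"
  then have "deriv g x = 0" if "x \<notin> {a..b}" for x
    using that by (intro deriv_eq_0_outside[of "{a..b}"]) auto
  with g show "\<exists>g'\<in>linear_hull {g \<in> test_functions. \<forall>x. x \<notin> {a..b} \<longrightarrow> g x = 0}.
      \<forall>x. (g has_real_derivative g' x) (at x)"
    by (intro bexI[of _ "deriv g"] linear_hull.base) (auto simp: deriv_test_function test_function_deriv)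
qed (use assms in auto)

lemma test_functions_add:
  assumes "\<phi> \<in> test_functions" "\<psi> \<in> test_functions"
  shows "(\<lambda>x. \<phi> x + \<psi> x) \<in> test_functions"
proof -
  obtain a b where 1: "0 < a" "a < b" "b < 1" "\<And>x. x \<notin> {a..b} \<Longrightarrow> \<phi> x = 0"
    using test_function_support[OF assms(1)] by metis
  obtain c d where 2: "0 < c" "c < d" "d < 1" "\<And>x. x \<notin> {c..d} \<Longrightarrow> \<psi> x = 0"
    using test_function_support[OF assms(2)] by metis
  have "\<phi> x = 0" "\<psi> x = 0" if "x \<notin> {min a c..max b d}" for x
    using that by (auto intro!: 1(4) 2(4))
  with assms show ?thesis
    by (intro linear_hull_of_test_functions[of "min a c" "max b d"] linear_hull.add linear_hull.base)
       (use 1 2 in auto)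
qed

lemma test_functions_scale:
  assumes "\<phi> \<in> test_functions"
  shows "(\<lambda>x. c * \<phi> x) \<in> test_functions"
proof -
  obtain a b where 1: "0 < a" "a < b" "b < 1" "\<And>x. x \<notin> {a..b} \<Longrightarrow> \<phi> x = 0"
    using test_function_support[OF assms(1)] by metis
  with assms show ?thesis
    by (intro linear_hull_of_test_functions[of a b] linear_hull.scale linear_hull.base) auto
qed

lemma test_functions_diff:
  assumes "\<phi> \<in> test_functions" "\<psi> \<in> test_functions"
  shows "(\<lambda>x. \<phi> x - \<psi> x) \<in> test_functions"
  using test_functions_add[OF assms(1) test_functions_scale[OF assms(2), of "-1"]] by simp

lemma has_derivative_powr_times_test_function:
  assumes "\<phi> \<in> test_functions"
  shows "((\<lambda>x. x powr \<beta> * \<phi> x) has_real_derivative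
           \<beta> * (x powr (\<beta> - 1) * \<phi> x) + x powr \<beta> * deriv \<phi> x) (at x)"
proof (cases "x > 0")
  case True
  then show ?thesis
    by (auto intro!: derivative_eq_intros test_function_deriv[OF assms] simp: algebra_simps)
next
  \<comment> \<open>For nonpositive x the power need not be differentiable, but the product vanishes
    identically to the left of the support.\<close>
  case False
  obtain a b where ab: "0 < a" "a < b" "b < 1" "\<And>x. x \<notin> {a..b} \<Longrightarrow> \<phi> x = 0" "\<And>x. x \<notin> {a..b} \<Longrightarrow> deriv \<phi> x = 0"
    using test_function_support[OF assms] by metis
  have "((\<lambda>x. x powr \<beta> * \<phi> x) has_real_derivative 0) (at x)"
    using ab False by (auto intro: has_field_derivative_transform_within_open[of "\<lambda>x. 0" 0 x "{..<a}"])
  then show ?thesis using ab False by auto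
qed

lemma powr_times_test_function:
  assumes "\<phi> \<in> test_functions"
  shows "(\<lambda>x. x powr \<beta> * \<phi> x) \<in> test_functions"
proof -
  obtain a b where ab: "0 < a" "a < b" "b < 1" "\<And>x. x \<notin> {a..b} \<Longrightarrow> \<phi> x = 0"
    using test_function_support[OF assms(1)] by metis
  define S where "S = {g \<in> test_functions. \<forall>x. x \<notin> {a..b} \<longrightarrow> g x = 0}"
  have S: "deriv g \<in> S" if "g \<in> S" for g
    using that deriv_eq_0_outside[of "{a..b}" g]
    by (auto simp: S_def deriv_test_function)
  define G where "G = {\<lambda>x. x powr \<beta> * g x | \<beta> g. g \<in> S}"
  show ?thesis
  proof (rule linear_hull_test_functions[where G = G and K = "{a..b}"])
    fix h assume "h \<in> G"
    then obtain \<beta> g where h: "h = (\<lambda>x. x powr \<beta> * g x)" "g \<in> S" by (auto simp: G_def)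
    have "(\<lambda>x. \<beta> * (x powr (\<beta> - 1) * g x) + x powr \<beta> * deriv g x) \<in> linear_hull G"
      using S[OF h(2)] h(2) by (intro linear_hull.intros) (auto simp: G_def)
    then show "\<exists>h'\<in>linear_hull G. \<forall>x. (h has_real_derivative h' x) (at x)"
      unfolding h(1) using h(2)
      by (intro bexI) (auto simp: S_def intro: has_derivative_powr_times_test_function)
  next
    show "(\<lambda>x. x powr \<beta> * \<phi> x) \<in> linear_hull G"
      using assms ab by (auto simp: G_def S_def intro!: linear_hull.base)
  qed (use ab in \<open>auto simp: G_def S_def\<close>)
qed

lemma continuous_on_test_function:
  assumes "\<phi> \<in> test_functions"
  shows "continuous_on S \<phi>"
  using test_function_deriv[OF assms] by (auto intro!: continuous_at_imp_continuous_on DERIV_isCont)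

section \<open>Integrals over subintervals\<close>

lemma integrable_lebesgue_on_iff:
  fixes f :: "real \<Rightarrow> real"
  assumes "S \<in> sets lebesgue"
  shows "integrable (lebesgue_on S) f \<longleftrightarrow> integrable lebesgue (\<lambda>x. indicator S x * f x)"
  using assms by (subst integrable_restrict_space) auto

lemma integral_lebesgue_on:
  fixes f :: "real \<Rightarrow> real"
  assumes "S \<in> sets lebesgue"
  shows "integral\<^sup>L (lebesgue_on S) f = (LINT x|lebesgue. indicator S x * f x)"
  using assms by (subst integral_restrict_space) auto

lemma integrable_lebesgue_on_subset:
  fixes f :: "real \<Rightarrow> real"
  assumes "integrable (lebesgue_on T) f" "S \<subseteq> T" "S \<in> sets lebesgue" "T \<in> sets lebesgue"
  shows "integrable (lebesgue_on S) f"
proof -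
  have "integrable lebesgue (\<lambda>x. indicator S x *\<^sub>R (indicator T x * f x))"
    using assms by (intro integrable_mult_indicator) (auto simp: integrable_lebesgue_on_iff)
  moreover have "(\<lambda>x. indicator S x *\<^sub>R (indicator T x * f x)) = (\<lambda>x. indicator S x * f x)"
    using assms(2) by (auto simp: indicator_def fun_eq_iff)
  ultimately show ?thesis using assms by (simp only: integrable_lebesgue_on_iff)
qed

lemma continuous_on_square_integrable:
  assumes "continuous_on {0..1} f"
  shows "f square_integrable_on {0<..<1}"
proof -
  have "integrable (lebesgue_on {0..1}) (\<lambda>x. (f x)\<^sup>2)" "integrable (lebesgue_on {0..1}) f"
    using assms by (auto intro!: continuous_imp_integrable_real continuous_intros)
  then have "integrable lebesgue01 (\<lambda>x. (f x)\<^sup>2)" "integrable lebesgue01 f"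
    by (auto elim!: integrable_lebesgue_on_subset)
  then show ?thesis unfolding square_integrable_on_def by blast
qed

lemma test_function_square_integrable [intro]:
  "\<phi> \<in> test_functions \<Longrightarrow> \<phi> square_integrable_on {0<..<1}"
  by (intro continuous_on_square_integrable continuous_on_test_function)

section \<open>Bump functions and the fundamental lemma of the calculus of variations\<close>

lemma exp_ge_power_div_fact:
  fixes x :: real
  assumes "0 \<le> x"
  shows "x ^ n / fact n \<le> exp x"
proof -
  have "(\<Sum>i\<in>{n}. x ^ i /\<^sub>R fact i) \<le> (\<Sum>i. x ^ i /\<^sub>R fact i)"
    using assms by (intro sum_le_suminf summable_exp_generic) auto
  then show ?thesis by (simp add: exp_def divide_inverse mult.commute)
qed

text \<open>Derivatives of members of this family are linear combinations of members, hence smoothness;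
  as \<open>s \<rightarrow> 0\<close> the members with \<open>i = j = 0\<close> increase to the indicator of \<open>(a,b)\<close>.\<close>

definition bump :: "real \<Rightarrow> real \<Rightarrow> real \<Rightarrow> nat \<Rightarrow> nat \<Rightarrow> real \<Rightarrow> real" where
  "bump s a b i j x = (if a < x \<and> x < b
     then (1 / (x - a)) ^ i * (1 / (b - x)) ^ j * exp (- s / (x - a) - s / (b - x)) else 0)"

lemma bump_nonneg: "0 \<le> bump s a b i j x"
  by (auto simp: bump_def)

text \<open>With z = s/y and n = i + m in z^n / n! \<le> exp z, the exponential absorbs the singular
  factor and leaves m spare powers of y.\<close>

lemma power_times_exp_le:
  fixes s y :: real
  assumes "0 < s" "0 < y"
  shows "(1 / y) ^ i * exp (- s / y) \<le> fact (i + m) / s ^ (i + m) * y ^ m"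
proof -
  have "(s / y) ^ (i + m) / fact (i + m) \<le> exp (s / y)"
    using assms by (intro exp_ge_power_div_fact) simp
  then have "exp (- (s / y)) \<le> fact (i + m) * (y / s) ^ (i + m)"
    using assms by (simp add: exp_minus field_simps)
  then have "(1 / y) ^ i * exp (- (s / y)) \<le> (1 / y) ^ i * (fact (i + m) * (y / s) ^ (i + m))"
    using assms by (intro mult_left_mono) auto
  also have "\<dots> = fact (i + m) / s ^ (i + m) * y ^ m"
    using assms by (simp add: field_simps power_add)
  finally show ?thesis by simp
qed

text \<open>Vanishing of second order at both ends is what makes the extension by 0 differentiable
  there. One exponential factor supplies the square while the other is merely bounded; the constant
  adds the two cases.\<close>

lemma bump_quadratic_bound:
  assumes "0 < s" "a < b"
  shows "\<exists>C. \<forall>x. \<bar>bump s a b i j x\<bar> \<le> C * (x - a)\<^sup>2 \<and> \<bar>bump s a b i j x\<bar> \<le> C * (b - x)\<^sup>2"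
proof -
  define F where "F i m = fact (i + m) / s ^ (i + m)" for i m :: nat
  have F: "0 \<le> F i m" for i m using assms by (simp add: F_def)
  have "\<bar>bump s a b i j x\<bar> \<le> (F i 2 * F j 0 + F i 0 * F j 2) * (x - a)\<^sup>2 \<and>
        \<bar>bump s a b i j x\<bar> \<le> (F i 2 * F j 0 + F i 0 * F j 2) * (b - x)\<^sup>2" for x
  proof (cases "a < x \<and> x < b")
    case True
    define P Q where "P = (1 / (x - a)) ^ i * exp (- s / (x - a))"
      and "Q = (1 / (b - x)) ^ j * exp (- s / (b - x))"
    have e: "bump s a b i j x = P * Q" 
      using True exp_add[of "- s / (x - a)" "- s / (b - x)"] by (simp add: bump_def P_def Q_def)
    have P: "0 \<le> P" "P \<le> F i m * (x - a) ^ m" for m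
      unfolding P_def F_def using True power_times_exp_le[OF assms(1), of "x - a"] by auto
    have Q: "0 \<le> Q" "Q \<le> F j m * (b - x) ^ m" for m
      unfolding Q_def F_def using True power_times_exp_le[OF assms(1), of "b - x"] by auto
    have "P * Q \<le> (F i 2 * (x - a)\<^sup>2) * F j 0" "P * Q \<le> F i 0 * (F j 2 * (b - x)\<^sup>2)"
      using P(2)[of 0] P(2)[of 2] Q(2)[of 0] Q(2)[of 2] P(1) Q(1) F
      by (auto intro!: mult_mono)
    moreover have "0 \<le> F i 0 * F j 2 * (x - a)\<^sup>2" "0 \<le> F i 2 * F j 0 * (b - x)\<^sup>2" using F by auto
    ultimately show ?thesis using P(1) Q(1) by (simp add: e algebra_simps)
  next
    case False
    then have "bump s a b i j x = 0" by (auto simp: bump_def)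
    then show ?thesis using F by simp
  qed
  then show ?thesis by blast
qed

lemma has_derivative_0_quadratic_bound:
  fixes f :: "real \<Rightarrow> real"
  assumes "\<And>x. \<bar>f x\<bar> \<le> C * (x - a)\<^sup>2"
  shows "(f has_real_derivative 0) (at a)"
proof -
  have f0: "f a = 0" using assms[of a] by simp
  have "((\<lambda>h. (f (a + h) - f a) / h) \<longlongrightarrow> 0) (at 0)"
  proof (rule Lim_null_comparison)
    show "\<forall>\<^sub>F h in at 0. norm ((f (a + h) - f a) / h) \<le> C * \<bar>h\<bar>"
    proof (rule eventually_at_filter[THEN iffD2], rule always_eventually, intro allI impI)
      fix h :: real assume "h \<noteq> 0"
      then show "norm ((f (a + h) - f a) / h) \<le> C * \<bar>h\<bar>"
        using assms[of "a + h"] by (simp add: f0 divide_le_eq power2_eq_square mult.assoc abs_mult_self_eq)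
    qed
    show "((\<lambda>h. C * \<bar>h\<bar>) \<longlongrightarrow> 0) (at 0)" by (auto intro!: tendsto_eq_intros)
  qed
  then show ?thesis by (simp add: DERIV_def)
qed

text \<open>In the interior this is the product rule, written as a combination of members with one
  exponent raised by one or two. At a and b every member is 0, so the right-hand side is 0 as well
  and the quadratic bound applies.\<close>

lemma bump_has_derivative:
  assumes s: "0 < s" and ab: "a < b"
  shows "(bump s a b i j has_real_derivative
     - real i * bump s a b (Suc i) j x + real j * bump s a b i (Suc j) x
     + s * bump s a b (Suc (Suc i)) j x - s * bump s a b i (Suc (Suc j)) x) (at x)"
    (is "(_ has_real_derivative ?D x) _")
proof -
  consider "a < x" "x < b" | "x = a" | "x = b" | "x < a \<or> b < x" by linarith
  then show ?thesis
  proof cases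
    case 1
    define e where "e x = (1 / (x - a)) ^ i * (1 / (b - x)) ^ j * exp (- s / (x - a) - s / (b - x))" for x
    have a: "((\<lambda>x. 1 / (x - a)) has_real_derivative - (1 / (x - a))\<^sup>2) (at x)"
      using 1 by (auto intro!: derivative_eq_intros simp: power2_eq_square)
    have b: "((\<lambda>x. 1 / (b - x)) has_real_derivative (1 / (b - x))\<^sup>2) (at x)"
      using 1 by (auto intro!: derivative_eq_intros simp: power2_eq_square)
    have A: "((\<lambda>x. (1 / (x - a)) ^ i) has_real_derivative - (real i * (1 / (x - a)) ^ Suc i)) (at x)"
      by (rule DERIV_cong[OF DERIV_power[OF a]]) (cases i, simp_all add: power2_eq_square)
    have B: "((\<lambda>x. (1 / (b - x)) ^ j) has_real_derivative real j * (1 / (b - x)) ^ Suc j) (at x)"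
      by (rule DERIV_cong[OF DERIV_power[OF b]]) (cases j, simp_all add: power2_eq_square)
    have "((\<lambda>x. - s * (1 / (x - a)) - s * (1 / (b - x))) has_real_derivative
       - s * (- (1 / (x - a))\<^sup>2) - s * (1 / (b - x))\<^sup>2) (at x)"
      by (intro DERIV_diff DERIV_cmult a b)
    from DERIV_fun_exp[OF this]
    have E: "((\<lambda>x. exp (- s / (x - a) - s / (b - x))) has_real_derivative
       exp (- s / (x - a) - s / (b - x)) * (s * (1 / (x - a)) ^ 2 - s * (1 / (b - x)) ^ 2)) (at x)"
      by simp
    define p q w where "p = 1 / (x - a)" and "q = 1 / (b - x)" and "w = exp (- s / (x - a) - s / (b - x))"
    have bx: "bump s a b i j x = p ^ i * q ^ j * w" for i j
      using 1 by (simp add: bump_def p_def q_def w_def)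
    have "(- (real i * p ^ Suc i) * q ^ j + real j * q ^ Suc j * p ^ i) * w + w * (s * p\<^sup>2 - s * q\<^sup>2) * (p ^ i * q ^ j) = ?D x"
      unfolding bx by (simp add: algebra_simps power2_eq_square)
    then have "(e has_real_derivative ?D x) (at x)"
      unfolding e_def using DERIV_mult[OF DERIV_mult[OF A B] E]
      unfolding p_def[symmetric] q_def[symmetric] w_def[symmetric] by (simp only:)
    then show ?thesis
      by (rule has_field_derivative_transform_within_open[of _ _ _ "{a<..<b}"])
         (use 1 in \<open>auto simp: e_def bump_def\<close>)
  next
    case 4
    have "(bump s a b i j has_real_derivative 0) (at x)"
      by (rule has_field_derivative_transform_within_open[of "\<lambda>x. 0" 0 x "- {a..b}"])
         (use 4 in \<open>auto simp: bump_def\<close>)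
    then show ?thesis using 4 by (auto simp: bump_def)
  next
    case 2
    obtain C where "\<bar>bump s a b i j x\<bar> \<le> C * (x - a)\<^sup>2" for x
      using bump_quadratic_bound[OF assms] by blast
    from has_derivative_0_quadratic_bound[OF this] 2 show ?thesis by (simp add: bump_def[of _ _ _ _ _ a])
  next
    case 3
    obtain C where "\<bar>bump s a b i j x\<bar> \<le> C * (b - x)\<^sup>2" for x
      using bump_quadratic_bound[OF assms] by blast
    then have "\<bar>bump s a b i j x\<bar> \<le> C * (x - b)\<^sup>2" for x by (simp only: power2_commute[of x b])
    from has_derivative_0_quadratic_bound[OF this] 3 show ?thesis by (simp add: bump_def[of _ _ _ _ _ b])
  qed
qed

lemma bump_test_function:
  assumes "0 < s" "0 < a" "a < b" "b < 1"
  shows "bump s a b i j \<in> test_functions"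
proof (rule linear_hull_test_functions[where G = "{bump s a b i j | i j. True}" and K = "{a..b}"])
  fix g assume "g \<in> {bump s a b i j | i j. True}"
  then obtain i j where g: "g = bump s a b i j" by auto
  have "(\<lambda>x. ((- real i * bump s a b (Suc i) j x + real j * bump s a b i (Suc j) x)
     + s * bump s a b (Suc (Suc i)) j x) + (- s) * bump s a b i (Suc (Suc j)) x)
     \<in> linear_hull {bump s a b i j | i j. True}"
    by (intro linear_hull.intros) auto
  then show "\<exists>g'\<in>linear_hull {bump s a b i j | i j. True}. \<forall>x. (g has_real_derivative g' x) (at x)"
    unfolding g using bump_has_derivative[OF assms(1,3), of i j] by (intro bexI) auto
qed (use assms in \<open>auto simp: bump_def intro: linear_hull.base\<close>)

lemma indicator_times_measurable:
  fixes f :: "real \<Rightarrow> real"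
  assumes "f \<in> borel_measurable M" "A \<in> sets M"
  shows "(\<lambda>x. indicator A x * f x) \<in> borel_measurable M"
  using assms by (intro borel_measurable_times borel_measurable_indicator)

text \<open>The positive and negative parts of f are densities of two finite measures that agree on
  all half-lines and hence coincide, so the two densities are equal almost everywhere.\<close>

lemma AE_eq_0_if_tail_integrals_eq_0:
  fixes f :: "real \<Rightarrow> real"
  assumes f: "integrable lebesgue f"
    and tails: "\<And>x. (LINT y|lebesgue. indicator {x<..} y * f y) = 0"
  shows "AE x in lebesgue. f x = 0"
proof -
  \<comment> \<open>Half-lines determine Borel measures, whereas f is measurable only for the
    completion; a Borel version is substituted.\<close>
  obtain g where g [measurable]: "g \<in> borel_measurable lborel" and fg: "AE x in lborel. f x = g x"
    using completion_ex_borel_measurable_real[of f lborel] f by auto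
  have fg': "AE x in lebesgue. f x = g x" using fg by (simp add: AE_completion)
  have gm: "g \<in> borel_measurable lebesgue" using g by (simp add: measurable_completion)
  have gi: "integrable lebesgue g"
    using f fg' gm by (subst integrable_cong_AE[of g _ f]) (auto elim: eventually_mono)
  then have gi': "integrable lborel g" using integrable_completion[OF g] by simp
  have tail: "(LINT y|lborel. indicator {x<..} y * g y) = 0" for x
  proof -
    have "(LINT y|lborel. indicator {x<..} y * g y) = (LINT y|lebesgue. indicator {x<..} y * g y)"
      by (rule integral_completion[symmetric]) measurable
    also have "\<dots> = (LINT y|lebesgue. indicator {x<..} y * f y)"
      using fg' f gm by (intro integral_cong_AE indicator_times_measurable) (auto elim: eventually_mono)
    finally show ?thesis using tails by simp
  qed
  define P Q where "P y = max 0 (g y)" and "Q y = max 0 (- g y)" for y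
  have [measurable]: "P \<in> borel_measurable lborel" "Q \<in> borel_measurable lborel"
    unfolding P_def Q_def by measurable
  have Pi: "integrable lborel P" "integrable lborel Q"
    unfolding P_def Q_def using gi' by (auto intro!: integrable_max)
  have em: "emeasure (density lborel (\<lambda>y. ennreal (R y))) {x<..} = ennreal (LINT y|lborel. indicator {x<..} y * R y)"
    if [measurable]: "R \<in> borel_measurable lborel" and R: "integrable lborel R" "\<And>y. 0 \<le> R y" for R :: "real \<Rightarrow> real" and x :: real
  proof -
    have "emeasure (density lborel (\<lambda>y. ennreal (R y))) {x<..} = (\<integral>\<^sup>+ y. ennreal (R y) * indicator {x<..} y \<partial>lborel)"
      by (rule emeasure_density) auto
    also have "\<dots> = (\<integral>\<^sup>+ y. ennreal (indicator {x<..} y * R y) \<partial>lborel)"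
      by (intro nn_integral_cong) (auto simp: indicator_def)
    also have "\<dots> = ennreal (LINT y|lborel. indicator {x<..} y * R y)"
      using R integrable_real_mult_indicator[of "{x<..}" lborel R] 
      by (intro nn_integral_eq_integral) (auto simp: mult.commute)
    finally show ?thesis .
  qed
  have PQ: "(LINT y|lborel. indicator {x<..} y * P y) = (LINT y|lborel. indicator {x<..} y * Q y)" for x
  proof -
    have ii: "integrable lborel (\<lambda>y. indicator {x<..} y * P y)" "integrable lborel (\<lambda>y. indicator {x<..} y * Q y)"
      using Pi integrable_real_mult_indicator[of "{x<..}" lborel] by (auto simp: mult.commute)
    have "(LINT y|lborel. indicator {x<..} y * P y) - (LINT y|lborel. indicator {x<..} y * Q y)
        = (LINT y|lborel. indicator {x<..} y * P y - indicator {x<..} y * Q y)"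
      using ii by simp
    also have "\<dots> = (LINT y|lborel. indicator {x<..} y * g y)"
      by (intro Bochner_Integration.integral_cong) (auto simp: P_def Q_def indicator_def)
    finally show ?thesis using tail by simp
  qed
  have "density lborel (\<lambda>y. ennreal (P y)) = density lborel (\<lambda>y. ennreal (Q y))"
  proof (rule measure_eqI_lessThan)
    show "emeasure (density lborel (\<lambda>y. ennreal (P y))) {x<..} < \<infinity>" for x
      using Pi by (subst em) (auto simp: P_def)
    show "emeasure (density lborel (\<lambda>y. ennreal (P y))) {x<..} = emeasure (density lborel (\<lambda>y. ennreal (Q y))) {x<..}" for x
      using Pi PQ[of x] by (subst (1 2) em) (auto simp: P_def Q_def)
  qed auto
  then have "AE y in lborel. ennreal (P y) = ennreal (Q y)"
    by (intro sigma_finite_measure.density_unique[OF lborel.sigma_finite_measure_axioms]) auto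
  then have "AE y in lborel. g y = 0"
    by eventually_elim (auto simp: P_def Q_def max_def split: if_splits)
  then have "AE y in lborel. f y = 0" using fg by eventually_elim simp
  then show ?thesis by (simp add: AE_completion)
qed

lemma test_function_bounded:
  assumes "\<phi> \<in> test_functions"
  obtains C where "\<And>x. \<bar>\<phi> x\<bar> \<le> C" "0 \<le> C"
proof -
  obtain a b where ab: "0 < a" "a < b" "b < 1" "\<And>x. x \<notin> {a..b} \<Longrightarrow> \<phi> x = 0"
    using test_function_support[OF assms(1)] by metis
  have "bounded (\<phi> ` {a..b})"
    by (intro compact_imp_bounded compact_continuous_image continuous_on_test_function assms) auto
  then obtain C where C: "\<And>x. x \<in> {a..b} \<Longrightarrow> \<bar>\<phi> x\<bar> \<le> C" by (force simp: bounded_iff)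
  have "0 \<le> C" using C[of a] ab by force
  then show ?thesis using that[of C] C ab(4) by (metis abs_zero)
qed

lemma test_function_measurable [measurable]:
  "\<phi> \<in> test_functions \<Longrightarrow> \<phi> \<in> borel_measurable borel"
  by (intro borel_measurable_continuous_onI continuous_on_test_function)

lemma borel_imp_lebesgue_on_measurable:
  fixes f :: "real \<Rightarrow> real"
  assumes "f \<in> borel_measurable borel" shows "f \<in> borel_measurable (lebesgue_on S)"
  using assms by (intro measurable_restrict_space1 measurable_completion) simp

lemma integrable_times_test_function:
  assumes u: "locally_integrable01 u" and \<phi>: "\<phi> \<in> test_functions"
  shows "integrable lebesgue01 (\<lambda>x. u x * \<phi> x)"
proof -
  obtain a b where ab: "0 < a" "a < b" "b < 1" "\<And>x. x \<notin> {a..b} \<Longrightarrow> \<phi> x = 0"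
    using test_function_support[OF \<phi>] by metis
  obtain C where C: "\<And>x. \<bar>\<phi> x\<bar> \<le> C" "0 \<le> C" using test_function_bounded[OF \<phi>] by metis
  have "integrable (lebesgue_on {a..b}) u" using u ab by (auto simp: locally_integrable01_def)
  then have i: "integrable lebesgue (\<lambda>x. indicator {a..b} x * u x)" by (simp add: integrable_lebesgue_on_iff)
  have m: "\<phi> \<in> borel_measurable lebesgue"
    using borel_imp_lebesgue_on_measurable[OF test_function_measurable[OF \<phi>], of UNIV] by (simp add: lebesgue_on_UNIV_eq)
  have "integrable lebesgue (\<lambda>x. indicator {a..b} x * u x * \<phi> x)"
  proof (rule Bochner_Integration.integrable_bound)
    show "integrable lebesgue (\<lambda>x. C * (indicator {a..b} x * u x))" using i by simp
    show "(\<lambda>x. indicator {a..b} x * u x * \<phi> x) \<in> borel_measurable lebesgue"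
      by (rule borel_measurable_times[OF borel_measurable_integrable[OF i] m])
    show "AE x in lebesgue. norm (indicator {a..b} x * u x * \<phi> x) \<le> norm (C * (indicator {a..b} x * u x))"
      using C by (intro AE_I2) (auto simp: abs_mult indicator_def mult.commute intro!: mult_right_mono)
  qed
  moreover have "(\<lambda>x. indicator {a..b} x * u x * \<phi> x) = (\<lambda>x. indicator {0<..<1} x * (u x * \<phi> x))"
    using ab by (auto simp: fun_eq_iff indicator_def)
  ultimately show ?thesis by (simp add: integrable_lebesgue_on_iff)
qed

lemma bump_tendsto_indicator:
  "(\<lambda>n. bump (1 / real (Suc n)) a b 0 0 x) \<longlonglongrightarrow> indicator {a<..<b} x"
proof (cases "a < x \<and> x < b")
  case True
  have l: "(\<lambda>n. 1 / real (Suc n)) \<longlonglongrightarrow> 0"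
    using LIMSEQ_inverse_real_of_nat by (simp add: divide_inverse)
  have "(\<lambda>n. exp (- (1 / real (Suc n)) / (x - a) - (1 / real (Suc n)) / (b - x))) \<longlonglongrightarrow> exp (- 0 / (x - a) - 0 / (b - x))"
    by (intro tendsto_intros l) (use True in auto)
  then show ?thesis using True by (simp add: bump_def)
qed (auto simp: bump_def)

lemma bump_le_1:
  assumes "0 < s"
  shows "bump s a b 0 0 x \<le> 1"
proof (cases "a < x \<and> x < b")
  case True
  then have "0 < s / (x - a)" "0 < s / (b - x)" using assms by auto
  then have "- s / (x - a) - s / (b - x) \<le> 0" by (simp only: minus_divide_left[symmetric])
  then show ?thesis using True by (simp add: bump_def)
qed (auto simp: bump_def)

text \<open>Dominated convergence with \<open>\<bar>h\<bar>\<close> on the interval as bound; the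
  two endpoints, where the limit indicator is 0, form a null set. This is how statements about test
  functions reach integrals over intervals.\<close>

lemma integral_bump_limit:
  assumes h: "locally_integrable01 h" and ab: "0 < a" "a < b" "b < 1"
  shows "(\<lambda>n. LINT x|lebesgue01. h x * bump (1 / real (Suc n)) a b 0 0 x) \<longlonglongrightarrow>
           (LINT x|lebesgue_on {a..b}. h x)"
proof -
  have "integrable (lebesgue_on {a..b}) h" using h ab by (auto simp: locally_integrable01_def)
  then have i: "integrable lebesgue (\<lambda>x. indicator {a..b} x * h x)" by (simp add: integrable_lebesgue_on_iff)
  have "(\<lambda>n. LINT x|lebesgue. indicator {a..b} x * h x * bump (1 / real (Suc n)) a b 0 0 x) \<longlonglongrightarrow>
         (LINT x|lebesgue. indicator {a..b} x * h x * indicator {a<..<b} x)"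
  proof (rule integral_dominated_convergence)
    show "integrable lebesgue (\<lambda>x. \<bar>indicator {a..b} x * h x\<bar>)" using i by simp
    show "AE x in lebesgue. (\<lambda>n. indicator {a..b} x * h x * bump (1 / real (Suc n)) a b 0 0 x)
        \<longlonglongrightarrow> indicator {a..b} x * h x * indicator {a<..<b} x"
      by (intro AE_I2 tendsto_intros bump_tendsto_indicator)
    show "AE x in lebesgue. norm (indicator {a..b} x * h x * bump (1 / real (Suc n)) a b 0 0 x)
        \<le> \<bar>indicator {a..b} x * h x\<bar>" for n
      using bump_nonneg[of "1 / real (Suc n)" a b 0 0] bump_le_1[of "1 / real (Suc n)" a b]
      by (intro AE_I2) (auto simp: abs_mult intro!: mult_left_le)
    have m: "bump (1 / real (Suc n)) a b 0 0 \<in> borel_measurable lebesgue" for n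
      using borel_imp_lebesgue_on_measurable[OF test_function_measurable[OF bump_test_function[OF _ ab]], of "1 / real (Suc n)" 0 0 UNIV]
      by (simp add: lebesgue_on_UNIV_eq)
    then show "(\<lambda>x. indicator {a..b} x * h x * bump (1 / real (Suc n)) a b 0 0 x) \<in> borel_measurable lebesgue" for n
      by (rule borel_measurable_times[OF borel_measurable_integrable[OF i]])
    show "(\<lambda>x. indicator {a..b} x * h x * indicator {a<..<b} x) \<in> borel_measurable lebesgue"
      by (rule borel_measurable_times[OF borel_measurable_integrable[OF i] borel_measurable_indicator]) simp
  qed
  moreover have "(LINT x|lebesgue. indicator {a..b} x * h x * bump s a b 0 0 x)
      = (LINT x|lebesgue01. h x * bump s a b 0 0 x)" for s
    using ab unfolding integral_lebesgue_on[of "{0<..<1::real}", simplified]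
    by (intro Bochner_Integration.integral_cong) (auto simp: indicator_def bump_def)
  moreover have "(LINT x|lebesgue. indicator {a..b} x * h x * indicator {a<..<b} x) = (LINT x|lebesgue_on {a..b}. h x)"
  proof -
    have "AE x in lebesgue. x \<noteq> a" "AE x in lebesgue. x \<noteq> b"
      using AE_lborel_singleton[of a] AE_lborel_singleton[of b] by (auto simp: AE_completion)
    then have "AE x in lebesgue. indicator {a..b} x * h x * indicator {a<..<b} x = indicator {a..b} x * h x"
      by eventually_elim (auto simp: indicator_def)
    then show ?thesis
      unfolding integral_lebesgue_on[of "{a..b}", simplified]
      using borel_measurable_integrable[OF i] borel_measurable_indicator[of "{a<..<b}" lebesgue]
      by (intro integral_cong_AE borel_measurable_times[of "\<lambda>x. indicator {a..b} x * h x"]) simp_all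
  qed
  ultimately show ?thesis by simp
qed

text \<open>Testing with bumps kills, in the limit, the integral of h over every compact
  subinterval. Up to null sets these are the tail integrals of the truncations of h, which therefore
  vanish almost everywhere.\<close>

lemma fundamental_lemma_calculus_of_variations:
  assumes h: "locally_integrable01 h"
    and 0: "\<And>\<phi>. \<phi> \<in> test_functions \<Longrightarrow> (LINT x|lebesgue01. h x * \<phi> x) = 0"
  shows "AE x in lebesgue01. h x = 0"
proof -
  have int0: "(LINT x|lebesgue_on {a..b}. h x) = 0" if ab: "0 < a" "a < b" "b < 1" for a b
  proof -
    have "(LINT x|lebesgue01. h x * bump (1 / real (Suc n)) a b 0 0 x) = 0" for n
      by (intro 0 bump_test_function ab) simp
    with integral_bump_limit[OF h ab] have "(\<lambda>n. 0) \<longlonglongrightarrow> (LINT x|lebesgue_on {a..b}. h x)"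
      by simp
    then show ?thesis by (simp add: LIMSEQ_const_iff)
  qed
  have "AE x in lebesgue. x \<in> {a..b} \<longrightarrow> h x = 0" if ab: "0 < a" "b < 1" for a b
  proof -
    have "integrable (lebesgue_on {a..b}) h" using h ab by (auto simp: locally_integrable01_def)
    then have i: "integrable lebesgue (\<lambda>x. indicator {a..b} x * h x)" by (simp add: integrable_lebesgue_on_iff)
    have "AE x in lebesgue. indicator {a..b} x * h x = 0"
    proof (rule AE_eq_0_if_tail_integrals_eq_0[OF i])
      fix x
      show "(LINT y|lebesgue. indicator {x<..} y * (indicator {a..b} y * h y)) = 0"
      proof (cases "max a x < b")
        case True
        have "AE y in lebesgue. y \<noteq> x" 
          using AE_lborel_singleton[of x] by (auto simp: AE_completion)
        then have ae: "AE y in lebesgue. indicator {x<..} y * (indicator {a..b} y * h y)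
            = indicator {max a x..b} y * (indicator {a..b} y * h y)"
          by eventually_elim (auto simp: indicator_def)
        have "(LINT y|lebesgue. indicator {x<..} y * (indicator {a..b} y * h y))
           = (LINT y|lebesgue. indicator {max a x..b} y * (indicator {a..b} y * h y))"
          by (intro integral_cong_AE[OF _ _ ae] indicator_times_measurable borel_measurable_integrable[OF i]) simp_all
        also have "\<dots> = (LINT y|lebesgue. indicator {max a x..b} y * h y)"
          by (intro Bochner_Integration.integral_cong) (auto simp: indicator_def)
        also have "\<dots> = 0"
          using int0[of "max a x" b] ab True by (simp add: integral_lebesgue_on)
        finally show ?thesis .
      next
        case False
        have "AE y in lebesgue. y \<noteq> b" 
          using AE_lborel_singleton[of b] by (simp add: AE_completion)
        then have "AE y in lebesgue. indicator {x<..} y * (indicator {a..b} y * h y) = 0"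
          by eventually_elim (use False in \<open>auto simp: indicator_def max_def split: if_splits\<close>)
        then show ?thesis by (rule integral_eq_zero_AE)
      qed
    qed
    then show ?thesis by eventually_elim auto
  qed
  \<comment> \<open>Countably many truncations exhaust (0,1), so their exceptional null sets can be
    joined.\<close>
  then have "AE x in lebesgue. \<forall>n. x \<in> {1 / real (Suc (Suc n))..1 - 1 / real (Suc (Suc n))} \<longrightarrow> h x = 0"
    unfolding AE_all_countable by auto
  then have "AE x in lebesgue. x \<in> {0<..<1} \<longrightarrow> h x = 0"
  proof eventually_elim
    case (elim x)
    show ?case
    proof
      assume x: "x \<in> {0<..<1}"
      then obtain n where n: "1 / real (Suc n) < min x (1 - x)"
        using reals_Archimedean[of "min x (1 - x)"] by (auto simp: divide_inverse)
      have "1 / real (Suc (Suc n)) \<le> 1 / real (Suc n)" by (intro divide_left_mono) simp_all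
      then show "h x = 0" using elim[rule_format, of n] n by auto
    qed
  qed
  then show ?thesis by (subst AE_restrict_space_iff) auto
qed

section \<open>Weak derivatives\<close>

lemma integral_lebesgue01_support:
  fixes f :: "real \<Rightarrow> real"
  assumes "0 < a" "b < 1" "\<And>x. x \<notin> {a..b} \<Longrightarrow> f x = 0"
  shows "integral\<^sup>L lebesgue01 f = integral\<^sup>L (lebesgue_on {a..b}) f"
proof -
  have "(\<lambda>x. indicator {0<..<1} x * f x) = (\<lambda>x. indicator {a..b} x * f x)"
    using assms by (force simp: fun_eq_iff indicator_def)
  then show ?thesis by (simp add: integral_lebesgue_on)
qed

lemma continuous_locally_integrable01:
  assumes "continuous_on {0<..<1} f"
  shows "locally_integrable01 f"
  using assms unfolding locally_integrable01_def
  by (auto intro!: continuous_imp_integrable_real elim: continuous_on_subset)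

lemma square_integrable_imp_locally_integrable01:
  assumes "f square_integrable_on {0<..<1}"
  shows "locally_integrable01 f"
  unfolding locally_integrable01_def
  by (auto intro!: integrable_lebesgue_on_subset[OF square_integrable_on_integrable[OF assms]])

lemma continuous_on_lebesgue_has_integral:
  fixes f :: "real \<Rightarrow> real"
  assumes "continuous_on {a..b} f" "(f has_integral I) {a..b}"
  shows "integral\<^sup>L (lebesgue_on {a..b}) f = I"
  using lebesgue_integral_eq_integral[OF continuous_imp_integrable_real[OF assms(1)]] assms(2)
  by (simp add: integral_unique)

lemma integral_by_parts_test_function:
  assumes p: "\<And>x. x \<in> {0<..<1} \<Longrightarrow> (p has_real_derivative q x) (at x)"
    and q: "continuous_on {0<..<1} q" and \<phi>: "\<phi> \<in> test_functions"
  shows "(LINT x|lebesgue01. p x * deriv \<phi> x) = - (LINT x|lebesgue01. q x * \<phi> x)"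
proof -
  obtain a b where ab: "0 < a" "a < b" "b < 1" "\<And>x. x \<notin> {a..b} \<Longrightarrow> \<phi> x = 0" "\<And>x. x \<notin> {a..b} \<Longrightarrow> deriv \<phi> x = 0"
    using test_function_support[OF \<phi>] by metis
  have cp: "continuous_on {0<..<1} p"
    using p DERIV_isCont by (blast intro: continuous_at_imp_continuous_on)
  have li: "locally_integrable01 p" "locally_integrable01 q"
    using cp q continuous_locally_integrable01 by auto
  \<comment> \<open>Endpoints strictly outside the support, so that the boundary terms
    vanish.\<close>
  define a' b' where "a' = a / 2" and "b' = (1 + b) / 2"
  have ab': "0 < a'" "a' < b'" "b' < 1" "a' < a" "b < b'" using ab by (auto simp: a'_def b'_def)
  define F where "F x = p x * deriv \<phi> x + q x * \<phi> x" for x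
  have F0: "F x = 0" if "x \<notin> {a'..b'}" for x
    using that ab ab' by (auto simp: F_def)
  have "(F has_integral (p b' * \<phi> b' - p a' * \<phi> a')) {a'..b'}"
  proof (rule fundamental_theorem_of_calculus)
    fix x assume x: "x \<in> {a'..b'}"
    have "((\<lambda>x. p x * \<phi> x) has_real_derivative F x) (at x)"
      unfolding F_def using DERIV_mult[OF p[of x] test_function_deriv[OF \<phi>]] x ab'
      by (simp add: algebra_simps)
    then show "((\<lambda>x. p x * \<phi> x) has_vector_derivative F x) (at x within {a'..b'})"
      by (simp add: has_real_derivative_iff_has_vector_derivative has_vector_derivative_at_within)
  qed (use ab' in auto)
  moreover have "continuous_on {a'..b'} F"
  proof -
    have "{a'..b'} \<subseteq> {0<..<1}" using ab' by auto
    from continuous_on_subset[OF cp this] continuous_on_subset[OF q this] show ?thesis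
      unfolding F_def
      using continuous_on_test_function[OF \<phi>] continuous_on_test_function[OF deriv_test_function[OF \<phi>]]
      by (simp add: continuous_on_add continuous_on_mult)
  qed
  ultimately have "integral\<^sup>L (lebesgue_on {a'..b'}) F = p b' * \<phi> b' - p a' * \<phi> a'"
    by (intro continuous_on_lebesgue_has_integral)
  then have "integral\<^sup>L lebesgue01 F = 0"
    using integral_lebesgue01_support[of a' b' F] F0 ab' ab(4) by simp
  moreover have "integral\<^sup>L lebesgue01 F = (LINT x|lebesgue01. p x * deriv \<phi> x) + (LINT x|lebesgue01. q x * \<phi> x)"
    unfolding F_def
    by (intro Bochner_Integration.integral_add integrable_times_test_function li \<phi> deriv_test_function)
  ultimately show ?thesis by simp
qed

lemma integral_by_parts_test_functions:
  assumes "\<phi> \<in> test_functions" "\<psi> \<in> test_functions"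
  shows "(LINT x|lebesgue01. \<phi> x * deriv \<psi> x) = - (LINT x|lebesgue01. deriv \<phi> x * \<psi> x)"
  using assms
  by (intro integral_by_parts_test_function test_function_deriv continuous_on_test_function deriv_test_function)

lemma integrable_times_test_function_cong:
  fixes u :: "real \<Rightarrow> real"
  assumes "AE x in lebesgue01. u x = v x" "u \<in> borel_measurable lebesgue01" "v \<in> borel_measurable lebesgue01" "\<phi> \<in> test_functions"
  shows "(LINT x|lebesgue01. u x * \<phi> x) = (LINT x|lebesgue01. v x * \<phi> x)"
  using assms borel_imp_lebesgue_on_measurable[OF test_function_measurable[OF assms(4)]]
  by (intro integral_cong_AE borel_measurable_times) (auto elim: eventually_mono)

text \<open>The truncations to an exhausting sequence of compact intervals are measurable and
  converge pointwise.\<close>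

lemma locally_integrable01_measurable:
  assumes "locally_integrable01 f"
  shows "f \<in> borel_measurable lebesgue01"
proof -
  define S where "S n = {1 / real (Suc (Suc n))..1 - 1 / real (Suc (Suc n))}" for n
  have "(\<lambda>x. indicator (S n) x * f x) \<in> borel_measurable lebesgue" for n
  proof -
    have "integrable (lebesgue_on (S n)) f" using assms by (auto simp: locally_integrable01_def S_def)
    then show ?thesis by (subst (asm) integrable_lebesgue_on_iff) (auto simp: S_def)
  qed
  then have m: "(\<lambda>x. indicator (S n) x * f x) \<in> borel_measurable lebesgue01" for n
    by (rule measurable_restrict_space1)
  show ?thesis
  proof (rule borel_measurable_LIMSEQ_real[OF _ m])
    fix x assume "x \<in> space lebesgue01"
    then have x: "0 < x" "x < 1" by auto
    then obtain N where N: "1 / real (Suc N) < min x (1 - x)"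
      using reals_Archimedean[of "min x (1 - x)"] by (auto simp: divide_inverse)
    have "indicator (S n) x * f x = f x" if "n \<ge> N" for n
    proof -
      have "1 / real (Suc (Suc n)) \<le> 1 / real (Suc N)" using that by (intro divide_left_mono) simp_all
      then show ?thesis using N by (auto simp: S_def)
    qed
    then show "(\<lambda>n. indicator (S n) x * f x) \<longlonglongrightarrow> f x"
      by (intro tendsto_eventually eventually_sequentiallyI)
  qed
qed

lemma AE_eq_if_test_integrals_eq:
  assumes "locally_integrable01 f" "locally_integrable01 g"
    and "\<And>\<phi>. \<phi> \<in> test_functions \<Longrightarrow> (LINT x|lebesgue01. f x * \<phi> x) = (LINT x|lebesgue01. g x * \<phi> x)"
  shows "AE x in lebesgue01. f x = g x"
proof -
  have "AE x in lebesgue01. f x - g x = 0"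
  proof (rule fundamental_lemma_calculus_of_variations)
    show "locally_integrable01 (\<lambda>x. f x - g x)"
      using assms(1,2) by (auto simp: locally_integrable01_def)
    show "(LINT x|lebesgue01. (f x - g x) * \<phi> x) = 0" if "\<phi> \<in> test_functions" for \<phi>
      using that assms by (simp add: left_diff_distrib integrable_times_test_function)
  qed
  then show ?thesis by simp
qed

text \<open>Both derivatives have the same test integrals, so the fundamental lemma identifies them.
  This ties the witness w of a distributional statement to a classical derivative.\<close>

lemma weak_deriv_C1:
  assumes u: "weak_deriv u w" and up: "AE x in lebesgue01. u x = p x"
    and p: "\<And>x. x \<in> {0<..<1} \<Longrightarrow> (p has_real_derivative q x) (at x)"
    and q: "continuous_on {0<..<1} q"
  shows "AE x in lebesgue01. w x = q x"
proof (rule AE_eq_if_test_integrals_eq)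
  have "continuous_on {0<..<1} p"
    using p DERIV_isCont by (blast intro: continuous_at_imp_continuous_on)
  then have li: "locally_integrable01 p" "locally_integrable01 q" "locally_integrable01 u" "locally_integrable01 w"
    using q u by (auto simp: weak_deriv_def continuous_locally_integrable01)
  then show "locally_integrable01 q" "locally_integrable01 w" by auto
  fix \<phi> assume \<phi>: "\<phi> \<in> test_functions"
  have "(LINT x|lebesgue01. w x * \<phi> x) = - (LINT x|lebesgue01. u x * deriv \<phi> x)"
    using u \<phi> by (simp add: weak_deriv_def)
  also have "(LINT x|lebesgue01. u x * deriv \<phi> x) = (LINT x|lebesgue01. p x * deriv \<phi> x)"
    using li by (intro integrable_times_test_function_cong up locally_integrable01_measurable deriv_test_function \<phi>)
  also have "\<dots> = - (LINT x|lebesgue01. q x * \<phi> x)"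
    by (rule integral_by_parts_test_function[OF p q \<phi>])
  finally show "(LINT x|lebesgue01. w x * \<phi> x) = (LINT x|lebesgue01. q x * \<phi> x)" by simp
qed

section \<open>Increments of continuous functions from distributional derivatives\<close>

lemma deriv_bump:
  assumes "0 < s" "a < b"
  shows "deriv (bump s a b 0 0) x = s * (bump s a b 2 0 x - bump s a b 0 2 x)"
  using DERIV_imp_deriv[OF bump_has_derivative[OF assms, of 0 0 x]]
  by (simp add: numeral_2_eq_2 algebra_simps)

text \<open>The bump rises from 0 to its value at the midpoint and falls back to 0, so its variation
  is twice a number at most 1. What matters is that the bound does not depend on s.\<close>

lemma bump_total_variation:
  assumes s: "0 < s" and ab: "0 < a" "a < b" "b < 1"
  shows "integral\<^sup>L (lebesgue_on {a..b}) (\<lambda>x. \<bar>deriv (bump s a b 0 0) x\<bar>) \<le> 2"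
proof -
  define B where "B = bump s a b 0 0"
  define m where "m = (a + b) / 2"
  have m: "a \<le> m" "m \<le> b" using ab by (auto simp: m_def)
  have B: "B \<in> test_functions" using bump_test_function[OF s ab] by (simp add: B_def)
  have dB: "deriv B x = s * (bump s a b 2 0 x - bump s a b 0 2 x)" for x
    using deriv_bump[OF s ab(2)] by (simp add: B_def)
  \<comment> \<open>Inside the interval the sign of the derivative is that of 1/(x - a)^2 - 1/(b -
    x)^2, which changes at the midpoint.\<close>
  have mono: "(1 / (b - x)) ^ 2 \<le> (1 / (x - a)) ^ 2" if "a < x" "x \<le> m" for x
    using that ab by (intro power_mono frac_le) (auto simp: m_def)
  have mono': "(1 / (x - a)) ^ 2 \<le> (1 / (b - x)) ^ 2" if "m \<le> x" "x < b" for x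
    using that ab by (intro power_mono frac_le) (auto simp: m_def)
  have pos: "0 \<le> deriv B x" if "a \<le> x" "x \<le> m" for x
    using mono[of x] that m s unfolding dB
    by (auto simp: bump_def intro!: mult_nonneg_nonneg)
  have neg: "deriv B x \<le> 0" if "m \<le> x" "x \<le> b" for x
    using mono'[of x] that m s unfolding dB
    by (auto simp: bump_def intro!: mult_nonneg_nonpos)
  have ftc: "(deriv B has_integral (B d - B c)) {c..d}" if "c \<le> d" for c d
    using test_function_deriv[OF B] that
    by (intro fundamental_theorem_of_calculus)
       (auto simp: has_real_derivative_iff_has_vector_derivative has_vector_derivative_at_within)
  have "((\<lambda>x. \<bar>deriv B x\<bar>) has_integral (B m - B a)) {a..m}"
    by (rule has_integral_eq[OF _ ftc[OF m(1)]]) (use pos in auto)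
  moreover have "((\<lambda>x. \<bar>deriv B x\<bar>) has_integral - (B b - B m)) {m..b}"
    by (rule has_integral_eq[OF _ has_integral_neg[OF ftc[OF m(2)]]]) (use neg in auto)
  ultimately have "((\<lambda>x. \<bar>deriv B x\<bar>) has_integral ((B m - B a) + - (B b - B m))) {a..b}"
    using m by (intro has_integral_combine[of a m b])
  then have "integral\<^sup>L (lebesgue_on {a..b}) (\<lambda>x. \<bar>deriv B x\<bar>) = (B m - B a) + - (B b - B m)"
    by (intro continuous_on_lebesgue_has_integral continuous_intros continuous_on_test_function deriv_test_function B)
  also have "\<dots> \<le> 2"
    using bump_le_1[OF s, of a b m] by (simp add: B_def bump_def)
  finally show ?thesis by (simp add: B_def)
qed

text \<open>Derivatives of bumps tend to the difference of the point masses at a and b. Integration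
  by parts is not possible for a merely continuous y; a polynomial replaces it, with an error
  controlled by the bounded variation of the bumps.\<close>

lemma integral_deriv_bump_limit:
  fixes y :: "real \<Rightarrow> real"
  assumes y: "continuous_on {0<..<1} y" and ab: "0 < a" "a < b" "b < 1"
  shows "(\<lambda>n. LINT x|lebesgue01. y x * deriv (bump (1 / real (Suc n)) a b 0 0) x) \<longlonglongrightarrow> y a - y b"
proof (rule LIMSEQ_I)
  fix r :: real assume r: "0 < r"
  define B where "B n = bump (1 / real (Suc n)) a b 0 0" for n
  have B: "B n \<in> test_functions" for n using bump_test_function[OF _ ab] by (simp add: B_def)
  have B0: "deriv (B n) x = 0" if "x \<notin> {a..b}" for n x
    using that ab by (intro deriv_eq_0_outside[of "{a..b}"]) (auto simp: B_def bump_def)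
  have sub: "{a..b} \<subseteq> {0<..<1}" using ab by auto
  \<comment> \<open>Error budget: exchanging y for the polynomial under the integral costs 2e, the
    limit for the polynomial e, and the two endpoint values e each, in total 5e < r.\<close>
  define e where "e = r / 6"
  have e: "0 < e" using r by (simp add: e_def)
  obtain P where P: "real_polynomial_function P" "\<And>x. x \<in> {a..b} \<Longrightarrow> \<bar>y x - P x\<bar> < e"
    using Stone_Weierstrass_real_polynomial_function[OF compact_Icc continuous_on_subset[OF y sub] e] by metis
  obtain P' where P': "real_polynomial_function P'" "\<And>x. (P has_real_derivative P' x) (at x)"
    using has_real_derivative_polynomial_function[OF P(1)] by blast
  have cP: "continuous_on S P'" "continuous_on S P" for S
    using P(1) P'(1) continuous_on_polymonial_function by (auto simp: real_polynomial_function_eq)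
  have "(\<lambda>n. LINT x|lebesgue01. P' x * B n x) \<longlonglongrightarrow> integral\<^sup>L (lebesgue_on {a..b}) P'"
    unfolding B_def by (intro integral_bump_limit continuous_locally_integrable01 cP ab)
  moreover have "(P' has_integral (P b - P a)) {a..b}"
    using P'(2) ab
    by (intro fundamental_theorem_of_calculus)
       (auto simp: has_real_derivative_iff_has_vector_derivative[symmetric] intro: has_field_derivative_at_within)
  then have "integral\<^sup>L (lebesgue_on {a..b}) P' = P b - P a"
    by (intro continuous_on_lebesgue_has_integral cP)
  moreover have "(LINT x|lebesgue01. P x * deriv (B n) x) = - (LINT x|lebesgue01. P' x * B n x)" for n
    by (intro integral_by_parts_test_function P'(2) cP B)
  ultimately have "(\<lambda>n. LINT x|lebesgue01. P x * deriv (B n) x) \<longlonglongrightarrow> - (P b - P a)"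
    by (simp only: tendsto_minus)
  then have "(\<lambda>n. LINT x|lebesgue01. P x * deriv (B n) x) \<longlonglongrightarrow> P a - P b" by simp
  from LIMSEQ_D[OF this, of e] e obtain N where
    N: "\<And>n. n \<ge> N \<Longrightarrow> \<bar>(LINT x|lebesgue01. P x * deriv (B n) x) - (P a - P b)\<bar> < e" by auto
  have "\<bar>(LINT x|lebesgue01. y x * deriv (B n) x) - (y a - y b)\<bar> < r" if n: "n \<ge> N" for n
  proof -
    have i: "integrable lebesgue01 (\<lambda>x. y x * deriv (B n) x)" "integrable lebesgue01 (\<lambda>x. P x * deriv (B n) x)"
      by (intro integrable_times_test_function continuous_locally_integrable01 y cP deriv_test_function B)+
    have "(LINT x|lebesgue01. y x * deriv (B n) x) - (LINT x|lebesgue01. P x * deriv (B n) x)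
        = (LINT x|lebesgue01. (y x - P x) * deriv (B n) x)"
      using i by (simp add: left_diff_distrib)
    also have "\<dots> = (LINT x|lebesgue_on {a..b}. (y x - P x) * deriv (B n) x)"
      using ab B0 by (intro integral_lebesgue01_support) auto
    finally have eq: "(LINT x|lebesgue01. y x * deriv (B n) x) - (LINT x|lebesgue01. P x * deriv (B n) x)
        = (LINT x|lebesgue_on {a..b}. (y x - P x) * deriv (B n) x)" .
    have c: "continuous_on {a..b} (\<lambda>x. (y x - P x) * deriv (B n) x)" "continuous_on {a..b} (deriv (B n))"
      by (intro continuous_intros continuous_on_subset[OF y sub] cP continuous_on_test_function deriv_test_function B)+
    have "\<bar>LINT x|lebesgue_on {a..b}. (y x - P x) * deriv (B n) x\<bar>
       \<le> (LINT x|lebesgue_on {a..b}. \<bar>(y x - P x) * deriv (B n) x\<bar>)"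
      by (rule integral_abs_bound)
    also have "\<dots> \<le> (LINT x|lebesgue_on {a..b}. e * \<bar>deriv (B n) x\<bar>)"
    proof (rule integral_mono)
      show "\<bar>(y x - P x) * deriv (B n) x\<bar> \<le> e * \<bar>deriv (B n) x\<bar>" if "x \<in> space (lebesgue_on {a..b})" for x
        using less_imp_le[OF P(2)[of x]] that by (auto simp: abs_mult intro!: mult_right_mono)
    qed (use c in \<open>auto intro!: continuous_imp_integrable_real continuous_intros\<close>)
    also have "\<dots> \<le> e * 2"
      using bump_total_variation[OF _ ab, of "1 / real (Suc n)"] e by (simp add: B_def)
    finally have "\<bar>(LINT x|lebesgue01. y x * deriv (B n) x) - (LINT x|lebesgue01. P x * deriv (B n) x)\<bar> \<le> e * 2"
      using eq by simp
    moreover have "\<bar>y a - P a\<bar> < e" "\<bar>y b - P b\<bar> < e" using P(2) ab by auto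
    ultimately show ?thesis using N[OF n] unfolding e_def by linarith
  qed
  then show "\<exists>no. \<forall>n\<ge>no. norm ((LINT x|lebesgue01. y x * deriv (bump (1 / real (Suc n)) a b 0 0) x) - (y a - y b)) < r"
    unfolding B_def[symmetric] by auto
qed

text \<open>Testing the distributional equation with bumps and letting s tend to 0 turns its two
  sides into y a - y b and minus the integral of z.\<close>

lemma weak_deriv_increment:
  fixes y :: "real \<Rightarrow> real"
  assumes v: "weak_deriv v z" and vy: "AE x in lebesgue01. v x = y x"
    and y: "continuous_on {0<..<1} y" and ab: "0 < a" "a < b" "b < 1"
  shows "y b - y a = integral\<^sup>L (lebesgue_on {a..b}) z"
proof -
  have z: "locally_integrable01 z" "locally_integrable01 v" using v by (auto simp: weak_deriv_def)
  define B where "B n = bump (1 / real (Suc n)) a b 0 0" for n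
  have B: "B n \<in> test_functions" for n using bump_test_function[OF _ ab] by (simp add: B_def)
  have "(LINT x|lebesgue01. y x * deriv (B n) x) = - (LINT x|lebesgue01. z x * B n x)" for n
  proof -
    have "(LINT x|lebesgue01. y x * deriv (B n) x) = (LINT x|lebesgue01. v x * deriv (B n) x)"
    proof (rule integrable_times_test_function_cong)
      show "AE x in lebesgue01. y x = v x" using vy by eventually_elim simp
    qed (intro locally_integrable01_measurable continuous_locally_integrable01[OF y] z deriv_test_function B)+
    then show ?thesis using v B[of n] by (simp add: weak_deriv_def)
  qed
  moreover have "(\<lambda>n. LINT x|lebesgue01. y x * deriv (B n) x) \<longlonglongrightarrow> y a - y b"
    unfolding B_def by (rule integral_deriv_bump_limit[OF y ab])
  ultimately have "(\<lambda>n. - (LINT x|lebesgue01. z x * B n x)) \<longlonglongrightarrow> y a - y b" by simp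
  moreover have "(\<lambda>n. - (LINT x|lebesgue01. z x * B n x)) \<longlonglongrightarrow> - integral\<^sup>L (lebesgue_on {a..b}) z"
    unfolding B_def by (intro tendsto_minus integral_bump_limit z ab)
  ultimately have "y a - y b = - integral\<^sup>L (lebesgue_on {a..b}) z" by (rule LIMSEQ_unique)
  then show ?thesis by simp
qed

section \<open>Absolutely continuous functions\<close>

text \<open>Absolute continuity encoded by its fundamental theorem of calculus: f is a primitive of
  an integrable, possibly discontinuous g. In this form the product rule can be proved without
  differentiation almost everywhere.\<close>

definition absolutely_continuous_with :: "(real \<Rightarrow> real) \<Rightarrow> (real \<Rightarrow> real) \<Rightarrow> real \<Rightarrow> real \<Rightarrow> bool" where
  "absolutely_continuous_with f g a b \<longleftrightarrow> g absolutely_integrable_on {a..b} \<and>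
     (\<forall>c d. a \<le> c \<longrightarrow> c \<le> d \<longrightarrow> d \<le> b \<longrightarrow> f d - f c = integral {c..d} g)"

lemma absolutely_continuous_with_continuous:
  assumes "absolutely_continuous_with f g a b"
  shows "continuous_on {a..b} f"
proof -
  have "g integrable_on {a..b}"
    using assms by (auto simp: absolutely_continuous_with_def dest: set_lebesgue_integral_eq_integral)
  then have "continuous_on {a..b} (\<lambda>x. f a + integral {a..x} g)"
    by (intro continuous_intros indefinite_integral_continuous_1)
  moreover have "f a + integral {a..x} g = f x" if "x \<in> {a..b}" for x
    using assms that unfolding absolutely_continuous_with_def by force
  ultimately show ?thesis by (rule continuous_on_eq)
qed

lemma absolutely_integrable_subinterval:
  fixes g :: "real \<Rightarrow> real"
  assumes "g absolutely_integrable_on {a..b}" "a \<le> c" "d \<le> b"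
  shows "g absolutely_integrable_on {c..d}"
  using assms by (auto intro: set_integrable_subset)

lemma absolutely_integrable_times_continuous:
  fixes g h :: "real \<Rightarrow> real"
  assumes "g absolutely_integrable_on {a..b}" "continuous_on {a..b} h"
  shows "(\<lambda>x. g x * h x) absolutely_integrable_on {a..b}"
proof -
  have "(\<lambda>x. h x * g x) absolutely_integrable_on {a..b}"
    using assms
    by (intro absolutely_integrable_bounded_measurable_product_real continuous_imp_measurable_on_sets_lebesgue
          compact_imp_bounded compact_continuous_image) auto
  then show ?thesis by (simp add: mult.commute)
qed

text \<open>Cut the interval into equal steps shorter than \<delta>: the increments telescope on
  both sides and leave the bound e (Z d - Z c) with e arbitrary.\<close>

lemma constant_if_increments_small:
  fixes F Z :: "real \<Rightarrow> real"
  assumes cd: "c \<le> d"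
    and small: "\<And>e. 0 < e \<Longrightarrow> \<exists>\<delta>>0. \<forall>x y. c \<le> x \<longrightarrow> x \<le> y \<longrightarrow> y \<le> d \<longrightarrow> y - x < \<delta> \<longrightarrow> \<bar>F y - F x\<bar> \<le> e * (Z y - Z x)"
  shows "F d = F c"
proof -
  have *: "\<bar>F d - F c\<bar> \<le> e * (Z d - Z c)" if e: "0 < e" for e
  proof -
    obtain \<delta> where \<delta>0: "0 < \<delta>" and
      "\<forall>x y. c \<le> x \<longrightarrow> x \<le> y \<longrightarrow> y \<le> d \<longrightarrow> y - x < \<delta> \<longrightarrow> \<bar>F y - F x\<bar> \<le> e * (Z y - Z x)"
      using small[OF e] by blast
    note \<delta> = \<delta>0 this(2)[rule_format]
    obtain n where n: "(d - c) / \<delta> < real n" "0 < n"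
    proof -
      obtain n where "(d - c) / \<delta> < real n" using reals_Archimedean2 by blast
      then have "(d - c) / \<delta> < real (Suc n)" by simp
      then show ?thesis using that by blast
    qed
    define h where "h = (d - c) / real n"
    have h: "0 \<le> h" "h * real n = d - c" using n(2) cd by (auto simp: h_def)
    have h\<delta>: "h < \<delta>"
      using n \<delta>(1) by (simp add: h_def pos_divide_less_eq mult.commute)
    have "\<bar>F (c + h * real i) - F c\<bar> \<le> e * (Z (c + h * real i) - Z c)" if "i \<le> n" for i
      using that
    proof (induction i)
      case (Suc i)
      have "h * real (Suc i) \<le> h * real n" using Suc h by (intro mult_left_mono) auto
      then have "c + h * real (Suc i) \<le> d" using h(2) by linarith
      moreover have "h * real (Suc i) = h * real i + h" by (simp add: distrib_left)
      moreover have "0 \<le> h * real i" using h(1) by simp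
      ultimately have "\<bar>F (c + h * real (Suc i)) - F (c + h * real i)\<bar> \<le> e * (Z (c + h * real (Suc i)) - Z (c + h * real i))"
        using h(1) h\<delta> by (intro \<delta>(2)) linarith+
      moreover have "\<bar>F (c + h * real i) - F c\<bar> \<le> e * (Z (c + h * real i) - Z c)" using Suc by simp
      ultimately show ?case unfolding right_diff_distrib by linarith
    qed simp
    from this[of n] show ?thesis using h(2) by simp
  qed
  have **: "\<bar>F d - F c\<bar> \<le> e * \<bar>Z d - Z c\<bar>" if "0 < e" for e
  proof -
    have "e * (Z d - Z c) \<le> e * \<bar>Z d - Z c\<bar>" using that by (intro mult_left_mono) auto
    with *[OF that] show ?thesis by linarith
  qed
  have "\<bar>F d - F c\<bar> \<le> 0"
  proof (rule field_le_epsilon)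
    fix r :: real assume r: "0 < r"
    have "\<bar>F d - F c\<bar> \<le> r / (1 + \<bar>Z d - Z c\<bar>) * \<bar>Z d - Z c\<bar>" using r by (intro **) simp
    also have "\<dots> \<le> r" using r by (simp add: field_simps)
    finally show "\<bar>F d - F c\<bar> \<le> 0 + r" by simp
  qed
  then show ?thesis by simp
qed

text \<open>The product minus the primitive of the proposed derivative is constant: over a short
  interval its increment is an integral of g1 and g2 against oscillations of f2 and f1, which
  uniform continuity makes small relative to the integral of
  \<open>\<bar>g1\<bar> + \<bar>g2\<bar>\<close>.\<close>

lemma absolutely_continuous_with_mult:
  assumes 1: "absolutely_continuous_with f1 g1 a b" and 2: "absolutely_continuous_with f2 g2 a b"
  shows "absolutely_continuous_with (\<lambda>x. f1 x * f2 x) (\<lambda>x. g1 x * f2 x + g2 x * f1 x) a b"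
proof -
  define G where "G x = g1 x * f2 x + g2 x * f1 x" for x
  have c: "continuous_on {a..b} f1" "continuous_on {a..b} f2"
    using 1 2 absolutely_continuous_with_continuous by auto
  have g: "g1 absolutely_integrable_on {a..b}" "g2 absolutely_integrable_on {a..b}"
    using 1 2 by (auto simp: absolutely_continuous_with_def)
  have G: "G absolutely_integrable_on {a..b}"
    unfolding G_def using c g by (intro set_integral_add absolutely_integrable_times_continuous)
  have "f1 d * f2 d - f1 c * f2 c = integral {c..d} G" if cd: "a \<le> c" "c \<le> d" "d \<le> b" for c d
  proof -
    define \<Phi> where "\<Phi> x = f1 x * f2 x - integral {c..x} G" for x
    define Z where "Z x = integral {c..x} (\<lambda>t. \<bar>g1 t\<bar> + \<bar>g2 t\<bar>)" for x
    have io: "G integrable_on {x..y}" "g1 integrable_on {x..y}" "g2 integrable_on {x..y}"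
         "(\<lambda>t. \<bar>g1 t\<bar> + \<bar>g2 t\<bar>) integrable_on {x..y}" "(\<lambda>t. \<bar>g1 t\<bar>) integrable_on {x..y}"
      if "c \<le> x" "y \<le> d" for x y
    proof -
      have "G absolutely_integrable_on {x..y}" "g1 absolutely_integrable_on {x..y}" "g2 absolutely_integrable_on {x..y}"
        using G g that cd by (auto intro: absolutely_integrable_subinterval)
      then show "G integrable_on {x..y}" "g1 integrable_on {x..y}" "g2 integrable_on {x..y}"
         "(\<lambda>t. \<bar>g1 t\<bar> + \<bar>g2 t\<bar>) integrable_on {x..y}" "(\<lambda>t. \<bar>g1 t\<bar>) integrable_on {x..y}"
        by (auto simp: absolutely_integrable_on_def intro!: integrable_add)
    qed
    have "\<Phi> d = \<Phi> c"
    proof (rule constant_if_increments_small[OF cd(2), where Z = Z])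
      fix e :: real assume e: "0 < e"
      have "uniformly_continuous_on {a..b} f1" "uniformly_continuous_on {a..b} f2"
        using c by (auto intro: compact_uniformly_continuous)
      then have u: "\<exists>r>0. \<forall>x\<in>{a..b}. \<forall>y\<in>{a..b}. \<bar>y - x\<bar> < r \<longrightarrow> \<bar>f1 y - f1 x\<bar> < e"
          "\<exists>r>0. \<forall>x\<in>{a..b}. \<forall>y\<in>{a..b}. \<bar>y - x\<bar> < r \<longrightarrow> \<bar>f2 y - f2 x\<bar> < e"
        unfolding uniformly_continuous_on_def dist_real_def using e by blast+
      obtain d1 where d1: "0 < d1"
        "\<forall>x\<in>{a..b}. \<forall>y\<in>{a..b}. \<bar>y - x\<bar> < d1 \<longrightarrow> \<bar>f1 y - f1 x\<bar> < e" using u(1) by blast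
      obtain d2 where d2: "0 < d2"
        "\<forall>x\<in>{a..b}. \<forall>y\<in>{a..b}. \<bar>y - x\<bar> < d2 \<longrightarrow> \<bar>f2 y - f2 x\<bar> < e" using u(2) by blast
      note dd = d1(1) d2(1) d1(2)[rule_format] d2(2)[rule_format]
      have "\<bar>\<Phi> y - \<Phi> x\<bar> \<le> e * (Z y - Z x)" if xy: "c \<le> x" "x \<le> y" "y \<le> d" "y - x < min d1 d2" for x y
      proof -
        have f: "f1 y - f1 x = integral {x..y} g1" "f2 y - f2 x = integral {x..y} g2"
          using 1 2 xy cd by (auto simp: absolutely_continuous_with_def)
        have "integral {c..y} G = integral {c..x} G + integral {x..y} G"
          using xy by (intro Henstock_Kurzweil_Integration.integral_combine[symmetric] io) auto
        \<comment> \<open>The increment of the product is split with f2 taken at the right end and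
          f1 at the left end, so that both are constants under the integral.\<close>
        then have "\<Phi> y - \<Phi> x = (f1 y - f1 x) * f2 y + f1 x * (f2 y - f2 x) - integral {x..y} G"
          by (simp add: \<Phi>_def algebra_simps)
        also have "\<dots> = integral {x..y} (\<lambda>t. g1 t * f2 y + f1 x * g2 t - G t)"
        proof -
          have i: "(\<lambda>t. g1 t * f2 y) integrable_on {x..y}" "(\<lambda>t. f1 x * g2 t) integrable_on {x..y}"
            using integrable_on_mult_left[OF io(2)[OF xy(1,3)], of "f2 y"]
              integrable_on_mult_right[OF io(3)[OF xy(1,3)], of "f1 x"] by blast+
          show ?thesis
            unfolding f Henstock_Kurzweil_Integration.integral_diff[OF integrable_add[OF i] io(1)[OF xy(1,3)]]
              Henstock_Kurzweil_Integration.integral_add[OF i] by simp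
        qed
        finally have eq: "\<Phi> y - \<Phi> x = integral {x..y} (\<lambda>t. g1 t * f2 y + f1 x * g2 t - G t)" .
        have "norm (integral {x..y} (\<lambda>t. g1 t * f2 y + f1 x * g2 t - G t)) \<le> integral {x..y} (\<lambda>t. e * (\<bar>g1 t\<bar> + \<bar>g2 t\<bar>))"
        proof (rule integral_norm_bound_integral)
          show "(\<lambda>t. g1 t * f2 y + f1 x * g2 t - G t) integrable_on {x..y}"
            using integrable_on_mult_left[OF io(2)[OF xy(1,3)], of "f2 y"]
              integrable_on_mult_right[OF io(3)[OF xy(1,3)], of "f1 x"] io(1)[OF xy(1,3)]
            by (intro integrable_diff integrable_add)
          show "(\<lambda>t. e * (\<bar>g1 t\<bar> + \<bar>g2 t\<bar>)) integrable_on {x..y}"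
            using io[of x y] xy by (intro integrable_on_mult_right) auto
          fix t assume t: "t \<in> {x..y}"
          have "g1 t * f2 y + f1 x * g2 t - G t = g1 t * (f2 y - f2 t) + g2 t * (f1 x - f1 t)"
            by (simp add: G_def algebra_simps)
          moreover have "\<bar>g1 t * (f2 y - f2 t)\<bar> \<le> \<bar>g1 t\<bar> * e" "\<bar>g2 t * (f1 x - f1 t)\<bar> \<le> \<bar>g2 t\<bar> * e"
            unfolding abs_mult using less_imp_le[OF dd(4)[of t y]] less_imp_le[OF dd(3)[of t x]] t xy cd
            by (auto intro!: mult_left_mono)
          ultimately show "norm (g1 t * f2 y + f1 x * g2 t - G t) \<le> e * (\<bar>g1 t\<bar> + \<bar>g2 t\<bar>)"
            by (simp add: distrib_left mult.commute)
        qed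
        also have "\<dots> = e * integral {x..y} (\<lambda>t. \<bar>g1 t\<bar> + \<bar>g2 t\<bar>)" by simp
        also have "integral {x..y} (\<lambda>t. \<bar>g1 t\<bar> + \<bar>g2 t\<bar>) = Z y - Z x"
        proof -
          have "Z x + integral {x..y} (\<lambda>t. \<bar>g1 t\<bar> + \<bar>g2 t\<bar>) = Z y"
            unfolding Z_def using xy by (intro Henstock_Kurzweil_Integration.integral_combine io) auto
          then show ?thesis by simp
        qed
        finally show ?thesis using eq by simp
      qed
      then show "\<exists>\<delta>>0. \<forall>x y. c \<le> x \<longrightarrow> x \<le> y \<longrightarrow> y \<le> d \<longrightarrow> y - x < \<delta> \<longrightarrow> \<bar>\<Phi> y - \<Phi> x\<bar> \<le> e * (Z y - Z x)"
        using dd by (intro exI[of _ "min d1 d2"]) auto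
    qed
    then show ?thesis by (simp add: \<Phi>_def)
  qed
  then show ?thesis using G unfolding absolutely_continuous_with_def G_def by blast
qed

lemma absolutely_continuous_with_add:
  assumes "absolutely_continuous_with f1 g1 a b" "absolutely_continuous_with f2 g2 a b"
  shows "absolutely_continuous_with (\<lambda>x. f1 x + f2 x) (\<lambda>x. g1 x + g2 x) a b"
proof -
  have "f1 d + f2 d - (f1 c + f2 c) = integral {c..d} (\<lambda>x. g1 x + g2 x)" if "a \<le> c" "c \<le> d" "d \<le> b" for c d
  proof -
    have "g1 integrable_on {c..d}" "g2 integrable_on {c..d}"
      using assms that absolutely_integrable_subinterval[where a = a and b = b and c = c and d = d]
      by (auto simp: absolutely_continuous_with_def dest: set_lebesgue_integral_eq_integral(1))
    then have "integral {c..d} (\<lambda>x. g1 x + g2 x) = integral {c..d} g1 + integral {c..d} g2"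
      by (rule Henstock_Kurzweil_Integration.integral_add)
    moreover have "f1 d - f1 c = integral {c..d} g1" "f2 d - f2 c = integral {c..d} g2"
      using assms that by (auto simp: absolutely_continuous_with_def)
    ultimately show ?thesis by simp
  qed
  then show ?thesis using assms by (auto simp: absolutely_continuous_with_def intro: set_integral_add)
qed

lemma absolutely_continuous_with_C1:
  assumes "\<And>x. x \<in> {a..b} \<Longrightarrow> (f has_real_derivative g x) (at x within {a..b})" "continuous_on {a..b} g"
  shows "absolutely_continuous_with f g a b"
  unfolding absolutely_continuous_with_def
proof (intro conjI allI impI)
  show "g absolutely_integrable_on {a..b}" by (intro absolutely_integrable_continuous_real assms)
  fix c d assume cd: "a \<le> c" "c \<le> d" "d \<le> b"
  have "(g has_integral (f d - f c)) {c..d}"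
    using DERIV_subset[OF assms(1), of _ "{c..d}"] cd
    by (intro fundamental_theorem_of_calculus)
       (auto simp: has_real_derivative_iff_has_vector_derivative[symmetric])
  then show "f d - f c = integral {c..d} g" by (simp add: integral_unique)
qed

lemma absolutely_continuous_with_cong:
  assumes "absolutely_continuous_with f g a b"
    and "\<And>x. x \<in> {a..b} \<Longrightarrow> f x = f' x" "\<And>x. x \<in> {a..b} \<Longrightarrow> g x = g' x"
  shows "absolutely_continuous_with f' g' a b"
proof -
  have "g' absolutely_integrable_on {a..b}"
    using assms set_integrable_cong[of lebesgue lebesgue "{a..b}" "{a..b}" g g']
    by (auto simp: absolutely_continuous_with_def)
  moreover have "f' d - f' c = integral {c..d} g'" if "a \<le> c" "c \<le> d" "d \<le> b" for c d
  proof -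
    have "integral {c..d} g = integral {c..d} g'"
      using that assms(3) by (intro Henstock_Kurzweil_Integration.integral_cong) auto
    then show ?thesis using assms that by (auto simp: absolutely_continuous_with_def)
  qed
  ultimately show ?thesis by (auto simp: absolutely_continuous_with_def)
qed

section \<open>Limits at the degenerate endpoint 0\<close>

lemma integral_tendsto_at_right_0:
  fixes f :: "real \<Rightarrow> real"
  assumes f: "integrable (lebesgue_on {0<..<1}) f"
  shows "((\<lambda>x. integral {x..1} f) \<longlongrightarrow> integral\<^sup>L (lebesgue_on {0<..<1}) f) (at_right 0)"
proof -
  have "(f has_integral integral\<^sup>L (lebesgue_on {0<..<1}) f) {0<..<1}"
    using f by (intro has_integral_integral_lebesgue_on) auto
  then have I: "(f has_integral integral\<^sup>L (lebesgue_on {0<..<1}) f) {0..1}"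
    by (simp add: has_integral_Icc_iff_Ioo)
  then have i: "f integrable_on {0..1}" by blast
  have "continuous_on {0..1} (\<lambda>x. integral {0..x} f)"
    by (rule indefinite_integral_continuous_1[OF i])
  then have "((\<lambda>x. integral {0..x} f) \<longlongrightarrow> integral {0..0} f) (at 0 within {0..1})"
    unfolding continuous_on by (rule bspec) simp
  then have "((\<lambda>x. integral {0..x} f) \<longlongrightarrow> 0) (at_right 0)"
    by (simp add: at_within_Icc_at_right)
  then have "((\<lambda>x. integral {0..1} f - integral {0..x} f) \<longlongrightarrow> integral {0..1} f - 0) (at_right 0)"
    by (intro tendsto_intros)
  moreover have "\<forall>\<^sub>F x in at_right 0. integral {0..1} f - integral {0..x} f = integral {x..1} f"
    unfolding eventually_at_right_field
  proof (intro exI[of _ 1] conjI allI impI)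
    fix x :: real assume x: "0 < x" "x < 1"
    then show "integral {0..1} f - integral {0..x} f = integral {x..1} f"
      using Henstock_Kurzweil_Integration.integral_combine[of 0 x 1 f] i by simp
  qed simp
  ultimately show ?thesis
    using I by (simp add: integral_unique Lim_transform_eventually)
qed

text \<open>A nonzero limit L would keep \<open>\<bar>F x / x\<bar>\<close> above \<bar>L\<bar>/(2x)
  near 0, and the integral of 1/x diverges logarithmically.\<close>

lemma limit_eq_0_if_quotient_integrable:
  fixes F :: "real \<Rightarrow> real"
  assumes F: "(F \<longlongrightarrow> L) (at_right 0)" and i: "integrable (lebesgue_on {0<..<1}) (\<lambda>x. F x / x)"
  shows "L = 0"
proof (rule ccontr)
  assume L: "L \<noteq> 0"
  have "\<forall>\<^sub>F x in at_right 0. dist (F x) L < \<bar>L\<bar> / 2"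
    using tendstoD[OF F, of "\<bar>L\<bar> / 2"] L by simp
  then obtain \<delta> where \<delta>: "0 < \<delta>" "\<And>x. 0 < x \<Longrightarrow> x < \<delta> \<Longrightarrow> \<bar>F x - L\<bar> < \<bar>L\<bar> / 2"
    unfolding eventually_at_right_field dist_real_def by auto
  define d where "d = min (\<delta> / 2) (1/2)"
  have d: "0 < d" "d < \<delta>" "d < 1" using \<delta> by (auto simp: d_def)
  define M where "M = 2 / \<bar>L\<bar> * integral {0<..<1} (\<lambda>x. \<bar>F x / x\<bar>)"
  have ia: "(\<lambda>x. \<bar>F x / x\<bar>) integrable_on {0<..<1}"
    by (rule integrable_on_lebesgue_on[OF integrable_abs[OF i]]) simp
  have bound: "ln d - ln c \<le> M" if c: "0 < c" "c \<le> d" for c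
  proof -
    have hi: "((\<lambda>x. 1 / x) has_integral (ln d - ln c)) {c..d}"
      using c by (intro fundamental_theorem_of_calculus)
        (auto simp: has_real_derivative_iff_has_vector_derivative[symmetric] intro!: derivative_eq_intros)
    have s: "(\<lambda>x. \<bar>F x / x\<bar>) integrable_on {c..d}"
      using c d by (intro integrable_on_subinterval[OF ia]) auto
    have "ln d - ln c \<le> integral {c..d} (\<lambda>x. 2 / \<bar>L\<bar> * \<bar>F x / x\<bar>)"
      unfolding integral_unique[OF hi, symmetric]
    proof (rule integral_le)
      fix x assume x: "x \<in> {c..d}"
      then have "\<bar>F x - L\<bar> < \<bar>L\<bar> / 2" using c d by (intro \<delta>) auto
      then have "\<bar>L\<bar> / 2 \<le> \<bar>F x\<bar>" by linarith
      then show "1 / x \<le> 2 / \<bar>L\<bar> * \<bar>F x / x\<bar>"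
        using x c L by (simp add: field_simps abs_divide)
    qed (use hi integrable_on_mult_right[OF s] in blast)+
    also have "\<dots> = 2 / \<bar>L\<bar> * integral {c..d} (\<lambda>x. \<bar>F x / x\<bar>)"
      by (rule Henstock_Kurzweil_Integration.integral_mult_right)
    also have "\<dots> \<le> M" unfolding M_def
      using c d by (intro mult_left_mono integral_subset_le s ia) auto
    finally show ?thesis .
  qed
  \<comment> \<open>With this left end ln d - ln c equals \<bar>M\<bar> + 1, which exceeds the bound
    M.\<close>
  have "d * exp (- \<bar>M\<bar> - 1) \<le> d" using d by (simp add: mult_le_cancel_left1)
  from bound[OF _ this] d show False by (simp add: ln_mult)
qed

section \<open>Orbits of strongly continuous semigroups\<close>

text \<open>X lies in an ambient vector space whose own topology is not that of N. The linear map J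
  into a normed space carries N, so limits and completeness are expressed through J.\<close>

locale normed_semigroup =
  fixes X :: "'a::real_vector set" and J :: "'a \<Rightarrow> 'b::real_normed_vector"
    and N :: "'a \<Rightarrow> real" and S :: "real \<Rightarrow> 'a \<Rightarrow> 'a"
  assumes subspace: "subspace X"
    and J_add: "x \<in> X \<Longrightarrow> y \<in> X \<Longrightarrow> J (x + y) = J x + J y"
    and J_scaleR: "x \<in> X \<Longrightarrow> J (c *\<^sub>R x) = c *\<^sub>R J x"
    and N_eq: "x \<in> X \<Longrightarrow> N x = norm (J x)"
    and complete: "(\<And>n. \<xi> n \<in> X) \<Longrightarrow> Cauchy (\<lambda>n::nat. J (\<xi> n)) \<Longrightarrow> \<exists>x\<in>X. (\<lambda>n. J (\<xi> n)) \<longlonglongrightarrow> J x"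
    and semigroup: "C0_semigroup X N S"
begin

lemma in_X: "0 \<in> X" "x \<in> X \<Longrightarrow> y \<in> X \<Longrightarrow> x + y \<in> X" "x \<in> X \<Longrightarrow> y \<in> X \<Longrightarrow> x - y \<in> X"
  "x \<in> X \<Longrightarrow> c *\<^sub>R x \<in> X"
  using subspace by (auto simp: subspace_def intro: subspace_diff)

lemma linear_on_diff:
  assumes "\<And>x y. x \<in> X \<Longrightarrow> y \<in> X \<Longrightarrow> F (x + y) = F x + F y"
    and "\<And>x c. x \<in> X \<Longrightarrow> F (c *\<^sub>R x) = c *\<^sub>R F x" and "x \<in> X" "y \<in> X"
  shows "F (x - y) = F x - (F y :: 'c::real_vector)"
proof -
  have "F (x + (-1) *\<^sub>R y) = F x + (-1) *\<^sub>R F y"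
    using assms in_X(4)[of y "-1"] by (simp only:)
  then show ?thesis by simp
qed

lemma J_diff: "x \<in> X \<Longrightarrow> y \<in> X \<Longrightarrow> J (x - y) = J x - J y"
  using linear_on_diff[of J] J_add J_scaleR by blast

lemma S_in: "0 \<le> t \<Longrightarrow> x \<in> X \<Longrightarrow> S t x \<in> X"
  and S_add: "0 \<le> t \<Longrightarrow> x \<in> X \<Longrightarrow> y \<in> X \<Longrightarrow> S t (x + y) = S t x + S t y"
  and S_scaleR: "0 \<le> t \<Longrightarrow> x \<in> X \<Longrightarrow> S t (c *\<^sub>R x) = c *\<^sub>R S t x"
  and S_0: "x \<in> X \<Longrightarrow> S 0 x = x"
  and S_plus: "0 \<le> s \<Longrightarrow> 0 \<le> t \<Longrightarrow> x \<in> X \<Longrightarrow> S (s + t) x = S s (S t x)"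
  using semigroup by (auto simp: C0_semigroup_def)

lemma S_diff: "0 \<le> t \<Longrightarrow> x \<in> X \<Longrightarrow> y \<in> X \<Longrightarrow> S t (x - y) = S t x - S t y"
  using linear_on_diff[of "S t"] S_add S_scaleR by blast

lemma S_bounded: "0 \<le> t \<Longrightarrow> \<exists>M. \<forall>x\<in>X. norm (J (S t x)) \<le> M * norm (J x)"
  using semigroup unfolding C0_semigroup_def by (metis N_eq)

lemma S_tendsto:
  assumes "x \<in> X"
  shows "((\<lambda>t. norm (J (S t x - x))) \<longlongrightarrow> 0) (at_right 0)"
proof -
  have "((\<lambda>t. N (S t x - x)) \<longlongrightarrow> 0) (at_right 0)" using semigroup assms by (auto simp: C0_semigroup_def)
  moreover have "\<forall>\<^sub>F t in at_right 0. N (S t x - x) = norm (J (S t x - x))"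
    using assms by (auto simp: eventually_at_right_field intro!: exI[of _ 1] N_eq in_X S_in)
  ultimately show ?thesis by (rule Lim_transform_eventually)
qed

text \<open>K is the operator norm of \<open>S t\<close>, a supremum over the unit ball; the factor
  3/4 allows a single vector w to come close to it.\<close>

lemma almost_norming_vector:
  assumes t: "0 \<le> t" and C: "0 \<le> C" and unb: "\<not> (\<forall>x\<in>X. norm (J (S t x)) \<le> C * norm (J x))"
  shows "\<exists>K w. C < K \<and> 0 < K \<and> w \<in> X \<and> norm (J w) \<le> 1 \<and> 3/4 * K < norm (J (S t w)) \<and>
           (\<forall>x\<in>X. norm (J (S t x)) \<le> K * norm (J x))"
proof -
  obtain M where M: "\<And>x. x \<in> X \<Longrightarrow> norm (J (S t x)) \<le> M * norm (J x)" using S_bounded[OF t] by blast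
  define A where "A = {norm (J (S t x)) | x. x \<in> X \<and> norm (J x) \<le> 1}"
  define K where "K = Sup A"
  have bdd: "bdd_above A"
  proof (rule bdd_aboveI)
    fix r assume "r \<in> A"
    then obtain x where x: "x \<in> X" "norm (J x) \<le> 1" "r = norm (J (S t x))" by (auto simp: A_def)
    have "M * norm (J x) \<le> \<bar>M\<bar> * 1" using x(2) by (intro mult_mono) auto
    then show "r \<le> \<bar>M\<bar>" using M[OF x(1)] x(3) by simp
  qed
  have KA: "norm (J (S t x)) \<le> K" if "x \<in> X" "norm (J x) \<le> 1" for x
    unfolding K_def using that by (intro cSup_upper bdd) (auto simp: A_def)
  have K: "norm (J (S t x)) \<le> K * norm (J x)" if x: "x \<in> X" for x
  proof (cases "norm (J x) = 0")
    case True
    then show ?thesis using M[OF x] by simp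
  next
    case False
    define z where "z = (1 / norm (J x)) *\<^sub>R x"
    have z: "z \<in> X" "norm (J z) \<le> 1" using x False by (auto simp: z_def in_X J_scaleR)
    have "norm (J (S t z)) = norm (J (S t x)) / norm (J x)"
      using x t by (simp add: z_def S_scaleR J_scaleR S_in)
    then show ?thesis using KA[OF z] False by (simp add: pos_divide_le_eq)
  qed
  obtain x0 where x0: "x0 \<in> X" "C * norm (J x0) < norm (J (S t x0))" using unb by (auto simp: not_le)
  have "norm (J x0) \<noteq> 0" using M[OF x0(1)] x0(2) by auto
  then have n0: "0 < norm (J x0)" by simp
  have CK: "C < K" using K[OF x0(1)] x0(2) n0 by (meson less_le_trans mult_less_cancel_right_pos)
  have "0 < norm (J (S t x0))" using x0(2) C n0 by (meson le_less_trans less_imp_le mult_nonneg_nonneg)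
  then have Kpos: "0 < K" using K[OF x0(1)] n0 by (metis dual_order.strict_trans1 zero_less_mult_pos2)
  have ne: "A \<noteq> {}" using in_X(1) J_scaleR[OF in_X(1), of 0] by (auto simp: A_def)
  have "3/4 * K < Sup A" using Kpos by (simp add: K_def[symmetric])
  then obtain r where "r \<in> A" "3/4 * K < r" using less_cSup_iff[OF ne bdd] by blast
  then show ?thesis using CK Kpos K by (auto simp: A_def)
qed

text \<open>Gliding hump: if \<open>\<parallel>S (t n)\<parallel> > 4\<^sup>n\<close> with \<open>t n \<rightarrow> 0\<close>, a series \<open>z = \<Sum> \<plusminus> 3\<^sup>-\<^sup>n w n\<close> of almost norming
  vectors with suitable signs makes \<open>S (t n) z\<close> unbounded.\<close>

lemma bounded_near_0: "\<exists>\<delta>>0. \<exists>M. \<forall>t\<in>{0..\<delta>}. \<forall>x\<in>X. norm (J (S t x)) \<le> M * norm (J x)"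
proof (rule ccontr)
  assume neg: "\<not> ?thesis"
  have "\<exists>t K w. 0 \<le> t \<and> t \<le> 1 / real (Suc n) \<and> 4 ^ n < K \<and> w \<in> X \<and> norm (J w) \<le> 1 \<and>
          3/4 * K < norm (J (S t w)) \<and> (\<forall>x\<in>X. norm (J (S t x)) \<le> K * norm (J x))" for n :: nat
  proof -
    obtain t where t: "0 \<le> t" "t \<le> 1 / real (Suc n)" "\<not> (\<forall>x\<in>X. norm (J (S t x)) \<le> 4 ^ n * norm (J x))"
      using neg by (metis atLeastAtMost_iff of_nat_0_less_iff zero_less_Suc zero_less_divide_1_iff)
    from almost_norming_vector[OF t(1) _ t(3)] show ?thesis using t(1,2) by auto
  qed
  then obtain t K w where t: "\<And>n. 0 \<le> t n" "\<And>n. t n \<le> 1 / real (Suc n)"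
    and K: "\<And>n. 4 ^ n < K n" "\<And>n x. x \<in> X \<Longrightarrow> norm (J (S (t n) x)) \<le> K n * norm (J x)"
    and w: "\<And>n. w n \<in> X" "\<And>n. norm (J (w n)) \<le> 1" "\<And>n. 3/4 * K n < norm (J (S (t n) (w n)))"
    by metis
  define c :: "nat \<Rightarrow> real" where "c n = (1/3) ^ n" for n
  have c: "0 < c n" for n by (simp add: c_def)
  have c3: "c (Suc n) = c n / 3" for n by (simp add: c_def)
  \<comment> \<open>Of a + b and a - b one has norm at least that of b, so the sign of each new term
    can be chosen to keep the image under \<open>S (t n)\<close> large.\<close>
  define y where "y = rec_nat 0 (\<lambda>n x. if c n * norm (J (S (t n) (w n))) \<le> norm (J (S (t n) (x + c n *\<^sub>R w n)))
                    then x + c n *\<^sub>R w n else x - c n *\<^sub>R w n)"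
  have y0: "y 0 = 0" by (simp add: y_def)
  have ySuc: "y (Suc n) = (if c n * norm (J (S (t n) (w n))) \<le> norm (J (S (t n) (y n + c n *\<^sub>R w n)))
                    then y n + c n *\<^sub>R w n else y n - c n *\<^sub>R w n)" for n by (simp add: y_def)
  have yX: "y n \<in> X" for n
    by (induction n) (auto simp: y0 ySuc in_X w)
  have big: "c n * norm (J (S (t n) (w n))) \<le> norm (J (S (t n) (y (Suc n))))" for n
  proof (cases "c n * norm (J (S (t n) (w n))) \<le> norm (J (S (t n) (y n + c n *\<^sub>R w n)))")
    case False
    define a b where "a = J (S (t n) (y n))" and "b = c n *\<^sub>R J (S (t n) (w n))"
    have ab: "J (S (t n) (y n + c n *\<^sub>R w n)) = a + b" "J (S (t n) (y n - c n *\<^sub>R w n)) = a - b"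
      by (simp_all add: a_def b_def S_add S_diff S_scaleR J_add J_diff J_scaleR S_in in_X yX w t)
    have nb: "norm b = c n * norm (J (S (t n) (w n)))" using c[of n] by (simp add: b_def)
    have "2 * norm b = norm ((a + b) - (a - b))" by (simp flip: scaleR_2)
    also have "\<dots> \<le> norm (a + b) + norm (a - b)" by (rule norm_triangle_ineq4)
    finally show ?thesis using False unfolding ySuc by (simp add: ab nb)
  qed (simp add: ySuc)
  have step: "norm (J (y (Suc n)) - J (y n)) \<le> c n" for n
  proof -
    have "J (y (Suc n)) - J (y n) = c n *\<^sub>R J (w n) \<or> J (y (Suc n)) - J (y n) = - (c n *\<^sub>R J (w n))"
      by (simp add: ySuc J_add J_diff J_scaleR in_X yX w)
    then have "norm (J (y (Suc n)) - J (y n)) = c n * norm (J (w n))" using c[of n] by auto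
    also have "\<dots> \<le> c n" using c[of n] w(2)[of n] by (simp add: mult_left_le)
    finally show ?thesis .
  qed
  have tail: "norm (J (y (n + k)) - J (y n)) \<le> 3/2 * (c n - c (n + k))" for n k
  proof (induction k)
    case (Suc k)
    have "norm (J (y (n + Suc k)) - J (y n)) \<le> norm (J (y (Suc (n + k))) - J (y (n + k))) + norm (J (y (n + k)) - J (y n))"
      using norm_triangle_ineq[of "J (y (Suc (n + k))) - J (y (n + k))" "J (y (n + k)) - J (y n)"] by simp
    also have "\<dots> \<le> c (n + k) + 3/2 * (c n - c (n + k))" using step Suc by (intro add_mono)
    also have "\<dots> = 3/2 * (c n - c (n + Suc k))"
      by (simp add: c3 field_simps)
    finally show ?case .
  qed simp
  have tail': "norm (J (y m) - J (y n)) \<le> 3/2 * c n" if "n \<le> m" for m n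
  proof -
    obtain k where k: "m = n + k" using \<open>n \<le> m\<close> le_Suc_ex by blast
    have "3/2 * (c n - c (n + k)) \<le> 3/2 * c n" using c[of "n + k"] by simp
    then show ?thesis using tail[of n k] k by simp
  qed
  have c0: "c \<longlonglongrightarrow> 0" unfolding c_def by (intro LIMSEQ_power_zero) simp
  have "Cauchy (\<lambda>n. J (y n))"
  proof (rule CauchyI')
    fix e :: real assume e: "0 < e"
    have "\<forall>\<^sub>F n in sequentially. c n < e / 2"
      using c0 e by (intro order_tendstoD(2)) auto
    then obtain n where n: "c n < e / 2" by (auto simp: eventually_sequentially)
    have "norm (J (y m) - J (y m')) < e" if "n \<le> m" "m < m'" for m m'
    proof -
      have "c m \<le> c n" using that unfolding c_def by (intro power_decreasing) auto
      then show ?thesis using tail'[of m m'] n that c[of n] by (simp add: norm_minus_commute)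
    qed
    then show "\<exists>M. \<forall>m\<ge>M. \<forall>n>m. dist (J (y m)) (J (y n)) < e" unfolding dist_norm by blast
  qed
  then obtain z where z: "z \<in> X" "(\<lambda>n. J (y n)) \<longlonglongrightarrow> J z" using complete[of y] yX by blast
  have zt: "norm (J z - J (y n)) \<le> 3/2 * c n" for n
    by (rule LIMSEQ_le_const2[of "\<lambda>m. norm (J (y m) - J (y n))"])
       (use tail' in \<open>auto intro!: tendsto_intros z\<close>)
  \<comment> \<open>The terms after n add up to at most half of \<open>c n\<close>, so they cost at
    most 1/2 K n c n against a gain of 3/4 K n c n. The remaining quarter exceeds (4/3)^n / 4
    because K n > 4^n and c n = 3^-n.\<close>
  have lower: "1/4 * (4/3) ^ n \<le> norm (J (S (t n) z))" for n
  proof -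
    have "norm (J (S (t n) (z - y (Suc n)))) \<le> K n * norm (J (z - y (Suc n)))"
      by (intro K in_X z yX)
    also have "\<dots> \<le> K n * (3/2 * c (Suc n))"
      using zt[of "Suc n"] K(1)[of n] by (intro mult_left_mono) (auto simp: J_diff z yX intro: less_imp_le order_trans[of 0 "4^n"])
    finally have 1: "norm (J (S (t n) z) - J (S (t n) (y (Suc n)))) \<le> 1/2 * (K n * c n)"
      by (simp add: S_diff J_diff S_in t z yX c_def)
    have "c n * (3/4 * K n) \<le> c n * norm (J (S (t n) (w n)))" using w(3)[of n] c[of n] by simp
    then have 2: "3/4 * (K n * c n) \<le> norm (J (S (t n) (y (Suc n))))" using big[of n] by (simp add: mult_ac)
    have "norm (J (S (t n) (y (Suc n)))) \<le> norm (J (S (t n) z)) + norm (J (S (t n) z) - J (S (t n) (y (Suc n))))"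
      using norm_triangle_ineq4[of "J (S (t n) z)" "J (S (t n) z) - J (S (t n) (y (Suc n)))"] by simp
    then have "1/4 * (K n * c n) \<le> norm (J (S (t n) z))" using 1 2 by simp
    moreover have "4 ^ n * c n \<le> K n * c n" using K(1)[of n] c[of n] by simp
    moreover have "4 ^ n * c n = (4/3) ^ n" by (simp add: c_def power_mult_distrib[symmetric])
    ultimately show ?thesis by simp
  qed
  obtain \<delta> where \<delta>: "0 < \<delta>" "\<And>s. 0 < s \<Longrightarrow> s < \<delta> \<Longrightarrow> norm (J (S s z - z)) < 1"
    using order_tendstoD(2)[OF S_tendsto[OF z(1)], of 1] unfolding eventually_at_right_field by auto
  have "\<forall>\<^sub>F n in sequentially. 1 / real (Suc n) < \<delta>"
    using LIMSEQ_inverse_real_of_nat \<delta>(1) by (intro order_tendstoD(2)) (auto simp: divide_inverse)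
  moreover have "\<forall>\<^sub>F n in sequentially. 4 * (norm (J z) + 1) < (4/3 :: real) ^ n"
  proof -
    obtain m where m: "4 * (norm (J z) + 1) < (4/3 :: real) ^ m"
      using real_arch_pow[of "4/3"] by auto
    have "4 * (norm (J z) + 1) < (4/3 :: real) ^ n" if "m \<le> n" for n
      using less_le_trans[OF m power_increasing[OF that, of "4/3 :: real"]] by simp
    then show ?thesis by (rule eventually_sequentiallyI)
  qed
  ultimately have "\<forall>\<^sub>F n in sequentially. False"
  proof eventually_elim
    case (elim n)
    have "norm (J (S (t n) z)) < norm (J z) + 1"
    proof (cases "t n = 0")
      case True
      then show ?thesis using z by (simp add: S_0)
    next
      case False
      then have "norm (J (S (t n) z - z)) < 1" using t[of n] elim by (intro \<delta>) auto
      then have "norm (J (S (t n) z) - J z) < 1" using t z by (simp add: J_diff S_in)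
      then show ?thesis using norm_triangle_ineq2[of "J (S (t n) z)" "J z"] by linarith
    qed
    then show ?case using lower[of n] elim by simp
  qed
  then show False by simp
qed

text \<open>By the semigroup property, n steps of length at most \<delta>, each costing a factor B,
  cover the whole interval.\<close>

lemma bounded_on_compact: "\<exists>M\<ge>0. \<forall>t\<in>{0..T}. \<forall>x\<in>X. norm (J (S t x)) \<le> M * norm (J x)"
proof -
  obtain \<delta> M where \<delta>: "0 < \<delta>" and M: "\<And>t x. 0 \<le> t \<Longrightarrow> t \<le> \<delta> \<Longrightarrow> x \<in> X \<Longrightarrow> norm (J (S t x)) \<le> M * norm (J x)"
    using bounded_near_0 by fastforce
  define B where "B = max 1 M"
  have B: "1 \<le> B" by (simp add: B_def)
  have MB: "norm (J (S t x)) \<le> B * norm (J x)" if "0 \<le> t" "t \<le> \<delta>" "x \<in> X" for t x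
  proof -
    have "M * norm (J x) \<le> B * norm (J x)" by (intro mult_right_mono) (auto simp: B_def)
    then show ?thesis using M[OF that] by simp
  qed
  have *: "norm (J (S t x)) \<le> B ^ n * norm (J x)" if "0 \<le> t" "t \<le> real n * \<delta>" "x \<in> X" for n t x
    using that
  proof (induction n arbitrary: t x)
    case 0
    then show ?case by (simp add: S_0)
  next
    case (Suc n)
    define s where "s = min t \<delta>"
    have s: "0 \<le> s" "s \<le> \<delta>" "0 \<le> t - s" "t - s \<le> real n * \<delta>"
      using Suc.prems \<delta> by (auto simp: s_def min_def algebra_simps)
    have "norm (J (S t x)) = norm (J (S s (S (t - s) x)))"
      using S_plus[of s "t - s" x] s Suc.prems by simp
    also have "\<dots> \<le> B * norm (J (S (t - s) x))" using s Suc.prems by (intro MB S_in)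
    also have "\<dots> \<le> B * (B ^ n * norm (J x))" using s Suc B by (intro mult_left_mono Suc.IH) auto
    finally show ?case by (simp add: mult.assoc)
  qed
  obtain n where "T / \<delta> < real n" using reals_Archimedean2 by blast
  then have n: "T \<le> real n * \<delta>" using \<delta> by (simp add: pos_divide_less_eq)
  show ?thesis
  proof (intro exI[of _ "B ^ n"] conjI ballI)
    show "norm (J (S t x)) \<le> B ^ n * norm (J x)" if "t \<in> {0..T}" "x \<in> X" for t x
      using that n by (intro *) auto
  qed (use B in simp)
qed

section \<open>Continuity and differentiability along orbits\<close>

lemma orbit_continuous:
  assumes x: "x \<in> X" and t: "0 \<le> t"
  shows "((\<lambda>s. J (S s x)) \<longlongrightarrow> J (S t x)) (at t within {0..})"
proof -
  obtain M where M: "0 \<le> M" "\<And>s x. s \<in> {0..t+1} \<Longrightarrow> x \<in> X \<Longrightarrow> norm (J (S s x)) \<le> M * norm (J x)"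
    using bounded_on_compact[of "t + 1"] by blast
  \<comment> \<open>The increment is \<open>S m\<close>, with m the smaller time, applied to the
    increment over [0,h]. Right continuity at 0 thus gives continuity from both sides, as
    \<open>S m\<close> is bounded locally uniformly in m.\<close>
  have bound: "norm (J (S s x) - J (S t x)) \<le> M * norm (J (S \<bar>s - t\<bar> x - x))" if "s \<in> {0..t+1}" for s
  proof -
    define m where "m = min s t"
    define h where "h = \<bar>s - t\<bar>"
    have m: "m \<in> {0..t+1}" "0 \<le> m" "0 \<le> h" "max s t = m + h" using that t by (auto simp: m_def h_def)
    have "norm (J (S s x) - J (S t x)) = norm (J (S (m + h) x) - J (S m x))"
      by (cases "s \<le> t") (auto simp: m_def h_def norm_minus_commute)
    also have "\<dots> = norm (J (S m (S h x - x)))"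
      using m x by (simp add: S_plus S_diff J_diff S_in)
    also have "\<dots> \<le> M * norm (J (S h x - x))" using m x by (intro M in_X S_in) auto
    finally show ?thesis by (simp add: h_def)
  qed
  have "((\<lambda>s. norm (J (S \<bar>s - t\<bar> x - x))) \<longlongrightarrow> 0) (at t within {0..})"
  proof (rule filterlim_compose[OF S_tendsto[OF x]])
    show "LIM s at t within {0..}. \<bar>s - t\<bar> :> at_right 0"
      by (auto simp: filterlim_at eventually_at_filter intro!: tendsto_eq_intros)
  qed
  then have lim: "((\<lambda>s. M * norm (J (S \<bar>s - t\<bar> x - x))) \<longlongrightarrow> 0) (at t within {0..})"
    by (rule tendsto_mult_right_zero)
  have "\<forall>\<^sub>F s in at t within {0..}. norm (J (S s x) - J (S t x)) \<le> M * norm (J (S \<bar>s - t\<bar> x - x))"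
    unfolding eventually_at
    by (intro exI[of _ 1]) (auto simp: dist_real_def intro!: bound)
  from Lim_null_comparison[OF this lim] show ?thesis by (rule LIM_zero_cancel)
qed

text \<open>Stated for every linear F dominated by J, so that one argument serves the whole state,
  its velocity and the image of its position under the multiplier.\<close>

lemma orbit_image_continuous:
  fixes F :: "'a \<Rightarrow> 'c::real_normed_vector"
  assumes x: "x \<in> X"
    and F: "\<And>x y. x \<in> X \<Longrightarrow> y \<in> X \<Longrightarrow> F (x + y) = F x + F y" "\<And>x c. x \<in> X \<Longrightarrow> F (c *\<^sub>R x) = c *\<^sub>R F x"
      "\<And>x. x \<in> X \<Longrightarrow> norm (F x) \<le> norm (J x)"
  shows "continuous_on {0..} (\<lambda>t. F (S t x))"
  unfolding continuous_on
proof
  fix t :: real assume "t \<in> {0..}"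
  then have t: "0 \<le> t" by simp
  have "((\<lambda>s. F (S s x) - F (S t x)) \<longlongrightarrow> 0) (at t within {0..})"
  proof (rule Lim_null_comparison)
    show "((\<lambda>s. norm (J (S s x) - J (S t x))) \<longlongrightarrow> 0) (at t within {0..})"
      using orbit_continuous[OF x t] by (intro tendsto_norm_zero LIM_zero)
    have "norm (F (S s x) - F (S t x)) \<le> norm (J (S s x) - J (S t x))" if "0 \<le> s" for s
      using F(3)[of "S s x - S t x"] linear_on_diff[of F "S s x" "S t x"] F(1,2) that t x
      by (simp add: J_diff S_in in_X)
    then show "\<forall>\<^sub>F s in at t within {0..}. norm (F (S s x) - F (S t x)) \<le> norm (J (S s x) - J (S t x))"
      by (auto simp: eventually_at_filter)
  qed
  then show "((\<lambda>s. F (S s x)) \<longlongrightarrow> F (S t x)) (at t within {0..})" by (rule LIM_zero_cancel)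
qed

text \<open>\<open>S t\<close> is bounded and commutes with the difference quotient of the orbit at
  time 0.\<close>

lemma generator_invariant:
  assumes g: "(x, y) \<in> generator X N S" and t: "0 \<le> t"
  shows "(S t x, S t y) \<in> generator X N S"
proof -
  have x: "x \<in> X" "y \<in> X" and lim: "((\<lambda>h. N ((S h x - x) /\<^sub>R h - y)) \<longlongrightarrow> 0) (at_right 0)"
    using g by (auto simp: generator_def)
  obtain M where M: "\<And>x. x \<in> X \<Longrightarrow> norm (J (S t x)) \<le> M * norm (J x)" using S_bounded[OF t] by blast
  have "((\<lambda>h. N ((S h (S t x) - S t x) /\<^sub>R h - S t y)) \<longlongrightarrow> 0) (at_right 0)"
  proof (rule Lim_null_comparison)
    show "((\<lambda>h. M * N ((S h x - x) /\<^sub>R h - y)) \<longlongrightarrow> 0) (at_right 0)"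
      using tendsto_mult_right_zero[OF lim] .
    show "\<forall>\<^sub>F h in at_right 0. norm (N ((S h (S t x) - S t x) /\<^sub>R h - S t y)) \<le> M * N ((S h x - x) /\<^sub>R h - y)"
      unfolding eventually_at_right_field
    proof (intro exI[of _ 1] conjI allI impI)
      fix h :: real assume h: "0 < h" "h < 1"
      have "S h (S t x) = S t (S h x)" using S_plus[of h t x] S_plus[of t h x] h t x by (simp add: add.commute)
      then have e: "(S h (S t x) - S t x) /\<^sub>R h - S t y = S t ((S h x - x) /\<^sub>R h - y)"
        using h t x by (simp add: S_diff S_scaleR in_X S_in)
      have v: "(S h x - x) /\<^sub>R h - y \<in> X" using h x by (intro in_X S_in) auto
      show "norm (N ((S h (S t x) - S t x) /\<^sub>R h - S t y)) \<le> M * N ((S h x - x) /\<^sub>R h - y)"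
        unfolding e using M[OF v] v t by (simp add: N_eq S_in)
    qed simp
  qed
  then show ?thesis using x t by (simp add: generator_def S_in)
qed

text \<open>The generator supplies only a right derivative at time 0. For a negative increment the
  earlier time t + s serves as base point, and continuity of the orbit of y moves the derivative
  from there to t.\<close>

lemma generator_has_derivative:
  fixes F :: "'a \<Rightarrow> 'c::real_normed_vector"
  assumes g: "(x, y) \<in> generator X N S" and t: "0 < t"
    and F: "\<And>x y. x \<in> X \<Longrightarrow> y \<in> X \<Longrightarrow> F (x + y) = F x + F y" "\<And>x c. x \<in> X \<Longrightarrow> F (c *\<^sub>R x) = c *\<^sub>R F x"
      "\<And>x. x \<in> X \<Longrightarrow> norm (F x) \<le> norm (J x)"
  shows "((\<lambda>s. F (S s x)) has_vector_derivative F (S t y)) (at t)"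
proof -
  have x: "x \<in> X" "y \<in> X" and lim: "((\<lambda>h. N ((S h x - x) /\<^sub>R h - y)) \<longlongrightarrow> 0) (at_right 0)"
    using g by (auto simp: generator_def)
  have F_diff: "x \<in> X \<Longrightarrow> y \<in> X \<Longrightarrow> F (x - y) = F x - F y" for x y
    using linear_on_diff[of F] F by blast
  obtain M where M: "0 \<le> M" "\<And>s x. s \<in> {0..t+1} \<Longrightarrow> x \<in> X \<Longrightarrow> norm (J (S s x)) \<le> M * norm (J x)"
    using bounded_on_compact[of "t + 1"] by blast
  \<comment> \<open>One majorant for both signs of s: the first part is the error of the generator
    quotient; the second is 0 for s > 0 and accounts for the shifted base point when s < 0.\<close>
  define R where "R s = M * N ((S \<bar>s\<bar> x - x) /\<^sub>R \<bar>s\<bar> - y) + norm (J (S (min (t + s) t) y) - J (S t y))" for s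
  have bound: "norm (F (S (t + s) x) - F (S t x) - s *\<^sub>R F (S t y)) / norm s \<le> R s"
    if s: "s \<noteq> 0" "\<bar>s\<bar> < min t 1" for s
  proof -
    define m where "m = min (t + s) t"
    define h where "h = \<bar>s\<bar>"
    have m: "m \<in> {0..t+1}" "0 \<le> m" "0 < h" using s t by (auto simp: m_def h_def)
    define v where "v = (S h x - x) /\<^sub>R h - y"
    have v: "v \<in> X" unfolding v_def using m x by (intro in_X S_in) auto
    have "S (m + h) x - S m x = S m (S h x - x)" using m x by (simp add: S_plus S_diff S_in)
    also have "S h x - x = h *\<^sub>R (v + y)" using m by (simp add: v_def)
    finally have e: "S (m + h) x - S m x = h *\<^sub>R S m (v + y)"
      using m x v by (simp add: S_scaleR in_X)
    have "F (S (t + s) x) - F (S t x) = sgn s *\<^sub>R (F (S (m + h) x) - F (S m x))"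
      using s by (cases "s > 0") (auto simp: m_def h_def)
    also have "F (S (m + h) x) - F (S m x) = h *\<^sub>R (F (S m v) + F (S m y))"
      using m x v F_diff[of "S (m + h) x" "S m x"] by (simp add: e F S_add S_in in_X)
    also have "sgn s *\<^sub>R (h *\<^sub>R (F (S m v) + F (S m y))) = s *\<^sub>R (F (S m v) + F (S m y))"
      by (simp add: h_def mult_sgn_abs)
    finally have "F (S (t + s) x) - F (S t x) - s *\<^sub>R F (S t y) = s *\<^sub>R (F (S m v) + (F (S m y) - F (S t y)))"
      by (simp add: algebra_simps)
    then have "norm (F (S (t + s) x) - F (S t x) - s *\<^sub>R F (S t y)) / norm s = norm (F (S m v) + (F (S m y) - F (S t y)))"
      using s by simp
    also have "\<dots> \<le> norm (F (S m v)) + norm (F (S m y) - F (S t y))" by (rule norm_triangle_ineq)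
    also have "norm (F (S m v)) \<le> M * N v"
      using F(3)[of "S m v"] M(2)[OF m(1) v] m v by (simp add: S_in N_eq)
    also have "norm (F (S m y) - F (S t y)) \<le> norm (J (S m y) - J (S t y))"
      using F(3)[of "S m y - S t y"] m t x by (simp add: F_diff J_diff S_in in_X)
    finally show ?thesis by (simp add: R_def v_def m_def h_def)
  qed
  have "(R \<longlongrightarrow> M * 0 + 0) (at 0)"
    unfolding R_def
  proof (intro tendsto_add tendsto_mult tendsto_const)
    show "((\<lambda>s. N ((S \<bar>s\<bar> x - x) /\<^sub>R \<bar>s\<bar> - y)) \<longlongrightarrow> 0) (at 0)"
    proof (rule filterlim_compose[OF lim])
      show "LIM s at (0::real). \<bar>s\<bar> :> at_right 0"
        by (auto simp: filterlim_at eventually_at_filter intro!: tendsto_eq_intros)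
    qed
    have "continuous_on {0..} (\<lambda>s. J (S s y))"
      using orbit_continuous[OF x(2)] by (auto simp: continuous_on)
    then have "isCont (\<lambda>s. J (S s y)) t"
      using t by (intro continuous_on_interior[of "{0..}"]) (auto simp: interior_real_atLeast)
    moreover have "((\<lambda>s. min (t + s) t) \<longlongrightarrow> t) (at 0)" by (auto intro!: tendsto_eq_intros)
    ultimately have "((\<lambda>s. J (S (min (t + s) t) y)) \<longlongrightarrow> J (S t y)) (at 0)"
      by (rule isCont_tendsto_compose)
    then show "((\<lambda>s. norm (J (S (min (t + s) t) y) - J (S t y))) \<longlongrightarrow> 0) (at 0)"
      using LIM_zero tendsto_norm_zero by blast
  qed
  then have R0: "(R \<longlongrightarrow> 0) (at 0)" by simp
  have "((\<lambda>s. norm (F (S (t + s) x) - F (S t x) - s *\<^sub>R F (S t y)) / norm s) \<longlongrightarrow> 0) (at 0)"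
  proof (rule Lim_null_comparison[OF _ R0])
    show "\<forall>\<^sub>F s in at 0. norm (norm (F (S (t + s) x) - F (S t x) - s *\<^sub>R F (S t y)) / norm s) \<le> R s"
      unfolding eventually_at using t bound
      by (intro exI[of _ "min t 1"]) (auto simp: dist_real_def)
  qed
  then show ?thesis
    unfolding has_vector_derivative_def has_derivative_at by (simp add: bounded_linear_scaleR_left)
qed

end

section \<open>Closures of first order Euler operators\<close>

lemma test_functions_product_integrable:
  assumes "\<phi> \<in> test_functions" "\<psi> \<in> test_functions"
  shows "integrable lebesgue01 (\<lambda>x. \<phi> x * \<psi> x)"
  using assms by (intro square_integrable_on_mult) auto

lemma integral_derivative_product_test_functions:
  assumes "\<phi> \<in> test_functions" "\<psi> \<in> test_functions"
  shows "(LINT x|lebesgue01. deriv \<phi> x * \<psi> x + \<phi> x * deriv \<psi> x) = 0"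
  using integral_by_parts_test_functions[OF assms] assms
  by (simp add: test_functions_product_integrable deriv_test_function)

lemma deriv_powr_times_test_function:
  assumes "\<phi> \<in> test_functions"
  shows "deriv (\<lambda>x. x powr \<beta> * \<phi> x) x = \<beta> * (x powr (\<beta> - 1) * \<phi> x) + x powr \<beta> * deriv \<phi> x"
  by (rule DERIV_imp_deriv[OF has_derivative_powr_times_test_function[OF assms]])

lemma inner_test_functions:
  assumes "\<phi> \<in> test_functions" "\<psi> \<in> test_functions"
  shows "inner (abs_L2 \<phi>) (abs_L2 \<psi>) = (LINT x|lebesgue01. \<phi> x * \<psi> x)"
  using assms by (intro inner_abs_L2) auto

text \<open>Both terms scale alike under dilations; this class contains the two components of the
  form and the multiplier, so closures are treated once.\<close>

definition euler_op :: "real \<Rightarrow> real \<Rightarrow> real \<Rightarrow> (real \<Rightarrow> real) \<Rightarrow> real \<Rightarrow> real" where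
  "euler_op \<beta> c0 c1 \<phi> x = c0 * (x powr \<beta> * deriv \<phi> x) + c1 * (x powr (\<beta> - 1) * \<phi> x)"

definition euler_adjoint :: "real \<Rightarrow> real \<Rightarrow> real \<Rightarrow> (real \<Rightarrow> real) \<Rightarrow> real \<Rightarrow> real" where
  "euler_adjoint \<beta> c0 c1 \<psi> x = - c0 * deriv (\<lambda>x. x powr \<beta> * \<psi> x) x + c1 * (x powr (\<beta> - 1) * \<psi> x)"

lemma euler_op_test_function:
  assumes "\<phi> \<in> test_functions" shows "euler_op \<beta> c0 c1 \<phi> \<in> test_functions"
  unfolding euler_op_def[abs_def]
  by (intro test_functions_add test_functions_scale powr_times_test_function deriv_test_function assms)

lemma euler_adjoint_test_function:
  assumes "\<psi> \<in> test_functions" shows "euler_adjoint \<beta> c0 c1 \<psi> \<in> test_functions"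
  unfolding euler_adjoint_def[abs_def]
  by (intro test_functions_add test_functions_scale powr_times_test_function deriv_test_function assms)

lemma euler_op_diff:
  assumes "\<phi> \<in> test_functions" "\<psi> \<in> test_functions"
  shows "euler_op \<beta> c0 c1 (\<lambda>x. \<phi> x - \<psi> x) = (\<lambda>x. euler_op \<beta> c0 c1 \<phi> x - euler_op \<beta> c0 c1 \<psi> x)"
proof
  fix x
  have d: "deriv (\<lambda>x. \<phi> x - \<psi> x) x = deriv \<phi> x - deriv \<psi> x"
    by (intro DERIV_imp_deriv DERIV_diff test_function_deriv assms)
  show "euler_op \<beta> c0 c1 (\<lambda>x. \<phi> x - \<psi> x) x = euler_op \<beta> c0 c1 \<phi> x - euler_op \<beta> c0 c1 \<psi> x"
    unfolding euler_op_def d by (simp add: algebra_simps)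
qed

lemma abs_euler_op_diff:
  assumes "\<phi> \<in> test_functions" "\<psi> \<in> test_functions"
  shows "abs_L2 (euler_op \<beta> c0 c1 (\<lambda>x. \<phi> x - \<psi> x)) = abs_L2 (euler_op \<beta> c0 c1 \<phi>) - abs_L2 (euler_op \<beta> c0 c1 \<psi>)"
  unfolding euler_op_diff[OF assms]
  by (intro abs_L2_diff[symmetric] test_function_square_integrable euler_op_test_function assms)

lemma euler_op_adjoint:
  assumes "\<phi> \<in> test_functions" "\<psi> \<in> test_functions"
  shows "inner (abs_L2 (euler_op \<beta> c0 c1 \<phi>)) (abs_L2 \<psi>) = inner (abs_L2 \<phi>) (abs_L2 (euler_adjoint \<beta> c0 c1 \<psi>))"
proof -
  define \<eta> where "\<eta> = (\<lambda>x. x powr \<beta> * \<psi> x)"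
  define \<zeta> where "\<zeta> = (\<lambda>x. x powr (\<beta> - 1) * \<psi> x)"
  have t: "\<eta> \<in> test_functions" "\<zeta> \<in> test_functions" "deriv \<phi> \<in> test_functions" "deriv \<eta> \<in> test_functions"
    using assms by (auto simp: \<eta>_def \<zeta>_def powr_times_test_function deriv_test_function)
  note i = test_functions_product_integrable
  have "(LINT x|lebesgue01. euler_op \<beta> c0 c1 \<phi> x * \<psi> x)
      = (LINT x|lebesgue01. c0 * (deriv \<phi> x * \<eta> x) + c1 * (\<phi> x * \<zeta> x))"
    by (intro Bochner_Integration.integral_cong) (auto simp: euler_op_def \<eta>_def \<zeta>_def algebra_simps)
  also have "\<dots> = c0 * (LINT x|lebesgue01. deriv \<phi> x * \<eta> x) + c1 * (LINT x|lebesgue01. \<phi> x * \<zeta> x)"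
    using i t assms by simp
  also have "\<dots> = - c0 * (LINT x|lebesgue01. \<phi> x * deriv \<eta> x) + c1 * (LINT x|lebesgue01. \<phi> x * \<zeta> x)"
    using integral_by_parts_test_functions[OF assms(1) t(1)] by simp
  also have "\<dots> = (LINT x|lebesgue01. (- c0) * (\<phi> x * deriv \<eta> x) + c1 * (\<phi> x * \<zeta> x))"
    using i t assms by simp
  also have "\<dots> = (LINT x|lebesgue01. \<phi> x * euler_adjoint \<beta> c0 c1 \<psi> x)"
    by (intro Bochner_Integration.integral_cong) (auto simp: euler_adjoint_def \<eta>_def \<zeta>_def algebra_simps)
  finally show ?thesis
    using assms by (simp add: inner_test_functions euler_op_test_function euler_adjoint_test_function)
qed

lemma L2_eq_if_inner_test_functions_eq:
  assumes "\<And>\<psi>. \<psi> \<in> test_functions \<Longrightarrow> inner u (abs_L2 \<psi>) = inner v (abs_L2 \<psi>)"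
  shows "u = v"
proof (rule L2_eqI, rule AE_eq_if_test_integrals_eq)
  show "(LINT x|lebesgue01. rep_L2 u x * \<phi> x) = (LINT x|lebesgue01. rep_L2 v x * \<phi> x)" if "\<phi> \<in> test_functions" for \<phi>
    using assms[OF that] that by (simp add: inner_L2_rep_abs test_function_square_integrable)
qed (auto intro: square_integrable_imp_locally_integrable01)

definition weak_euler_op :: "real \<Rightarrow> real \<Rightarrow> real \<Rightarrow> L2 \<Rightarrow> L2 \<Rightarrow> bool" where
  "weak_euler_op \<beta> c0 c1 u h \<longleftrightarrow>
     (\<forall>\<psi>\<in>test_functions. inner h (abs_L2 \<psi>) = inner u (abs_L2 (euler_adjoint \<beta> c0 c1 \<psi>)))"

text \<open>\<open>THE\<close> is meaningful only where some h exists; it is then unique because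
  test functions separate elements of \<open>L2\<close>. Facts about the extension are obtained from
  a witness of \<open>weak_euler_op\<close>.\<close>

definition euler_ext :: "real \<Rightarrow> real \<Rightarrow> real \<Rightarrow> L2 \<Rightarrow> L2" where
  "euler_ext \<beta> c0 c1 u = (THE h. weak_euler_op \<beta> c0 c1 u h)"

lemma euler_ext_eqI: "weak_euler_op \<beta> c0 c1 u h \<Longrightarrow> euler_ext \<beta> c0 c1 u = h"
  unfolding euler_ext_def
  by (rule the_equality) (auto simp: weak_euler_op_def intro: L2_eq_if_inner_test_functions_eq)

lemma weak_euler_op_test_function:
  "\<phi> \<in> test_functions \<Longrightarrow> weak_euler_op \<beta> c0 c1 (abs_L2 \<phi>) (abs_L2 (euler_op \<beta> c0 c1 \<phi>))"
  by (auto simp: weak_euler_op_def euler_op_adjoint)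

lemma weak_euler_op_add:
  "weak_euler_op \<beta> c0 c1 u h \<Longrightarrow> weak_euler_op \<beta> c0 c1 v g \<Longrightarrow> weak_euler_op \<beta> c0 c1 (u + v) (h + g)"
  by (simp add: weak_euler_op_def inner_add_left)

lemma weak_euler_op_scaleR:
  "weak_euler_op \<beta> c0 c1 u h \<Longrightarrow> weak_euler_op \<beta> c0 c1 (r *\<^sub>R u) (r *\<^sub>R h)"
  by (simp add: weak_euler_op_def)

lemma weak_euler_op_closed:
  assumes "\<And>n::nat. weak_euler_op \<beta> c0 c1 (u n) (h n)" "u \<longlonglongrightarrow> u'" "h \<longlonglongrightarrow> h'"
  shows "weak_euler_op \<beta> c0 c1 u' h'"
  unfolding weak_euler_op_def
proof
  fix \<psi> assume "\<psi> \<in> test_functions"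
  then have "(\<lambda>n. inner (h n) (abs_L2 \<psi>)) = (\<lambda>n. inner (u n) (abs_L2 (euler_adjoint \<beta> c0 c1 \<psi>)))"
    using assms(1) by (auto simp: weak_euler_op_def)
  moreover have "(\<lambda>n. inner (h n) (abs_L2 \<psi>)) \<longlonglongrightarrow> inner h' (abs_L2 \<psi>)"
    "(\<lambda>n. inner (u n) (abs_L2 (euler_adjoint \<beta> c0 c1 \<psi>))) \<longlonglongrightarrow> inner u' (abs_L2 (euler_adjoint \<beta> c0 c1 \<psi>))"
    by (intro tendsto_intros assms)+
  ultimately show "inner h' (abs_L2 \<psi>) = inner u' (abs_L2 (euler_adjoint \<beta> c0 c1 \<psi>))"
    using LIMSEQ_unique by simp
qed

text \<open>Closability: the limit of the images is a weak image of u, and u has only one, so the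
  limit does not depend on the approximating sequence.\<close>

lemma euler_ext_limit:
  assumes "\<And>n::nat. \<phi> n \<in> test_functions" "(\<lambda>n. abs_L2 (\<phi> n)) \<longlonglongrightarrow> u"
    and "Cauchy (\<lambda>n. abs_L2 (euler_op \<beta> c0 c1 (\<phi> n)))"
  shows "weak_euler_op \<beta> c0 c1 u (euler_ext \<beta> c0 c1 u)"
    and "(\<lambda>n. abs_L2 (euler_op \<beta> c0 c1 (\<phi> n))) \<longlonglongrightarrow> euler_ext \<beta> c0 c1 u"
proof -
  obtain h where h: "(\<lambda>n. abs_L2 (euler_op \<beta> c0 c1 (\<phi> n))) \<longlonglongrightarrow> h"
    using assms(3) Cauchy_convergent_iff convergent_def by blast
  have "weak_euler_op \<beta> c0 c1 u h"
    by (rule weak_euler_op_closed[OF _ assms(2) h]) (intro weak_euler_op_test_function assms)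
  moreover from this have "euler_ext \<beta> c0 c1 u = h" by (rule euler_ext_eqI)
  ultimately show "weak_euler_op \<beta> c0 c1 u (euler_ext \<beta> c0 c1 u)"
    "(\<lambda>n. abs_L2 (euler_op \<beta> c0 c1 (\<phi> n))) \<longlonglongrightarrow> euler_ext \<beta> c0 c1 u" using h by simp_all
qed

lemma locally_integrable01_powr_times:
  assumes "locally_integrable01 w"
  shows "locally_integrable01 (\<lambda>x. x powr \<beta> * w x)"
  unfolding locally_integrable01_def
proof (intro allI impI, elim conjE)
  fix a b :: real assume ab: "0 < a" "b < 1"
  have w: "integrable (lebesgue_on {a..b}) w" using assms ab by (auto simp: locally_integrable01_def)
  have c: "continuous_on {a..b} (\<lambda>x. x powr \<beta>)" using ab by (auto intro!: continuous_intros)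
  then have "bounded ((\<lambda>x. x powr \<beta>) ` {a..b})"
    by (intro compact_imp_bounded compact_continuous_image) auto
  then obtain C where C: "\<And>x. x \<in> {a..b} \<Longrightarrow> x powr \<beta> \<le> C" by (force simp: bounded_iff)
  show "integrable (lebesgue_on {a..b}) (\<lambda>x. x powr \<beta> * w x)"
  proof (rule Bochner_Integration.integrable_bound)
    show "integrable (lebesgue_on {a..b}) (\<lambda>x. C * w x)" using w by simp
    show "(\<lambda>x. x powr \<beta> * w x) \<in> borel_measurable (lebesgue_on {a..b})"
      using continuous_imp_measurable_on_sets_lebesgue[OF c] w by (intro borel_measurable_times) auto
    show "AE x in lebesgue_on {a..b}. norm (x powr \<beta> * w x) \<le> norm (C * w x)"
    proof (rule AE_I2)
      fix x assume "x \<in> space (lebesgue_on {a..b})"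
      then have "x powr \<beta> \<le> \<bar>C\<bar>" using C[of x] by simp
      then show "norm (x powr \<beta> * w x) \<le> norm (C * w x)" by (simp add: abs_mult mult_right_mono)
    qed
  qed
qed

text \<open>The bridge from closures to functions: powers of x times test functions are test
  functions, so w may be tested with them and the abstract h acquires a pointwise formula.\<close>

lemma weak_euler_op_weak_deriv:
  assumes wd: "weak_deriv (rep_L2 u) w" and h: "weak_euler_op \<beta> c0 c1 u h"
  shows "AE x in lebesgue01. rep_L2 h x = c0 * (x powr \<beta> * w x) + c1 * (x powr (\<beta> - 1) * rep_L2 u x)"
proof (rule AE_eq_if_test_integrals_eq)
  have li: "locally_integrable01 (rep_L2 u)" "locally_integrable01 w" using wd by (auto simp: weak_deriv_def)
  have lx: "locally_integrable01 (\<lambda>x. x powr \<beta> * w x)" "locally_integrable01 (\<lambda>x. x powr (\<beta> - 1) * rep_L2 u x)"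
    by (intro locally_integrable01_powr_times li)+
  then show "locally_integrable01 (\<lambda>x. c0 * (x powr \<beta> * w x) + c1 * (x powr (\<beta> - 1) * rep_L2 u x))"
    by (auto simp: locally_integrable01_def)
  show "locally_integrable01 (rep_L2 h)" by (intro square_integrable_imp_locally_integrable01) simp
  fix \<psi> assume \<psi>: "\<psi> \<in> test_functions"
  define \<eta> where "\<eta> = (\<lambda>x. x powr \<beta> * \<psi> x)"
  define \<zeta> where "\<zeta> = (\<lambda>x. x powr (\<beta> - 1) * \<psi> x)"
  have t: "\<eta> \<in> test_functions" "\<zeta> \<in> test_functions" "deriv \<eta> \<in> test_functions"
    using \<psi> by (auto simp: \<eta>_def \<zeta>_def powr_times_test_function deriv_test_function)
  note i = integrable_times_test_function
  have "(LINT x|lebesgue01. rep_L2 h x * \<psi> x) = inner h (abs_L2 \<psi>)"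
    using \<psi> by (simp add: inner_L2_rep_abs test_function_square_integrable)
  also have "\<dots> = inner u (abs_L2 (euler_adjoint \<beta> c0 c1 \<psi>))" using h \<psi> by (simp add: weak_euler_op_def)
  also have "\<dots> = (LINT x|lebesgue01. rep_L2 u x * euler_adjoint \<beta> c0 c1 \<psi> x)"
    using \<psi> by (simp add: inner_L2_rep_abs test_function_square_integrable euler_adjoint_test_function)
  also have "\<dots> = (LINT x|lebesgue01. (- c0) * (rep_L2 u x * deriv \<eta> x) + c1 * (rep_L2 u x * \<zeta> x))"
    by (intro Bochner_Integration.integral_cong) (auto simp: euler_adjoint_def \<eta>_def \<zeta>_def algebra_simps)
  also have "\<dots> = - c0 * (LINT x|lebesgue01. rep_L2 u x * deriv \<eta> x) + c1 * (LINT x|lebesgue01. rep_L2 u x * \<zeta> x)"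
    using i li t by simp
  also have "(LINT x|lebesgue01. rep_L2 u x * deriv \<eta> x) = - (LINT x|lebesgue01. w x * \<eta> x)"
    using wd t by (simp add: weak_deriv_def)
  also have "- c0 * - (LINT x|lebesgue01. w x * \<eta> x) + c1 * (LINT x|lebesgue01. rep_L2 u x * \<zeta> x)
     = (LINT x|lebesgue01. c0 * (w x * \<eta> x) + c1 * (rep_L2 u x * \<zeta> x))"
    using i li t by simp
  also have "\<dots> = (LINT x|lebesgue01. (c0 * (x powr \<beta> * w x) + c1 * (x powr (\<beta> - 1) * rep_L2 u x)) * \<psi> x)"
    by (intro Bochner_Integration.integral_cong) (auto simp: \<eta>_def \<zeta>_def algebra_simps)
  finally show "(LINT x|lebesgue01. rep_L2 h x * \<psi> x)
     = (LINT x|lebesgue01. (c0 * (x powr \<beta> * w x) + c1 * (x powr (\<beta> - 1) * rep_L2 u x)) * \<psi> x)" .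
qed

section \<open>The closed form and its domain\<close>

locale degenerate_singular =
  fixes \<alpha> \<mu> :: real
  assumes \<alpha>: "0 \<le> \<alpha>" "\<alpha> < 2" and \<mu>: "\<mu> \<le> mu_crit \<alpha>"
begin

definition k :: real where "k = (1 - \<alpha>) / 2"

text \<open>k^2 is the critical value \<open>mu_crit \<alpha>\<close>, so \<nu> measures how far
  \<mu> stays below the Hardy threshold and is 0 exactly at it.\<close>

definition \<nu> :: real where "\<nu> = sqrt (k\<^sup>2 - \<mu>)"

lemma \<nu>_square: "\<nu>\<^sup>2 = k\<^sup>2 - \<mu>"
  using \<mu> by (simp add: \<nu>_def k_def mu_crit_def power_divide)

definition C :: "(real \<Rightarrow> real) \<Rightarrow> real \<Rightarrow> real" where "C = euler_op (\<alpha> / 2) 1 (- k)"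
definition D :: "(real \<Rightarrow> real) \<Rightarrow> real \<Rightarrow> real" where "D = euler_op (\<alpha> / 2) 0 \<nu>"
definition B :: "(real \<Rightarrow> real) \<Rightarrow> real \<Rightarrow> real" where "B = euler_op 1 1 (\<alpha> / 4)"

definition J0 :: "(real \<Rightarrow> real) \<Rightarrow> L2 \<times> L2" where "J0 \<phi> = (abs_L2 (C \<phi>), abs_L2 (D \<phi>))"

lemma CDB_test_functions:
  "\<phi> \<in> test_functions \<Longrightarrow> C \<phi> \<in> test_functions" "\<phi> \<in> test_functions \<Longrightarrow> D \<phi> \<in> test_functions"
  "\<phi> \<in> test_functions \<Longrightarrow> B \<phi> \<in> test_functions"
  by (simp_all add: C_def D_def B_def euler_op_test_function)

lemma J0_diff:
  assumes "\<phi> \<in> test_functions" "\<psi> \<in> test_functions"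
  shows "J0 (\<lambda>x. \<phi> x - \<psi> x) = J0 \<phi> - J0 \<psi>"
  using assms by (simp add: J0_def C_def D_def abs_euler_op_diff)

lemma powr_shift:
  assumes "0 < (x::real)"
  shows "x powr \<alpha> = x\<^sup>2 * x powr (\<alpha> - 2)" "x powr (\<alpha> - 1) = x * x powr (\<alpha> - 2)"
    "\<mu> / x powr (2 - \<alpha>) = \<mu> * x powr (\<alpha> - 2)"
    "x powr (\<alpha>/2) = x * x powr (\<alpha>/2 - 1)" "(x powr (\<alpha>/2 - 1))\<^sup>2 = x powr (\<alpha> - 2)"
proof -
  show "x powr \<alpha> = x\<^sup>2 * x powr (\<alpha> - 2)"
    using assms powr_add[of x 2 "\<alpha> - 2"] by (simp add: powr_numeral)
  show "x powr (\<alpha> - 1) = x * x powr (\<alpha> - 2)"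
    using assms powr_add[of x 1 "\<alpha> - 2"] by simp
  show "\<mu> / x powr (2 - \<alpha>) = \<mu> * x powr (\<alpha> - 2)"
    using powr_minus_divide[of x "2 - \<alpha>"] by simp
  show "x powr (\<alpha>/2) = x * x powr (\<alpha>/2 - 1)"
    using assms powr_add[of x 1 "\<alpha>/2 - 1"] by simp
  show "(x powr (\<alpha>/2 - 1))\<^sup>2 = x powr (\<alpha> - 2)"
    using assms powr_add[of x "\<alpha>/2 - 1" "\<alpha>/2 - 1"] by (simp add: power2_eq_square)
qed

text \<open>Completing the square: the integrands differ by k times the derivative of x^(\<alpha>-1)
  \<phi> \<psi>, which integrates to 0. Nonnegativity of the form, that is Hardy's inequality, is
  built into the right-hand side.\<close>

lemma a_form_eq:
  assumes \<phi>: "\<phi> \<in> test_functions" and \<psi>: "\<psi> \<in> test_functions"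
  shows "a_form \<alpha> \<mu> \<phi> \<psi> = inner (J0 \<phi>) (J0 \<psi>)"
proof -
  define \<eta> where "\<eta> = (\<lambda>x. x powr (\<alpha> - 1) * \<phi> x)"
  have \<eta>: "\<eta> \<in> test_functions" using \<phi> by (simp add: \<eta>_def powr_times_test_function)
  have pw: "x powr \<alpha> * deriv \<phi> x * deriv \<psi> x - \<mu> / x powr (2 - \<alpha>) * \<phi> x * \<psi> x
     = (C \<phi> x * C \<psi> x + D \<phi> x * D \<psi> x) + k * (deriv \<eta> x * \<psi> x + \<eta> x * deriv \<psi> x)"
    if x: "x \<in> space lebesgue01" for x
  proof -
    have x: "0 < x" using x by simp
    define r s where "r = x powr (\<alpha>/2 - 1)" and "s = x powr (\<alpha> - 2)"
    have rs: "r\<^sup>2 = s" using powr_shift(5)[OF x] by (simp add: r_def s_def)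
    have ops: "C \<phi> x = r * (x * deriv \<phi> x - k * \<phi> x)" "C \<psi> x = r * (x * deriv \<psi> x - k * \<psi> x)"
      "D \<phi> x = \<nu> * r * \<phi> x" "D \<psi> x = \<nu> * r * \<psi> x"
      using powr_shift(4)[OF x] by (simp_all add: C_def D_def euler_op_def r_def algebra_simps)
    have dx: "deriv \<eta> x = (\<alpha> - 1) * (s * \<phi> x) + (x * s) * deriv \<phi> x" "\<eta> x = x * s * \<phi> x"
      using deriv_powr_times_test_function[OF \<phi>, of "\<alpha> - 1" x] powr_shift(2)[OF x]
      by (simp_all add: \<eta>_def s_def)
    have "C \<phi> x * C \<psi> x + D \<phi> x * D \<psi> x
       = r\<^sup>2 * ((x * deriv \<phi> x - k * \<phi> x) * (x * deriv \<psi> x - k * \<psi> x)) + \<nu>\<^sup>2 * (r\<^sup>2 * (\<phi> x * \<psi> x))"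
      unfolding ops power2_eq_square by (simp add: algebra_simps)
    also have "\<dots> = s * ((x * deriv \<phi> x - k * \<phi> x) * (x * deriv \<psi> x - k * \<psi> x)) + (k\<^sup>2 - \<mu>) * (s * (\<phi> x * \<psi> x))"
      by (simp only: rs \<nu>_square)
    finally have CD: "C \<phi> x * C \<psi> x + D \<phi> x * D \<psi> x = \<dots>" .
    have a1: "\<alpha> - 1 = - 2 * k" by (simp add: k_def)
    show ?thesis
      unfolding CD dx a1 powr_shift(1,3)[OF x] s_def[symmetric] by (simp add: algebra_simps power2_eq_square)
  qed
  have "a_form \<alpha> \<mu> \<phi> \<psi> = (LINT x|lebesgue01. (C \<phi> x * C \<psi> x + D \<phi> x * D \<psi> x) + k * (deriv \<eta> x * \<psi> x + \<eta> x * deriv \<psi> x))"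
    unfolding a_form_def by (rule Bochner_Integration.integral_cong[OF refl pw])
  also have "\<dots> = (LINT x|lebesgue01. C \<phi> x * C \<psi> x) + (LINT x|lebesgue01. D \<phi> x * D \<psi> x)
      + k * (LINT x|lebesgue01. deriv \<eta> x * \<psi> x + \<eta> x * deriv \<psi> x)"
    using \<phi> \<psi> \<eta> by (simp add: test_functions_product_integrable CDB_test_functions deriv_test_function)
  also have "\<dots> = inner (J0 \<phi>) (J0 \<psi>)"
    using \<phi> \<psi> \<eta> by (simp add: integral_derivative_product_test_functions J0_def inner_prod_def inner_test_functions CDB_test_functions)
  finally show ?thesis .
qed

text \<open>With \<open>k + \<alpha>/4 = (2 - \<alpha>)/4\<close>, the difference of both sides is the integral of
  \<open>(x\<^sup>\<alpha> - x\<^sup>2) (\<phi>' - k\<phi>/x)\<^sup>2 + (k\<^sup>2 - \<mu>) x\<^sup>\<alpha>\<^sup>-\<^sup>2 \<phi>\<^sup>2 - (k + \<alpha>/4) (x \<phi>\<^sup>2)'\<close>.\<close>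

lemma multiplier_bound_test_function:
  assumes \<phi>: "\<phi> \<in> test_functions"
  shows "(norm (abs_L2 (B \<phi>)))\<^sup>2 + 3 * (2 - \<alpha>)\<^sup>2 / 16 * (norm (abs_L2 \<phi>))\<^sup>2 \<le> (norm (J0 \<phi>))\<^sup>2"
proof -
  define \<kappa> where "\<kappa> = 3 * (2 - \<alpha>)\<^sup>2 / 16"
  define d where "d = (2 - \<alpha>) / 4"
  define \<eta> where "\<eta> = (\<lambda>x. x powr 1 * \<phi> x)"
  have \<eta>: "\<eta> \<in> test_functions" using \<phi> by (simp only: \<eta>_def powr_times_test_function)
  have "0 \<le> (LINT x|lebesgue01. (C \<phi> x * C \<phi> x + D \<phi> x * D \<phi> x) - (B \<phi> x * B \<phi> x + \<kappa> * (\<phi> x * \<phi> x))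
       + d * (deriv \<eta> x * \<phi> x + \<eta> x * deriv \<phi> x))"
  proof (rule integral_nonneg_AE, rule AE_I2)
    fix x assume "x \<in> space lebesgue01"
    then have x: "0 < x" "x < 1" by auto
    define r s where "r = x powr (\<alpha>/2 - 1)" and "s = x powr (\<alpha> - 2)"
    have rs: "r\<^sup>2 = s" using powr_shift(5)[OF x(1)] by (simp add: r_def s_def)
    \<comment> \<open>Here x < 1 and \<alpha> < 2 enter: the weight x^\<alpha> of the form dominates
      the x^2 that comes from the multiplier.\<close>
    have s1: "1 \<le> s"
      using x \<alpha> powr_mono'[of "\<alpha> - 2" 0 x] by (simp add: s_def)
    define y where "y = x * deriv \<phi> x - k * \<phi> x"
    have ops: "C \<phi> x = r * y" "D \<phi> x = \<nu> * r * \<phi> x" "B \<phi> x = x * deriv \<phi> x + \<alpha>/4 * \<phi> x"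
      using powr_shift(4)[OF x(1)] x by (simp_all add: C_def D_def B_def euler_op_def r_def y_def algebra_simps)
    have dx: "deriv \<eta> x = \<phi> x + x * deriv \<phi> x" "\<eta> x = x * \<phi> x"
      using deriv_powr_times_test_function[OF \<phi>, of 1 x] x
      by (simp_all add: \<eta>_def)
    have "C \<phi> x * C \<phi> x + D \<phi> x * D \<phi> x = r\<^sup>2 * y\<^sup>2 + \<nu>\<^sup>2 * (r\<^sup>2 * (\<phi> x)\<^sup>2)"
      unfolding ops power2_eq_square by (simp add: algebra_simps)
    then have CD: "C \<phi> x * C \<phi> x + D \<phi> x * D \<phi> x = s * y\<^sup>2 + \<nu>\<^sup>2 * (s * (\<phi> x)\<^sup>2)" by (simp only: rs)
    \<comment> \<open>B \<phi> equals y + d \<phi>. Subtracting d (x \<phi>^2)' cancels the mixed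
      term and leaves -3 d^2 \<phi>^2, since 1 + 2k = 4d; this is compensated by \<kappa> = 3
      d^2.\<close>
    have id: "B \<phi> x * B \<phi> x + \<kappa> * (\<phi> x * \<phi> x) - d * (deriv \<eta> x * \<phi> x + \<eta> x * deriv \<phi> x) = y\<^sup>2"
      unfolding ops dx y_def \<kappa>_def d_def k_def by (simp add: power2_eq_square field_simps)
    have "y\<^sup>2 \<le> s * y\<^sup>2" using s1 mult_right_mono[OF s1, of "y\<^sup>2"] by simp
    moreover have "0 \<le> \<nu>\<^sup>2 * (s * (\<phi> x)\<^sup>2)" using s1 by simp
    ultimately show "0 \<le> (C \<phi> x * C \<phi> x + D \<phi> x * D \<phi> x) - (B \<phi> x * B \<phi> x + \<kappa> * (\<phi> x * \<phi> x))
       + d * (deriv \<eta> x * \<phi> x + \<eta> x * deriv \<phi> x)"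
      using CD id by linarith
  qed
  also have "\<dots> = ((LINT x|lebesgue01. C \<phi> x * C \<phi> x) + (LINT x|lebesgue01. D \<phi> x * D \<phi> x))
      - ((LINT x|lebesgue01. B \<phi> x * B \<phi> x) + \<kappa> * (LINT x|lebesgue01. \<phi> x * \<phi> x))
      + d * (LINT x|lebesgue01. deriv \<eta> x * \<phi> x + \<eta> x * deriv \<phi> x)"
    using \<phi> \<eta> by (simp add: test_functions_product_integrable CDB_test_functions deriv_test_function)
  also have "\<dots> = (inner (abs_L2 (C \<phi>)) (abs_L2 (C \<phi>)) + inner (abs_L2 (D \<phi>)) (abs_L2 (D \<phi>)))
       - (inner (abs_L2 (B \<phi>)) (abs_L2 (B \<phi>)) + \<kappa> * inner (abs_L2 \<phi>) (abs_L2 \<phi>))"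
    using \<phi> \<eta> by (simp add: integral_derivative_product_test_functions inner_test_functions CDB_test_functions)
  finally show ?thesis
    unfolding power2_norm_eq_inner by (simp add: J0_def \<kappa>_def inner_prod_def)
qed

text \<open>One nonnegative summand of the combined bound is dropped at a time; in the second case
  the factor 3 is given away as well.\<close>

lemma norm_B_le: "\<phi> \<in> test_functions \<Longrightarrow> norm (abs_L2 (B \<phi>)) \<le> norm (J0 \<phi>)"
  and Hardy: "\<phi> \<in> test_functions \<Longrightarrow> norm (abs_L2 \<phi>) \<le> 4 / (2 - \<alpha>) * norm (J0 \<phi>)"
proof -
  assume \<phi>: "\<phi> \<in> test_functions"
  have 1: "(norm (abs_L2 (B \<phi>)))\<^sup>2 \<le> (norm (J0 \<phi>))\<^sup>2" and 2: "3 * (2 - \<alpha>)\<^sup>2 / 16 * (norm (abs_L2 \<phi>))\<^sup>2 \<le> (norm (J0 \<phi>))\<^sup>2"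
  proof -
    have "0 \<le> 3 * (2 - \<alpha>)\<^sup>2 / 16 * (norm (abs_L2 \<phi>))\<^sup>2" "0 \<le> (norm (abs_L2 (B \<phi>)))\<^sup>2" by auto
    then show "(norm (abs_L2 (B \<phi>)))\<^sup>2 \<le> (norm (J0 \<phi>))\<^sup>2" "3 * (2 - \<alpha>)\<^sup>2 / 16 * (norm (abs_L2 \<phi>))\<^sup>2 \<le> (norm (J0 \<phi>))\<^sup>2"
      using multiplier_bound_test_function[OF \<phi>] by linarith+
  qed
  show "norm (abs_L2 (B \<phi>)) \<le> norm (J0 \<phi>)" using 1 by (rule power2_le_imp_le) simp
  have "((2 - \<alpha>) / 4 * norm (abs_L2 \<phi>))\<^sup>2 \<le> 3 * (2 - \<alpha>)\<^sup>2 / 16 * (norm (abs_L2 \<phi>))\<^sup>2"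
    by (simp add: power_mult_distrib power_divide mult_right_mono)
  also note 2
  finally have "(2 - \<alpha>) / 4 * norm (abs_L2 \<phi>) \<le> norm (J0 \<phi>)" by (rule power2_le_imp_le) simp
  then show "norm (abs_L2 \<phi>) \<le> 4 / (2 - \<alpha>) * norm (J0 \<phi>)" using \<alpha> by (simp add: field_simps)
qed

section \<open>Closures of \<open>C\<close>, \<open>D\<close> and \<open>B\<close> on the energy
  space\<close>

definition ext_C :: "L2 \<Rightarrow> L2" where "ext_C = euler_ext (\<alpha> / 2) 1 (- k)"
definition ext_D :: "L2 \<Rightarrow> L2" where "ext_D = euler_ext (\<alpha> / 2) 0 \<nu>"
definition ext_B :: "L2 \<Rightarrow> L2" where "ext_B = euler_ext 1 1 (\<alpha> / 4)"

definition J :: "L2 \<Rightarrow> L2 \<times> L2" where "J u = (ext_C u, ext_D u)"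

text \<open>By the completed square the form norm of a difference is a distance of images under
  \<open>J0\<close>, so the condition becomes an ordinary Cauchy condition in a Hilbert
  space.\<close>

lemma approximates_iff:
  "approximates \<alpha> \<mu> \<phi> u \<longleftrightarrow>
    (\<forall>n. \<phi> n \<in> test_functions) \<and> Cauchy (\<lambda>n. J0 (\<phi> n)) \<and> (\<lambda>n. abs_L2 (\<phi> n)) \<longlonglongrightarrow> u"
proof -
  have "sqrt (a_form \<alpha> \<mu> (\<lambda>x. \<phi> m x - \<phi> n x) (\<lambda>x. \<phi> m x - \<phi> n x)) = dist (J0 (\<phi> m)) (J0 (\<phi> n))"
    if "\<forall>n. \<phi> n \<in> test_functions" for m n
    using that by (simp add: a_form_eq test_functions_diff J0_diff dist_norm norm_eq_sqrt_inner)
  then show ?thesis unfolding approximates_def Cauchy_def by auto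
qed

lemma approximates_limits:
  assumes "approximates \<alpha> \<mu> \<phi> u"
  shows "(\<lambda>n. abs_L2 (\<phi> n)) \<longlonglongrightarrow> u" "(\<lambda>n. J0 (\<phi> n)) \<longlonglongrightarrow> J u" "(\<lambda>n. abs_L2 (B (\<phi> n))) \<longlonglongrightarrow> ext_B u"
    "weak_euler_op (\<alpha> / 2) 1 (- k) u (ext_C u)" "weak_euler_op (\<alpha> / 2) 0 \<nu> u (ext_D u)" "weak_euler_op 1 1 (\<alpha> / 4) u (ext_B u)"
    "\<And>n. \<phi> n \<in> test_functions"
proof -
  show t: "\<phi> n \<in> test_functions" for n using assms by (simp add: approximates_iff)
  have c: "Cauchy (\<lambda>n. J0 (\<phi> n))" and l: "(\<lambda>n. abs_L2 (\<phi> n)) \<longlonglongrightarrow> u" using assms by (auto simp: approximates_iff)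
  show "(\<lambda>n. abs_L2 (\<phi> n)) \<longlonglongrightarrow> u" by (rule l)
  have cC: "Cauchy (\<lambda>n. abs_L2 (C (\<phi> n)))" and cD: "Cauchy (\<lambda>n. abs_L2 (D (\<phi> n)))"
    using bounded_linear.Cauchy[OF bounded_linear_fst c] bounded_linear.Cauchy[OF bounded_linear_snd c]
    by (simp_all add: J0_def)
  \<comment> \<open>The multiplier is bounded by the form norm, so its images form a Cauchy sequence
    too.\<close>
  have cB: "Cauchy (\<lambda>n. abs_L2 (B (\<phi> n)))"
  proof (rule CauchyI)
    fix e :: real assume "0 < e"
    then obtain N where N: "\<And>m n. m \<ge> N \<Longrightarrow> n \<ge> N \<Longrightarrow> norm (J0 (\<phi> m) - J0 (\<phi> n)) < e"
      using CauchyD[OF c] by blast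
    have "norm (abs_L2 (B (\<phi> m)) - abs_L2 (B (\<phi> n))) \<le> norm (J0 (\<phi> m) - J0 (\<phi> n))" for m n
      using norm_B_le[OF test_functions_diff[OF t t], of m n] t
      by (simp add: B_def abs_euler_op_diff J0_diff)
    then show "\<exists>M. \<forall>m\<ge>M. \<forall>n\<ge>M. norm (abs_L2 (B (\<phi> m)) - abs_L2 (B (\<phi> n))) < e"
      using N by (meson le_less_trans)
  qed
  note lC = euler_ext_limit[OF t l cC[unfolded C_def]] and lD = euler_ext_limit[OF t l cD[unfolded D_def]]
    and lB = euler_ext_limit[OF t l cB[unfolded B_def]]
  show "weak_euler_op (\<alpha> / 2) 1 (- k) u (ext_C u)" "weak_euler_op (\<alpha> / 2) 0 \<nu> u (ext_D u)" "weak_euler_op 1 1 (\<alpha> / 4) u (ext_B u)"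
    using lC(1) lD(1) lB(1) by (simp_all add: ext_C_def ext_D_def ext_B_def)
  show "(\<lambda>n. J0 (\<phi> n)) \<longlonglongrightarrow> J u" "(\<lambda>n. abs_L2 (B (\<phi> n))) \<longlonglongrightarrow> ext_B u"
    using tendsto_Pair[OF lC(2) lD(2)] lB(2) by (simp_all add: J0_def J_def C_def D_def B_def ext_C_def ext_D_def ext_B_def)
qed

text \<open>The combination u - r v covers sums (r = -1) and multiples (u = 0) at once.\<close>

lemma approximates_diff_scaleR:
  assumes "approximates \<alpha> \<mu> \<phi> u" "approximates \<alpha> \<mu> \<psi> v"
  shows "approximates \<alpha> \<mu> (\<lambda>n x. \<phi> n x - r * \<psi> n x) (u - r *\<^sub>R v)"
proof -
  have t: "\<phi> n \<in> test_functions" "(\<lambda>x. r * \<psi> n x) \<in> test_functions" "\<psi> n \<in> test_functions" for n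
    using assms by (auto simp: approximates_iff test_functions_scale)
  have s: "abs_L2 (\<lambda>x. r * \<psi> n x) = r *\<^sub>R abs_L2 (\<psi> n)" for n
    using t by (simp add: abs_L2_scaleR test_function_square_integrable)
  have d: "deriv (\<lambda>x. r * \<psi> n x) x = r * deriv (\<psi> n) x" for n x
    by (intro DERIV_imp_deriv DERIV_cmult test_function_deriv t)
  have e: "euler_op \<beta> c0 c1 (\<lambda>x. r * \<psi> n x) = (\<lambda>x. r * euler_op \<beta> c0 c1 (\<psi> n) x)" for \<beta> c0 c1 n
    by (auto simp: euler_op_def d algebra_simps)
  have "J0 (\<lambda>x. r * \<psi> n x) = r *\<^sub>R J0 (\<psi> n)" for n
    unfolding J0_def C_def D_def e using t
    by (simp add: abs_L2_scaleR test_function_square_integrable euler_op_test_function)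
  then have J: "J0 (\<lambda>x. \<phi> n x - r * \<psi> n x) = J0 (\<phi> n) - r *\<^sub>R J0 (\<psi> n)" for n
    by (simp add: J0_diff t)
  have "(\<lambda>n. J0 (\<phi> n) - r *\<^sub>R J0 (\<psi> n)) \<longlonglongrightarrow> J u - r *\<^sub>R J v"
    by (intro tendsto_intros approximates_limits assms)
  then have "Cauchy (\<lambda>n. J0 (\<lambda>x. \<phi> n x - r * \<psi> n x))" unfolding J by (rule LIMSEQ_imp_Cauchy)
  moreover have "abs_L2 (\<lambda>x. \<phi> n x - r * \<psi> n x) = abs_L2 (\<phi> n) - r *\<^sub>R abs_L2 (\<psi> n)" for n
    using t by (simp add: s abs_L2_diff[symmetric] test_function_square_integrable)
  then have "(\<lambda>n. abs_L2 (\<lambda>x. \<phi> n x - r * \<psi> n x)) \<longlonglongrightarrow> u - r *\<^sub>R v"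
    by (simp only:) (intro tendsto_intros approximates_limits[OF assms(1)] approximates_limits[OF assms(2)])
  ultimately show ?thesis
    unfolding approximates_iff using t by (auto intro: test_functions_diff)
qed

lemma approximates_test_function:
  "\<phi> \<in> test_functions \<Longrightarrow> approximates \<alpha> \<mu> (\<lambda>n. \<phi>) (abs_L2 \<phi>)"
  by (simp add: approximates_iff convergent_const convergent_Cauchy)

text \<open>Closability gives the forms the same limit along all approximating sequences, which
  justifies the definite description.\<close>

lemma H_inner_eq:
  assumes "u \<in> H_space \<alpha> \<mu>" "v \<in> H_space \<alpha> \<mu>"
  shows "H_inner \<alpha> \<mu> u v = inner (J u) (J v)"
proof -
  have lim: "(\<lambda>n. a_form \<alpha> \<mu> (\<phi> n) (\<psi> n)) \<longlonglongrightarrow> inner (J u) (J v)"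
    if "approximates \<alpha> \<mu> \<phi> u" "approximates \<alpha> \<mu> \<psi> v" for \<phi> \<psi>
  proof -
    have "(\<lambda>n. inner (J0 (\<phi> n)) (J0 (\<psi> n))) \<longlonglongrightarrow> inner (J u) (J v)"
      by (intro tendsto_intros approximates_limits that)
    then show ?thesis using approximates_limits(7)[OF that(1)] approximates_limits(7)[OF that(2)]
      by (simp add: a_form_eq)
  qed
  show ?thesis
    unfolding H_inner_def
  proof (rule the_equality)
    show "\<exists>\<phi> \<psi>. approximates \<alpha> \<mu> \<phi> u \<and> approximates \<alpha> \<mu> \<psi> v \<and> (\<lambda>n. a_form \<alpha> \<mu> (\<phi> n) (\<psi> n)) \<longlonglongrightarrow> inner (J u) (J v)"
      using assms lim by (auto simp: H_space_def)
  qed (use lim LIMSEQ_unique in blast)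
qed

lemma H_norm_eq: "u \<in> H_space \<alpha> \<mu> \<Longrightarrow> H_norm \<alpha> \<mu> u = norm (J u)"
  by (simp add: H_norm_def H_inner_eq norm_eq_sqrt_inner)

lemma H_space_weak_euler_op:
  assumes "u \<in> H_space \<alpha> \<mu>"
  shows "weak_euler_op (\<alpha> / 2) 1 (- k) u (ext_C u)" "weak_euler_op (\<alpha> / 2) 0 \<nu> u (ext_D u)" "weak_euler_op 1 1 (\<alpha> / 4) u (ext_B u)"
  using assms approximates_limits(4-6) by (auto simp: H_space_def)

lemma J_add: "u \<in> H_space \<alpha> \<mu> \<Longrightarrow> v \<in> H_space \<alpha> \<mu> \<Longrightarrow> J (u + v) = J u + J v"
  and ext_B_add: "u \<in> H_space \<alpha> \<mu> \<Longrightarrow> v \<in> H_space \<alpha> \<mu> \<Longrightarrow> ext_B (u + v) = ext_B u + ext_B v"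
  using weak_euler_op_add[OF H_space_weak_euler_op(1) H_space_weak_euler_op(1), THEN euler_ext_eqI]
    weak_euler_op_add[OF H_space_weak_euler_op(2) H_space_weak_euler_op(2), THEN euler_ext_eqI]
    weak_euler_op_add[OF H_space_weak_euler_op(3) H_space_weak_euler_op(3), THEN euler_ext_eqI]
  by (simp_all add: J_def ext_C_def ext_D_def ext_B_def)

lemma J_scaleR: "u \<in> H_space \<alpha> \<mu> \<Longrightarrow> J (r *\<^sub>R u) = r *\<^sub>R J u"
  and ext_B_scaleR: "u \<in> H_space \<alpha> \<mu> \<Longrightarrow> ext_B (r *\<^sub>R u) = r *\<^sub>R ext_B u"
  using weak_euler_op_scaleR[OF H_space_weak_euler_op(1), THEN euler_ext_eqI]
    weak_euler_op_scaleR[OF H_space_weak_euler_op(2), THEN euler_ext_eqI]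
    weak_euler_op_scaleR[OF H_space_weak_euler_op(3), THEN euler_ext_eqI]
  by (simp_all add: J_def ext_C_def ext_D_def ext_B_def)

lemma subspace_H_space: "subspace (H_space \<alpha> \<mu>)"
proof -
  have z: "(\<lambda>x. 0) \<in> test_functions"
    using test_functions_scale[OF bump_test_function[of 1 "1/3" "2/3" 0 0], of 0] by simp
  have 0: "0 \<in> H_space \<alpha> \<mu>"
    using approximates_test_function[OF z] by (auto simp: H_space_def zero_L2_def)
  have d: "u - r *\<^sub>R v \<in> H_space \<alpha> \<mu>" if "u \<in> H_space \<alpha> \<mu>" "v \<in> H_space \<alpha> \<mu>" for u v r
    using that approximates_diff_scaleR unfolding H_space_def by blast
  show ?thesis
    unfolding subspace_def using 0 d[of _ _ "-1"] d[OF 0, of _ "- _"] by auto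
qed

lemma norm_ext_B_le:
  assumes "u \<in> H_space \<alpha> \<mu>" shows "norm (ext_B u) \<le> norm (J u)"
proof -
  obtain \<phi> where \<phi>: "approximates \<alpha> \<mu> \<phi> u" using assms by (auto simp: H_space_def)
  show ?thesis
    by (rule LIMSEQ_le[OF tendsto_norm tendsto_norm])
       (use approximates_limits[OF \<phi>] norm_B_le in auto)
qed

text \<open>Each u n is replaced by a test function within 1/(n+1) in the form norm. Hardy's
  inequality makes these converge in \<open>L2\<close> as well, and the limit is the required
  element.\<close>

lemma H_space_complete:
  assumes u: "\<And>n::nat. u n \<in> H_space \<alpha> \<mu>" and c: "Cauchy (\<lambda>n. J (u n))"
  shows "\<exists>v\<in>H_space \<alpha> \<mu>. (\<lambda>n. J (u n)) \<longlonglongrightarrow> J v"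
proof -
  obtain j where j: "(\<lambda>n. J (u n)) \<longlonglongrightarrow> j" using c Cauchy_convergent_iff convergent_def by blast
  have "\<exists>\<phi>\<in>test_functions. norm (J0 \<phi> - J (u n)) < 1 / real (Suc n)" for n
  proof -
    obtain \<phi> where \<phi>: "approximates \<alpha> \<mu> \<phi> (u n)" using u by (auto simp: H_space_def)
    have "\<exists>m. norm (J0 (\<phi> m) - J (u n)) < 1 / real (Suc n)"
      using LIMSEQ_D[OF approximates_limits(2)[OF \<phi>], of "1 / real (Suc n)"] by auto
    then show ?thesis using approximates_limits(7)[OF \<phi>] by blast
  qed
  then obtain \<psi> where \<psi>: "\<And>n. \<psi> n \<in> test_functions" "\<And>n. norm (J0 (\<psi> n) - J (u n)) < 1 / real (Suc n)" by metis
  have "(\<lambda>n. J0 (\<psi> n) - J (u n)) \<longlonglongrightarrow> 0"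
  proof (rule Lim_null_comparison)
    show "\<forall>\<^sub>F n in sequentially. norm (J0 (\<psi> n) - J (u n)) \<le> 1 / real (Suc n)"
      using \<psi>(2) less_imp_le by (intro always_eventually) blast
    show "(\<lambda>n. 1 / real (Suc n)) \<longlonglongrightarrow> 0" using LIMSEQ_inverse_real_of_nat by (simp add: divide_inverse)
  qed
  from tendsto_add[OF this j] have jl: "(\<lambda>n. J0 (\<psi> n)) \<longlonglongrightarrow> j" by simp
  then have cj: "Cauchy (\<lambda>n. J0 (\<psi> n))" by (rule LIMSEQ_imp_Cauchy)
  have "Cauchy (\<lambda>n. abs_L2 (\<psi> n))"
  proof (rule CauchyI)
    fix e :: real assume e: "0 < e"
    define K where "K = 4 / (2 - \<alpha>)"
    have K: "0 < K" using \<alpha> by (simp add: K_def)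
    obtain N where N: "\<And>m n. m \<ge> N \<Longrightarrow> n \<ge> N \<Longrightarrow> norm (J0 (\<psi> m) - J0 (\<psi> n)) < e / K"
      using CauchyD[OF cj, of "e / K"] e K by auto
    have "norm (abs_L2 (\<psi> m) - abs_L2 (\<psi> n)) < e" if "m \<ge> N" "n \<ge> N" for m n
    proof -
      have "norm (abs_L2 (\<psi> m) - abs_L2 (\<psi> n)) \<le> K * norm (J0 (\<psi> m) - J0 (\<psi> n))"
        using Hardy[OF test_functions_diff[OF \<psi>(1) \<psi>(1)], of m n] \<psi>(1)
        by (simp add: K_def J0_diff abs_L2_diff test_function_square_integrable)
      also have "\<dots> < e" using N[OF that] K by (simp add: field_simps)
      finally show ?thesis .
    qed
    then show "\<exists>M. \<forall>m\<ge>M. \<forall>n\<ge>M. norm (abs_L2 (\<psi> m) - abs_L2 (\<psi> n)) < e" by blast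
  qed
  then obtain v where v: "(\<lambda>n. abs_L2 (\<psi> n)) \<longlonglongrightarrow> v" using Cauchy_convergent_iff convergent_def by blast
  have a: "approximates \<alpha> \<mu> \<psi> v" using \<psi>(1) cj v by (simp add: approximates_iff)
  have "J v = j" using LIMSEQ_unique[OF approximates_limits(2)[OF a] jl] .
  then show ?thesis using a j by (auto simp: H_space_def)
qed

section \<open>Multiplier identities and Green's formula on the closure\<close>

lemma inner_ext_B_self:
  assumes "v \<in> H_space \<alpha> \<mu>"
  shows "inner v (ext_B v) = - ((2 - \<alpha>) / 4) * (norm v)\<^sup>2"
proof -
  have t: "inner (abs_L2 \<phi>) (abs_L2 (B \<phi>)) = - ((2 - \<alpha>) / 4) * inner (abs_L2 \<phi>) (abs_L2 \<phi>)"
    if \<phi>: "\<phi> \<in> test_functions" for \<phi>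
  proof -
    define \<eta> where "\<eta> = (\<lambda>x. x powr 1 * \<phi> x)"
    have \<eta>: "\<eta> \<in> test_functions" using \<phi> by (simp only: \<eta>_def powr_times_test_function)
    \<comment> \<open>The multiplier is skew up to a scalar: \<phi> B \<phi> is half the derivative
      of x \<phi>^2, which integrates to 0, minus (2 - \<alpha>)/4 \<phi>^2.\<close>
    have "(LINT x|lebesgue01. \<phi> x * B \<phi> x) = (LINT x|lebesgue01. 1/2 * (deriv \<eta> x * \<phi> x + \<eta> x * deriv \<phi> x) - (2 - \<alpha>) / 4 * (\<phi> x * \<phi> x))"
    proof (rule Bochner_Integration.integral_cong[OF refl])
      fix x assume "x \<in> space lebesgue01"
      then have x: "0 < x" by simp
      have dx: "deriv \<eta> x = \<phi> x + x * deriv \<phi> x" "\<eta> x = x * \<phi> x" "B \<phi> x = x * deriv \<phi> x + \<alpha>/4 * \<phi> x"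
        using deriv_powr_times_test_function[OF \<phi>, of 1 x] x by (simp_all add: \<eta>_def B_def euler_op_def)
      show "\<phi> x * B \<phi> x = 1/2 * (deriv \<eta> x * \<phi> x + \<eta> x * deriv \<phi> x) - (2 - \<alpha>) / 4 * (\<phi> x * \<phi> x)"
        unfolding dx by (simp add: field_simps)
    qed
    also have "\<dots> = 1/2 * (LINT x|lebesgue01. deriv \<eta> x * \<phi> x + \<eta> x * deriv \<phi> x) - (2 - \<alpha>) / 4 * (LINT x|lebesgue01. \<phi> x * \<phi> x)"
      using \<phi> \<eta> by (simp add: test_functions_product_integrable deriv_test_function)
    finally show ?thesis
      using \<phi> \<eta> by (simp add: inner_test_functions CDB_test_functions integral_derivative_product_test_functions)
  qed
  obtain \<phi> where \<phi>: "approximates \<alpha> \<mu> \<phi> v" using assms by (auto simp: H_space_def)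
  note l = approximates_limits[OF \<phi>]
  have "(\<lambda>n. inner (abs_L2 (\<phi> n)) (abs_L2 (B (\<phi> n)))) \<longlonglongrightarrow> inner v (ext_B v)"
    by (intro tendsto_intros l)
  moreover have "(\<lambda>n. - ((2 - \<alpha>) / 4) * inner (abs_L2 (\<phi> n)) (abs_L2 (\<phi> n))) \<longlonglongrightarrow> - ((2 - \<alpha>) / 4) * inner v v"
    by (intro tendsto_intros l)
  ultimately show ?thesis using t l(7) LIMSEQ_unique by (simp add: power2_norm_eq_inner)
qed

text \<open>B u + (1 - \<alpha>/4) u is (x u)_x, and its integral over (0,1) vanishes. This is the
  form in which the Dirichlet condition at 1 survives the closure.\<close>

lemma inner_ext_B_const:
  assumes "u \<in> H_space \<alpha> \<mu>"
  shows "inner (ext_B u + (1 - \<alpha> / 4) *\<^sub>R u) (abs_L2 (\<lambda>x. 1)) = 0"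
proof -
  have one: "(\<lambda>x. 1::real) square_integrable_on {0<..<1}"
    by (intro continuous_on_square_integrable continuous_intros)
  have t: "inner (abs_L2 (B \<phi>) + (1 - \<alpha> / 4) *\<^sub>R abs_L2 \<phi>) (abs_L2 (\<lambda>x. 1)) = 0"
    if \<phi>: "\<phi> \<in> test_functions" for \<phi>
  proof -
    define \<eta> where "\<eta> = (\<lambda>x. x powr 1 * \<phi> x)"
    have \<eta>: "\<eta> \<in> test_functions" using \<phi> by (simp only: \<eta>_def powr_times_test_function)
    have "abs_L2 (B \<phi>) + (1 - \<alpha> / 4) *\<^sub>R abs_L2 \<phi> = abs_L2 (\<lambda>x. B \<phi> x + (1 - \<alpha>/4) * \<phi> x)"
      using \<phi> by (simp add: abs_L2_scaleR abs_L2_add test_function_square_integrable CDB_test_functions square_integrable_on_scale)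
    moreover have "(\<lambda>x. B \<phi> x + (1 - \<alpha>/4) * \<phi> x) \<in> test_functions"
      by (intro test_functions_add test_functions_scale CDB_test_functions \<phi>)
    ultimately have "inner (abs_L2 (B \<phi>) + (1 - \<alpha> / 4) *\<^sub>R abs_L2 \<phi>) (abs_L2 (\<lambda>x. 1)) = (LINT x|lebesgue01. (B \<phi> x + (1 - \<alpha>/4) * \<phi> x) * 1)"
      using one by (simp only: inner_abs_L2 test_function_square_integrable)
    also have "\<dots> = (LINT x|lebesgue01. 1 * deriv \<eta> x)"
    proof (rule Bochner_Integration.integral_cong[OF refl])
      fix x assume "x \<in> space lebesgue01"
      then have x: "0 < x" by simp
      then show "(B \<phi> x + (1 - \<alpha>/4) * \<phi> x) * 1 = 1 * deriv \<eta> x"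
        using deriv_powr_times_test_function[OF \<phi>, of 1 x] by (simp add: \<eta>_def B_def euler_op_def algebra_simps)
    qed
    also have "\<dots> = 0"
      using integral_by_parts_test_function[of "\<lambda>x. 1" "\<lambda>x. 0", OF _ _ \<eta>] by simp
    finally show ?thesis .
  qed
  obtain \<phi> where \<phi>: "approximates \<alpha> \<mu> \<phi> u" using assms by (auto simp: H_space_def)
  note l = approximates_limits[OF \<phi>]
  have "(\<lambda>n. inner (abs_L2 (B (\<phi> n)) + (1 - \<alpha> / 4) *\<^sub>R abs_L2 (\<phi> n)) (abs_L2 (\<lambda>x. 1))) \<longlonglongrightarrow> inner (ext_B u + (1 - \<alpha> / 4) *\<^sub>R u) (abs_L2 (\<lambda>x. 1))"
    by (intro tendsto_intros l)
  then show ?thesis using t l(7) by (simp add: LIMSEQ_const_iff)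
qed

text \<open>No boundary terms arise because both arguments are limits of test functions. The limits
  are separated: with \<psi> fixed the form is an L2 pairing with u, continuous in u, and only
  afterwards is \<psi> sent to v.\<close>

lemma Green:
  assumes A: "A_rel \<alpha> \<mu> u f" and u: "u \<in> H_space \<alpha> \<mu>" and v: "v \<in> H_space \<alpha> \<mu>"
  shows "inner (J u) (J v) = - inner f v"
proof -
  obtain w z where w: "weak_deriv (rep_L2 u) w" and z: "weak_deriv (\<lambda>x. x powr \<alpha> * w x) z"
    and f: "AE x in lebesgue01. rep_L2 f x = z x + \<mu> / x powr (2 - \<alpha>) * rep_L2 u x"
    using A by (auto simp: A_rel_def)
  have li: "locally_integrable01 (rep_L2 u)" "locally_integrable01 w" "locally_integrable01 z"
    using w z by (auto simp: weak_deriv_def)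
  have test: "inner (J u) (J0 \<psi>) = - inner f (abs_L2 \<psi>)" if \<psi>: "\<psi> \<in> test_functions" for \<psi>
  proof -
    define \<eta> where "\<eta> = (\<lambda>x. x powr \<alpha> * deriv \<psi> x)"
    define \<zeta> where "\<zeta> = (\<lambda>x. x powr (\<alpha> - 2) * \<psi> x)"
    \<comment> \<open>The operator applied to the test function: all derivatives are moved away from
      u, so that convergence in L2 is enough.\<close>
    define L where "L x = deriv \<eta> x + \<mu> * \<zeta> x" for x
    have t: "\<eta> \<in> test_functions" "\<zeta> \<in> test_functions" "deriv \<eta> \<in> test_functions"
      using \<psi> by (auto simp: \<eta>_def \<zeta>_def powr_times_test_function deriv_test_function)
    have L: "L \<in> test_functions" unfolding L_def[abs_def] by (intro test_functions_add test_functions_scale t)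
    have a: "inner (J0 \<phi>) (J0 \<psi>) = - inner (abs_L2 \<phi>) (abs_L2 L)" if \<phi>: "\<phi> \<in> test_functions" for \<phi>
    proof -
      have "a_form \<alpha> \<mu> \<phi> \<psi> = (LINT x|lebesgue01. deriv \<phi> x * \<eta> x - \<mu> * (\<phi> x * \<zeta> x))"
        unfolding a_form_def
        by (intro Bochner_Integration.integral_cong) (auto simp: powr_shift(3) \<eta>_def \<zeta>_def algebra_simps)
      also have "\<dots> = (LINT x|lebesgue01. deriv \<phi> x * \<eta> x) - \<mu> * (LINT x|lebesgue01. \<phi> x * \<zeta> x)"
        using \<phi> t by (simp add: test_functions_product_integrable deriv_test_function)
      also have "(LINT x|lebesgue01. deriv \<phi> x * \<eta> x) = - (LINT x|lebesgue01. \<phi> x * deriv \<eta> x)"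
        using integral_by_parts_test_functions[OF \<phi> t(1)] by simp
      also have "- (LINT x|lebesgue01. \<phi> x * deriv \<eta> x) - \<mu> * (LINT x|lebesgue01. \<phi> x * \<zeta> x) = - (LINT x|lebesgue01. \<phi> x * L x)"
        using \<phi> t by (simp add: L_def distrib_left test_functions_product_integrable mult.left_commute)
      finally show ?thesis using \<phi> \<psi> L by (simp add: a_form_eq inner_test_functions)
    qed
    obtain \<phi> where \<phi>: "approximates \<alpha> \<mu> \<phi> u" using u by (auto simp: H_space_def)
    note l = approximates_limits[OF \<phi>]
    have "(\<lambda>n. inner (J0 (\<phi> n)) (J0 \<psi>)) \<longlonglongrightarrow> inner (J u) (J0 \<psi>)"
      "(\<lambda>n. - inner (abs_L2 (\<phi> n)) (abs_L2 L)) \<longlonglongrightarrow> - inner u (abs_L2 L)"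
      by (intro tendsto_intros l)+
    then have "inner (J u) (J0 \<psi>) = - inner u (abs_L2 L)"
      using a l(7) LIMSEQ_unique by simp
    also have "inner u (abs_L2 L) = (LINT x|lebesgue01. rep_L2 u x * deriv \<eta> x + \<mu> * (rep_L2 u x * \<zeta> x))"
      using L by (simp add: inner_L2_rep_abs test_function_square_integrable L_def distrib_left mult.left_commute)
    also have "\<dots> = (LINT x|lebesgue01. rep_L2 u x * deriv \<eta> x) + \<mu> * (LINT x|lebesgue01. rep_L2 u x * \<zeta> x)"
      using li t by (simp add: integrable_times_test_function)
    also have "(LINT x|lebesgue01. rep_L2 u x * deriv \<eta> x) = - (LINT x|lebesgue01. w x * \<eta> x)"
      using w t by (simp add: weak_deriv_def)
    also have "(LINT x|lebesgue01. w x * \<eta> x) = (LINT x|lebesgue01. (x powr \<alpha> * w x) * deriv \<psi> x)"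
      by (intro Bochner_Integration.integral_cong) (auto simp: \<eta>_def)
    also have "\<dots> = - (LINT x|lebesgue01. z x * \<psi> x)" using z \<psi> by (simp add: weak_deriv_def)
    also have "- (- (LINT x|lebesgue01. z x * \<psi> x)) + \<mu> * (LINT x|lebesgue01. rep_L2 u x * \<zeta> x)
       = (LINT x|lebesgue01. z x * \<psi> x + \<mu> * (rep_L2 u x * \<zeta> x))"
      using li t \<psi> by (simp add: integrable_times_test_function)
    also have "\<dots> = (LINT x|lebesgue01. rep_L2 f x * \<psi> x)"
    proof (rule integral_cong_AE)
      have "AE x in lebesgue01. x \<in> space lebesgue01" by (rule AE_space)
      with f show "AE x in lebesgue01. z x * \<psi> x + \<mu> * (rep_L2 u x * \<zeta> x) = rep_L2 f x * \<psi> x"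
      proof eventually_elim
        case (elim x)
        then have x: "0 < x" by simp
        show ?case unfolding elim(1) powr_shift(3)[OF x] \<zeta>_def by (simp add: algebra_simps)
      qed
      have "integrable lebesgue01 (\<lambda>x. z x * \<psi> x)" "integrable lebesgue01 (\<lambda>x. rep_L2 u x * \<zeta> x)"
         "integrable lebesgue01 (\<lambda>x. rep_L2 f x * \<psi> x)"
        using li t \<psi> by (auto intro!: integrable_times_test_function square_integrable_imp_locally_integrable01)
      then show "(\<lambda>x. z x * \<psi> x + \<mu> * (rep_L2 u x * \<zeta> x)) \<in> borel_measurable lebesgue01"
        "(\<lambda>x. rep_L2 f x * \<psi> x) \<in> borel_measurable lebesgue01" by auto
    qed
    finally show ?thesis using \<psi> by (simp add: inner_L2_rep_abs test_function_square_integrable)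
  qed
  obtain \<psi> where \<psi>: "approximates \<alpha> \<mu> \<psi> v" using v by (auto simp: H_space_def)
  note l = approximates_limits[OF \<psi>]
  have "(\<lambda>n. inner (J u) (J0 (\<psi> n))) \<longlonglongrightarrow> inner (J u) (J v)" "(\<lambda>n. - inner f (abs_L2 (\<psi> n))) \<longlonglongrightarrow> - inner f v"
    by (intro tendsto_intros l)+
  then show ?thesis using test l(7) LIMSEQ_unique by simp
qed

end

section \<open>The Rellich identity\<close>

lemma lebesgue01_Icc_absolutely_integrable:
  fixes f :: "real \<Rightarrow> real"
  assumes "integrable lebesgue01 f" "0 < \<epsilon>"
  shows "f absolutely_integrable_on {\<epsilon>..1}"
proof -
  have "f integrable_on {0<..<1}" "(\<lambda>x. norm (f x)) integrable_on {0<..<1}"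
    using assms(1) integrable_norm[OF assms(1)] by (auto intro: integrable_on_lebesgue_on)
  then have "f absolutely_integrable_on {0..1}"
    by (simp add: absolutely_integrable_on_def integrable_on_Icc_iff_Ioo)
  then show ?thesis using assms(2) by (auto intro: absolutely_integrable_subinterval)
qed

lemma AE_lebesgue_on_subset:
  assumes "AE x in lebesgue_on T. P x" "S \<subseteq> T" "S \<in> sets lebesgue" "T \<in> sets lebesgue"
  shows "AE x in lebesgue_on S. P x"
proof -
  have "AE x in lebesgue. x \<in> T \<longrightarrow> P x" using assms by (subst (asm) AE_restrict_space_iff) auto
  then have "AE x in lebesgue. x \<in> S \<longrightarrow> P x" by eventually_elim (use assms(2) in auto)
  then show ?thesis using assms by (subst AE_restrict_space_iff) auto
qed

text \<open>Distributional derivatives see only the open interval; both sides are continuous up to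
  1, so the identity reaches the endpoint where the trace is taken.\<close>

lemma increments_up_to_endpoint:
  fixes y g :: "real \<Rightarrow> real"
  assumes inc: "\<And>a b. 0 < a \<Longrightarrow> a < b \<Longrightarrow> b < 1 \<Longrightarrow> y b - y a = integral {a..b} g"
    and y: "continuous_on {0<..1} y" and g: "g absolutely_integrable_on {\<epsilon>..1}" and \<epsilon>: "0 < \<epsilon>" "\<epsilon> < 1"
  shows "absolutely_continuous_with y g \<epsilon> 1"
  unfolding absolutely_continuous_with_def
proof (intro conjI allI impI g)
  fix c d assume cd: "\<epsilon> \<le> c" "c \<le> d" "d \<le> 1"
  consider "c = d" | "c < d" "d < 1" | "c < d" "d = 1" using cd by linarith
  then show "y d - y c = integral {c..d} g"
  proof cases
    case 3
    define F where "F b = y b - y c - integral {c..b} g" for b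
    have gi: "g integrable_on {c..1}"
      using absolutely_integrable_subinterval[OF g cd(1) order_refl] by (simp add: absolutely_integrable_on_def)
    have cl: "closure {c<..<1} = {c..1}" using 3 by simp
    have "continuous_on (closure {c<..<1}) F"
      unfolding cl F_def using cd \<epsilon>
      by (intro continuous_intros indefinite_integral_continuous_1 gi continuous_on_subset[OF y]) auto
    moreover have "F b = 0" if "b \<in> {c<..<1}" for b
      using that inc[of c b] cd \<epsilon> by (simp add: F_def)
    moreover have "1 \<in> closure {c<..<1}" using 3 unfolding cl by simp
    ultimately have "F 1 = 0" by (rule continuous_constant_on_closure)
    then show ?thesis using 3 by (simp add: F_def)
  qed (use inc cd \<epsilon> in auto)
qed

context degenerate_singular
begin

text \<open>(x p)' has integral 0 over (0,1), while its integral over [\<epsilon>,1] is p 1 -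
  \<epsilon> p \<epsilon>. Hence x p tends to p 1 at 0, and since p = (x p)/x is integrable, this
  limit is 0.\<close>

lemma H_space_vanishes_at_1:
  assumes u: "u \<in> H_space \<alpha> \<mu>" and w: "weak_deriv (rep_L2 u) w"
    and p: "AE x in lebesgue01. rep_L2 u x = p x"
    and pq: "\<And>x. x \<in> {0<..1} \<Longrightarrow> (p has_real_derivative q x) (at x within {0<..1})"
    and q: "continuous_on {0<..1} q" and wq: "AE x in lebesgue01. w x = q x"
  shows "p 1 = 0"
proof -
  have one: "(\<lambda>x. 1::real) square_integrable_on {0<..<1}"
    by (intro continuous_on_square_integrable continuous_intros)
  define h where "h = ext_B u + (1 - \<alpha> / 4) *\<^sub>R u"
  have "weak_euler_op 1 1 (\<alpha> / 4) u (ext_B u)" by (rule H_space_weak_euler_op(3)[OF u])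
  then have Bu: "AE x in lebesgue01. rep_L2 (ext_B u) x = 1 * (x powr 1 * w x) + \<alpha> / 4 * (x powr (1 - 1) * rep_L2 u x)"
    by (rule weak_euler_op_weak_deriv[OF w])
  have "h = abs_L2 (rep_L2 (ext_B u)) + (1 - \<alpha> / 4) *\<^sub>R abs_L2 (rep_L2 u)" by (simp add: h_def)
  also have "\<dots> = abs_L2 (\<lambda>x. rep_L2 (ext_B u) x + (1 - \<alpha> / 4) * rep_L2 u x)"
    by (simp only: abs_L2_scaleR abs_L2_add rep_L2_square_integrable square_integrable_on_scale)
  finally have "AE x in lebesgue01. rep_L2 h x = rep_L2 (ext_B u) x + (1 - \<alpha> / 4) * rep_L2 u x"
    by (simp only:) (intro rep_L2_abs_L2 square_integrable_on_add square_integrable_on_scale rep_L2_square_integrable)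
  moreover have "AE x in lebesgue01. x \<in> space lebesgue01" by (rule AE_space)
  ultimately have hx: "AE x in lebesgue01. rep_L2 h x = x * q x + p x"
    using Bu p wq by eventually_elim (simp add: algebra_simps)
  have cp: "continuous_on {0<..1} p" unfolding continuous_on_eq_continuous_within using pq DERIV_continuous by blast
  have hi: "integrable lebesgue01 (rep_L2 h)" by (intro square_integrable_on_integrable rep_L2_square_integrable)
  have sub: "{0<..<1} \<subseteq> {0<..1::real}" by auto
  have cm: "(\<lambda>x. x * q x + p x) \<in> borel_measurable lebesgue01" "p \<in> borel_measurable lebesgue01"
    by (intro continuous_imp_measurable_on_sets_lebesgue continuous_intros continuous_on_subset[OF q sub] continuous_on_subset[OF cp sub]; simp)+
  have i: "integrable lebesgue01 (\<lambda>x. x * q x + p x)"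
    using integrable_cong_AE[OF _ cm(1) hx] hi by auto
  have "(LINT x|lebesgue01. x * q x + p x) = (LINT x|lebesgue01. rep_L2 h x)"
    using hx cm(1) hi by (intro integral_cong_AE) (auto elim: eventually_mono)
  also have "\<dots> = inner h (abs_L2 (\<lambda>x. 1))" using inner_L2_rep_abs[OF one, of h] by simp
  also have "\<dots> = 0" using inner_ext_B_const[OF u] by (simp add: h_def)
  finally have I0: "(LINT x|lebesgue01. x * q x + p x) = 0" .
  have lim: "((\<lambda>x. integral {x..1} (\<lambda>x. x * q x + p x)) \<longlongrightarrow> 0) (at_right 0)"
    using integral_tendsto_at_right_0[OF i] I0 by simp
  have ftc: "integral {\<epsilon>..1} (\<lambda>x. x * q x + p x) = p 1 - \<epsilon> * p \<epsilon>" if "0 < \<epsilon>" "\<epsilon> < 1" for \<epsilon>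
  proof -
    have "((\<lambda>x. x * q x + p x) has_integral (1 * p 1 - \<epsilon> * p \<epsilon>)) {\<epsilon>..1}"
    proof (rule fundamental_theorem_of_calculus)
      fix x assume x: "x \<in> {\<epsilon>..1}"
      have "(p has_real_derivative q x) (at x within {\<epsilon>..1})"
        using pq[of x] x that by (auto intro: DERIV_subset)
      then have "((\<lambda>x. x * p x) has_real_derivative x * q x + p x) (at x within {\<epsilon>..1})"
        by (auto intro!: derivative_eq_intros)
      then show "((\<lambda>x. x * p x) has_vector_derivative x * q x + p x) (at x within {\<epsilon>..1})"
        by (simp add: has_real_derivative_iff_has_vector_derivative)
    qed (use that in simp)
    then show ?thesis by (simp add: integral_unique)
  qed
  have "\<forall>\<^sub>F \<epsilon> in at_right 0. integral {\<epsilon>..1} (\<lambda>x. x * q x + p x) = p 1 - \<epsilon> * p \<epsilon>"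
    unfolding eventually_at_right_field using ftc by (intro exI[of _ 1]) auto
  with lim have "((\<lambda>\<epsilon>. p 1 - \<epsilon> * p \<epsilon>) \<longlongrightarrow> 0) (at_right 0)"
    by (rule Lim_transform_eventually)
  then have "((\<lambda>\<epsilon>. p 1 - (p 1 - \<epsilon> * p \<epsilon>)) \<longlongrightarrow> p 1 - 0) (at_right 0)" by (intro tendsto_intros)
  then have l: "((\<lambda>\<epsilon>. \<epsilon> * p \<epsilon>) \<longlongrightarrow> p 1) (at_right 0)" by simp
  have ip: "integrable lebesgue01 p"
    using integrable_cong_AE[OF _ cm(2) p] square_integrable_on_integrable[OF rep_L2_square_integrable[of u]] by auto
  have "integrable lebesgue01 (\<lambda>x. x * p x / x)"
    using ip by (rule Bochner_Integration.integrable_cong[THEN iffD1, rotated 2]) auto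
  from limit_eq_0_if_quotient_integrable[OF l this] show ?thesis .
qed

text \<open>The multiplier \<open>x u\<^sub>x - k u\<close> turns \<open>A u\<close> into the derivative of
  \<open>Q = (x\<^sup>1\<^sup>+\<^sup>\<alpha> u\<^sub>x\<^sup>2 - 2k x\<^sup>\<alpha> u u\<^sub>x + \<mu> x\<^sup>\<alpha>\<^sup>-\<^sup>1 u\<^sup>2) / 2\<close>. The quotient \<open>Q/x\<close> is
  \<open>((C u)\<^sup>2 - (D u)\<^sup>2) / 2\<close>, hence integrable even in the critical case, so \<open>Q\<close> vanishes at \<open>0\<close>.\<close>

lemma Rellich:
  assumes u: "u \<in> H_space \<alpha> \<mu>" and A: "A_rel \<alpha> \<mu> u f" and d: "deriv_at_1 u d"
  shows "inner f (ext_B u) = d\<^sup>2 / 2 - (2 - \<alpha>) / 4 * (norm (J u))\<^sup>2"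
proof -
  obtain w z where w: "weak_deriv (rep_L2 u) w" and z: "weak_deriv (\<lambda>x. x powr \<alpha> * w x) z"
    and f: "AE x in lebesgue01. rep_L2 f x = z x + \<mu> / x powr (2 - \<alpha>) * rep_L2 u x"
    using A by (auto simp: A_rel_def)
  obtain p q where p: "AE x in lebesgue01. rep_L2 u x = p x"
    and pq: "\<And>x. x \<in> {0<..1} \<Longrightarrow> (p has_real_derivative q x) (at x within {0<..1})"
    and q: "continuous_on {0<..1} q" and q1: "q 1 = d"
    using d unfolding deriv_at_1_def by blast
  have sub: "{0<..<1} \<subseteq> {0<..1::real}" by auto
  have sp: "AE x in lebesgue01. x \<in> space lebesgue01" by (rule AE_space)
  have cp: "continuous_on {0<..1} p" unfolding continuous_on_eq_continuous_within using pq DERIV_continuous by blast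
  have pq': "(p has_real_derivative q x) (at x)" if "x \<in> {0<..<1}" for x
  proof -
    have "(p has_real_derivative q x) (at x within {0<..<1})" using pq[of x] that sub by (auto intro: DERIV_subset)
    then show ?thesis using that at_within_open[of x "{0<..<1}"] by simp
  qed
  have wq: "AE x in lebesgue01. w x = q x"
    by (rule weak_deriv_C1[OF w p pq' continuous_on_subset[OF q sub]])
  have p1: "p 1 = 0" by (rule H_space_vanishes_at_1[OF u w p pq q wq])
  \<comment> \<open>The flux is kept as a quantity of its own: by the equation it has the integrable
    derivative \<open>g\<close> defined below, whereas q is known only to be continuous.\<close>
  define y where "y x = x powr \<alpha> * q x" for x
  have cy: "continuous_on {0<..1} y" unfolding y_def by (intro continuous_intros q) auto
  define g where "g x = rep_L2 f x - \<mu> * (x powr (\<alpha> - 2) * p x)" for x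
  have zg: "AE x in lebesgue01. z x = g x"
    using f p sp
  proof eventually_elim
    case (elim x)
    then have x: "0 < x" by simp
    show ?case using elim(1) unfolding powr_shift(3)[OF x] g_def elim(2) by simp
  qed
  have gabs: "g absolutely_integrable_on {\<epsilon>..1}" if \<epsilon>: "0 < \<epsilon>" for \<epsilon>
  proof -
    have "rep_L2 f absolutely_integrable_on {\<epsilon>..1}"
      by (intro lebesgue01_Icc_absolutely_integrable square_integrable_on_integrable rep_L2_square_integrable \<epsilon>)
    moreover have "(\<lambda>x. \<mu> * (x powr (\<alpha> - 2) * p x)) absolutely_integrable_on {\<epsilon>..1}"
      using \<epsilon> by (intro absolutely_integrable_continuous_real continuous_intros continuous_on_subset[OF cp]) auto
    ultimately show ?thesis unfolding g_def by (intro set_integral_diff)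
  qed
  have inc: "y b - y a = integral {a..b} g" if ab: "0 < a" "a < b" "b < 1" for a b
  proof -
    have vy: "AE x in lebesgue01. x powr \<alpha> * w x = y x" using wq by eventually_elim (simp add: y_def)
    have "y b - y a = integral\<^sup>L (lebesgue_on {a..b}) z"
      by (rule weak_deriv_increment[OF z vy continuous_on_subset[OF cy sub] ab])
    also have "\<dots> = integral\<^sup>L (lebesgue_on {a..b}) g"
    proof (rule integral_cong_AE)
      show "AE x in lebesgue_on {a..b}. z x = g x" using ab by (intro AE_lebesgue_on_subset[OF zg]) auto
      have "integrable (lebesgue_on {a..b}) z" using z ab by (auto simp: weak_deriv_def locally_integrable01_def)
      then show "z \<in> borel_measurable (lebesgue_on {a..b})" by auto
      have "g absolutely_integrable_on {a..b}" using absolutely_integrable_subinterval[OF gabs[OF ab(1)], of a b] ab by simp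
      then have "integrable (lebesgue_on {a..b}) g" by (simp add: integrable_lebesgue_on_iff set_integrable_def)
      then show "g \<in> borel_measurable (lebesgue_on {a..b})" by auto
    qed
    also have "\<dots> = integral {a..b} g"
    proof -
      have "g absolutely_integrable_on {a..b}" using absolutely_integrable_subinterval[OF gabs[OF ab(1)], of a b] ab by simp
      then have "integrable (lebesgue_on {a..b}) g" by (simp add: integrable_lebesgue_on_iff set_integrable_def)
      then show ?thesis by (intro lebesgue_integral_eq_integral) auto
    qed
    finally show ?thesis .
  qed
  define R where "R x = rep_L2 f x * (x * q x - k * p x)" for x
  \<comment> \<open>Written through y and p, whose absolute continuity is known; x^(1-\<alpha>) y^2
    is x^(1+\<alpha>) q^2.\<close>
  define Q where "Q x = y x * ((1/2 * x powr (1 - \<alpha>)) * y x + (- k) * p x) + (1/2 * \<mu> * x powr (\<alpha> - 1)) * (p x * p x)" for x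
  have QR: "integral {\<epsilon>..1} R = Q 1 - Q \<epsilon>" if \<epsilon>: "0 < \<epsilon>" "\<epsilon> < 1" for \<epsilon>
  proof -
    have sub': "{\<epsilon>..1} \<subseteq> {0<..1}" using \<epsilon> by auto
    have acy: "absolutely_continuous_with y g \<epsilon> 1"
      by (rule increments_up_to_endpoint[OF inc cy gabs[OF \<epsilon>(1)] \<epsilon>])
    have acp: "absolutely_continuous_with p q \<epsilon> 1"
      using DERIV_subset[OF pq sub'] \<epsilon> by (intro absolutely_continuous_with_C1 continuous_on_subset[OF q sub']) auto
    have ac1: "absolutely_continuous_with (\<lambda>x. 1/2 * x powr (1 - \<alpha>)) (\<lambda>x. 1/2 * ((1 - \<alpha>) * x powr (- \<alpha>))) \<epsilon> 1"
      using \<epsilon> by (intro absolutely_continuous_with_C1 continuous_intros) (auto intro!: derivative_eq_intros)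
    have ac2: "absolutely_continuous_with (\<lambda>x. 1/2 * \<mu> * x powr (\<alpha> - 1)) (\<lambda>x. 1/2 * \<mu> * ((\<alpha> - 1) * x powr (\<alpha> - 2))) \<epsilon> 1"
      using \<epsilon> by (intro absolutely_continuous_with_C1 continuous_intros) (auto intro!: derivative_eq_intros)
    have ac0: "absolutely_continuous_with (\<lambda>x. - k) (\<lambda>x. 0) \<epsilon> 1"
      by (intro absolutely_continuous_with_C1) auto
    \<comment> \<open>The sum and product rules follow the shape of \<open>Q\<close>; the raw
      derivative they produce is identified with \<open>R\<close> below.\<close>
    note ac = absolutely_continuous_with_add[OF
        absolutely_continuous_with_mult[OF acy absolutely_continuous_with_add[OF absolutely_continuous_with_mult[OF ac1 acy]
           absolutely_continuous_with_mult[OF ac0 acp]]]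
        absolutely_continuous_with_mult[OF ac2 absolutely_continuous_with_mult[OF acp acp]]]
    have "absolutely_continuous_with Q R \<epsilon> 1"
    proof (rule absolutely_continuous_with_cong[OF ac])
      fix x assume "x \<in> {\<epsilon>..1}"
      then have x: "0 < x" using \<epsilon> by auto
      define s where "s = x powr (\<alpha> - 2)"
      define t where "t = x powr (- \<alpha>)"
      have st: "x\<^sup>2 * s * t = 1" using x powr_add[of x \<alpha> "- \<alpha>"] powr_shift(1)[OF x] by (simp add: s_def t_def)
      have t1: "x powr (1 - \<alpha>) = x * t" using x powr_add[of x 1 "- \<alpha>"] by (simp add: t_def)
      have yx: "y x = x\<^sup>2 * s * q x" using powr_shift(1)[OF x] by (simp add: y_def s_def)
      have a1: "1 - \<alpha> = 2 * k" "\<alpha> - 1 = - 2 * k" by (simp_all add: k_def)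
      have tyx: "t * y x = q x" using st unfolding yx by (simp add: mult_ac)
      have "g x * (1/2 * x powr (1 - \<alpha>) * y x + - k * p x) +
         (1/2 * ((1 - \<alpha>) * x powr - \<alpha>) * y x + g x * (1/2 * x powr (1 - \<alpha>)) + (0 * p x + q x * - k)) * y x +
         (1/2 * \<mu> * ((\<alpha> - 1) * x powr (\<alpha> - 2)) * (p x * p x) + (q x * p x + q x * p x) * (1/2 * \<mu> * x powr (\<alpha> - 1)))
        = g x * (1/2 * x * (t * y x) - k * p x) + (k * (t * y x) - k * q x) * y x + g x * (1/2 * x * (t * y x))
          + \<mu> * s * p x * (x * q x - k * p x)"
        unfolding t1 powr_shift(2)[OF x] s_def[symmetric] t_def[symmetric]
        unfolding a1 by (simp add: algebra_simps)
      also have "\<dots> = R x"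
        unfolding tyx R_def g_def s_def[symmetric] by (simp add: algebra_simps)
      finally show "g x * (1/2 * x powr (1 - \<alpha>) * y x + - k * p x) +
         (1/2 * ((1 - \<alpha>) * x powr - \<alpha>) * y x + g x * (1/2 * x powr (1 - \<alpha>)) + (0 * p x + q x * - k)) * y x +
         (1/2 * \<mu> * ((\<alpha> - 1) * x powr (\<alpha> - 2)) * (p x * p x) + (q x * p x + q x * p x) * (1/2 * \<mu> * x powr (\<alpha> - 1))) = R x" .
    qed (simp add: Q_def)
    then show ?thesis using \<epsilon> by (simp add: absolutely_continuous_with_def)
  qed
  have Cu: "AE x in lebesgue01. rep_L2 (ext_C u) x = 1 * (x powr (\<alpha>/2) * w x) + (- k) * (x powr (\<alpha>/2 - 1) * rep_L2 u x)"
    by (rule weak_euler_op_weak_deriv[OF w H_space_weak_euler_op(1)[OF u]])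
  have Du: "AE x in lebesgue01. rep_L2 (ext_D u) x = 0 * (x powr (\<alpha>/2) * w x) + \<nu> * (x powr (\<alpha>/2 - 1) * rep_L2 u x)"
    by (rule weak_euler_op_weak_deriv[OF w H_space_weak_euler_op(2)[OF u]])
  have Bu: "AE x in lebesgue01. rep_L2 (ext_B u) x = 1 * (x powr 1 * w x) + \<alpha> / 4 * (x powr (1 - 1) * rep_L2 u x)"
    by (rule weak_euler_op_weak_deriv[OF w H_space_weak_euler_op(3)[OF u]])
  \<comment> \<open>Here \<alpha>/4 + k = (2 - \<alpha>)/4: the multiplier exceeds x u_x - k u by
    that multiple of u.\<close>
  have RB: "AE x in lebesgue01. rep_L2 f x * rep_L2 (ext_B u) x - (2 - \<alpha>) / 4 * (rep_L2 f x * rep_L2 u x) = R x"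
    using Bu p wq sp
  proof eventually_elim
    case (elim x)
    then have "rep_L2 (ext_B u) x - (2 - \<alpha>) / 4 * rep_L2 u x = x * q x - k * p x"
      by (simp add: k_def field_simps)
    then have "rep_L2 f x * (rep_L2 (ext_B u) x - (2 - \<alpha>) / 4 * rep_L2 u x) = R x" by (simp add: R_def)
    then show ?case by (simp add: algebra_simps)
  qed
  have cm: "(\<lambda>x. x * q x - k * p x) \<in> borel_measurable lebesgue01"
    by (intro continuous_imp_measurable_on_sets_lebesgue continuous_intros continuous_on_subset[OF q sub] continuous_on_subset[OF cp sub]; simp)+
  have fm: "rep_L2 f \<in> borel_measurable lebesgue01" using rep_L2_square_integrable[of f] by (simp add: square_integrable_on_def)
  have Rm: "R \<in> borel_measurable lebesgue01" unfolding R_def[abs_def] by (rule borel_measurable_times[OF fm cm])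
  have fi: "integrable lebesgue01 (\<lambda>x. rep_L2 f x * rep_L2 (ext_B u) x)" "integrable lebesgue01 (\<lambda>x. rep_L2 f x * rep_L2 u x)"
    by (intro square_integrable_on_mult rep_L2_square_integrable)+
  then have fi': "integrable lebesgue01 (\<lambda>x. rep_L2 f x * rep_L2 (ext_B u) x - (2 - \<alpha>) / 4 * (rep_L2 f x * rep_L2 u x))" by simp
  have Ri: "integrable lebesgue01 R" using integrable_cong_AE[OF borel_measurable_integrable[OF fi'] Rm RB] fi' by blast
  have "integral\<^sup>L lebesgue01 R = (LINT x|lebesgue01. rep_L2 f x * rep_L2 (ext_B u) x - (2 - \<alpha>) / 4 * (rep_L2 f x * rep_L2 u x))"
    by (rule integral_cong_AE[OF borel_measurable_integrable[OF fi'] Rm RB, symmetric])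
  also have "\<dots> = inner f (ext_B u) - (2 - \<alpha>) / 4 * inner f u"
    using fi by (simp add: inner_L2_rep)
  finally have IR: "integral\<^sup>L lebesgue01 R = inner f (ext_B u) - (2 - \<alpha>) / 4 * inner f u" .
  have "\<forall>\<^sub>F \<epsilon> in at_right 0. integral {\<epsilon>..1} R = Q 1 - Q \<epsilon>"
    unfolding eventually_at_right_field using QR by (intro exI[of _ 1]) auto
  with integral_tendsto_at_right_0[OF Ri] have "((\<lambda>\<epsilon>. Q 1 - Q \<epsilon>) \<longlongrightarrow> integral\<^sup>L lebesgue01 R) (at_right 0)"
    by (rule Lim_transform_eventually)
  then have "((\<lambda>\<epsilon>. Q 1 - (Q 1 - Q \<epsilon>)) \<longlongrightarrow> Q 1 - integral\<^sup>L lebesgue01 R) (at_right 0)" by (intro tendsto_intros)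
  then have Qlim: "(Q \<longlongrightarrow> Q 1 - integral\<^sup>L lebesgue01 R) (at_right 0)" by simp
  \<comment> \<open>In the difference of the two squares the coefficient of p^2 is k^2 - (k^2 -
    \<mu>) = \<mu>, so Q/x is expressed by functions known to be square integrable.\<close>
  have CD: "AE x in lebesgue01. 1/2 * (rep_L2 (ext_C u) x)\<^sup>2 - 1/2 * (rep_L2 (ext_D u) x)\<^sup>2 = Q x / x"
    using Cu Du p wq sp
  proof eventually_elim
    case (elim x)
    then have x: "0 < x" by simp
    define r s where "r = x powr (\<alpha>/2 - 1)" and "s = x powr (\<alpha> - 2)"
    define t where "t = x powr (- \<alpha>)"
    have rs: "r\<^sup>2 = s" using powr_shift(5)[OF x] by (simp add: r_def s_def)
    have st: "x\<^sup>2 * s * t = 1" using x powr_add[of x \<alpha> "- \<alpha>"] powr_shift(1)[OF x] by (simp add: s_def t_def)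
    have t1: "x powr (1 - \<alpha>) = x * t" using x powr_add[of x 1 "- \<alpha>"] by (simp add: t_def)
    have yx: "y x = x\<^sup>2 * s * q x" using powr_shift(1)[OF x] by (simp add: y_def s_def)
    have tyx: "t * y x = q x" using st unfolding yx by (simp add: mult_ac)
    have "Q x = 1/2 * x * (t * y x) * y x - k * p x * y x + 1/2 * \<mu> * (x * s) * (p x)\<^sup>2"
      unfolding Q_def t1 powr_shift(2)[OF x] s_def[symmetric] by (simp add: algebra_simps power2_eq_square)
    also have "\<dots> = x * (1/2 * s * (x * q x - k * p x)\<^sup>2 - 1/2 * (k\<^sup>2 - \<mu>) * (s * (p x)\<^sup>2))"
      unfolding tyx unfolding yx by (simp add: algebra_simps power2_eq_square)
    finally have Qx: "Q x / x = 1/2 * s * (x * q x - k * p x)\<^sup>2 - 1/2 * (k\<^sup>2 - \<mu>) * (s * (p x)\<^sup>2)"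
      using x by simp
    have c: "rep_L2 (ext_C u) x = r * (x * q x - k * p x)" "rep_L2 (ext_D u) x = \<nu> * (r * p x)"
      unfolding elim(1,2) elim(3) elim(4) powr_shift(4)[OF x] r_def by (simp_all add: algebra_simps)
    show ?case unfolding Qx c power_mult_distrib rs \<nu>_square by simp
  qed
  have sq: "integrable lebesgue01 (\<lambda>x. 1/2 * (rep_L2 (ext_C u) x)\<^sup>2 - 1/2 * (rep_L2 (ext_D u) x)\<^sup>2)"
    using rep_L2_square_integrable[of "ext_C u"] rep_L2_square_integrable[of "ext_D u"] by (simp add: square_integrable_on_def)
  have Qm: "(\<lambda>x. Q x / x) \<in> borel_measurable lebesgue01"
    unfolding Q_def
    by (intro continuous_imp_measurable_on_sets_lebesgue continuous_intros continuous_on_subset[OF cy sub] continuous_on_subset[OF cp sub]; auto)+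
  have "integrable lebesgue01 (\<lambda>x. Q x / x)"
    using integrable_cong_AE[OF borel_measurable_integrable[OF sq] Qm CD] sq by blast
  from limit_eq_0_if_quotient_integrable[OF Qlim this] have "Q 1 = integral\<^sup>L lebesgue01 R" by simp
  moreover have "Q 1 = d\<^sup>2 / 2" by (simp add: Q_def p1 y_def q1 power2_eq_square)
  \<comment> \<open>Green's formula with v = u trades the extra (2 - \<alpha>)/4 times the pairing
    of f and u for the form norm.\<close>
  moreover have "(norm (J u))\<^sup>2 = - inner f u" using Green[OF A u u] by (simp add: power2_norm_eq_inner)
  ultimately show ?thesis using IR by (simp add: field_simps)
qed

end

section \<open>Observability\<close>

context degenerate_singular
begin

definition state_iso :: "L2 \<times> L2 \<Rightarrow> (L2 \<times> L2) \<times> L2" where "state_iso U = (J (fst U), snd U)"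

lemma state_norm_eq: "U \<in> state_space \<alpha> \<mu> \<Longrightarrow> state_norm \<alpha> \<mu> U = norm (state_iso U)"
  by (auto simp: state_norm_def state_space_def state_iso_def norm_prod_def H_norm_eq)

lemma normed_semigroup_state_space:
  assumes "C0_semigroup (state_space \<alpha> \<mu>) (state_norm \<alpha> \<mu>) S"
  shows "normed_semigroup (state_space \<alpha> \<mu>) state_iso (state_norm \<alpha> \<mu>) S"
proof
  show "subspace (state_space \<alpha> \<mu>)"
    using subspace_H_space by (auto simp: subspace_def state_space_def zero_prod_def)
  show "state_iso (x + y) = state_iso x + state_iso y" if "x \<in> state_space \<alpha> \<mu>" "y \<in> state_space \<alpha> \<mu>" for x y
    using that by (auto simp: state_iso_def state_space_def J_add)
  show "state_iso (c *\<^sub>R x) = c *\<^sub>R state_iso x" if "x \<in> state_space \<alpha> \<mu>" for x c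
    using that by (auto simp: state_iso_def state_space_def J_scaleR)
  show "state_norm \<alpha> \<mu> x = norm (state_iso x)" if "x \<in> state_space \<alpha> \<mu>" for x
    using that by (rule state_norm_eq)
  show "C0_semigroup (state_space \<alpha> \<mu>) (state_norm \<alpha> \<mu>) S" by fact
  fix \<xi> :: "nat \<Rightarrow> L2 \<times> L2"
  assume \<xi>: "\<And>n. \<xi> n \<in> state_space \<alpha> \<mu>" and c: "Cauchy (\<lambda>n. state_iso (\<xi> n))"
  have cJ: "Cauchy (\<lambda>n. J (fst (\<xi> n)))" and cv: "Cauchy (\<lambda>n. snd (\<xi> n))"
    using bounded_linear.Cauchy[OF bounded_linear_fst c] bounded_linear.Cauchy[OF bounded_linear_snd c]
    by (simp_all add: state_iso_def)
  have "fst (\<xi> n) \<in> H_space \<alpha> \<mu>" for n using \<xi>[of n] by (auto simp: state_space_def)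
  from H_space_complete[OF this cJ] obtain u where u: "u \<in> H_space \<alpha> \<mu>" "(\<lambda>n. J (fst (\<xi> n))) \<longlonglongrightarrow> J u" by blast
  obtain v where v: "(\<lambda>n. snd (\<xi> n)) \<longlonglongrightarrow> v" using cv Cauchy_convergent_iff convergent_def by blast
  show "\<exists>x\<in>state_space \<alpha> \<mu>. (\<lambda>n. state_iso (\<xi> n)) \<longlonglongrightarrow> state_iso x"
    using u v by (intro bexI[of _ "(u, v)"]) (auto simp: state_iso_def state_space_def intro: tendsto_Pair)
qed

lemma classical_observability:
  assumes cl: "classical_solution \<alpha> \<mu> v0 v1 v vt" and T: "0 < T"
    and tr: "\<And>t. t \<in> {0<..<T} \<Longrightarrow> deriv_at_1 (v t) (\<tau> t)" and \<tau>: "\<tau> square_integrable_on {0<..<T}"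
  shows "((2 - \<alpha>) * T - 4) * ((norm (state_iso (v0, v1)))\<^sup>2 / 2) \<le> (LINT t|lebesgue_on {0<..<T}. (\<tau> t)\<^sup>2)"
proof -
  let ?X = "state_space \<alpha> \<mu>" and ?N = "state_norm \<alpha> \<mu>"
  obtain S where S: "C0_semigroup ?X ?N S" and gen: "generator ?X ?N S = wave_operator \<alpha> \<mu>"
    and vS: "\<And>t. 0 \<le> t \<Longrightarrow> (v t, vt t) = S t (v0, v1)"
    and v01: "v0 \<in> D_space \<alpha> \<mu>" "v1 \<in> H_space \<alpha> \<mu>"
    using cl unfolding classical_solution_def mild_solution_def by blast
  interpret normed_semigroup ?X state_iso ?N S by (rule normed_semigroup_state_space[OF S])
  define x where "x = (v0, v1)"
  obtain f0 where "A_rel \<alpha> \<mu> v0 f0" using v01 by (auto simp: D_space_def)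
  define y where "y = (v1, f0)"
  have xy: "(x, y) \<in> generator ?X ?N S"
    using \<open>A_rel \<alpha> \<mu> v0 f0\<close> v01 unfolding gen by (auto simp: wave_operator_def x_def y_def)
  then have xX: "x \<in> ?X" by (simp add: generator_def)
  \<comment> \<open>Since \<open>S t\<close> preserves the graph of the generator, S t y is the
    operator applied to S t x: its first component repeats the velocity, which therefore lies in the
    energy space, and its second is the acceleration.\<close>
  define f where "f t = snd (S t y)" for t
  have St: "S t x = (v t, vt t) \<and> S t y = (vt t, f t) \<and> v t \<in> H_space \<alpha> \<mu> \<and> vt t \<in> H_space \<alpha> \<mu> \<and> A_rel \<alpha> \<mu> (v t) (f t)"
    if "0 \<le> t" for t
  proof -
    have "(S t x, S t y) \<in> wave_operator \<alpha> \<mu>" using generator_invariant[OF xy that] by (simp add: gen)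
    moreover have "S t x = (v t, vt t)" using vS[OF that] by (simp add: x_def)
    ultimately show ?thesis by (auto simp: wave_operator_def f_def D_space_def)
  qed
  \<comment> \<open>Twice the energy of the data. It is conserved because Green's formula makes the
    state orthogonal to its time derivative.\<close>
  define E where "E = (norm (state_iso x))\<^sup>2"
  have E: "(norm (J (v t)))\<^sup>2 + (norm (vt t))\<^sup>2 = E" if t: "0 \<le> t" for t
  proof -
    define e where "e s = inner (state_iso (S s x)) (state_iso (S s x))" for s
    have es: "e s = (norm (J (v s)))\<^sup>2 + (norm (vt s))\<^sup>2" if "0 \<le> s" for s
      using St[OF that] by (simp add: e_def state_iso_def inner_prod_def power2_norm_eq_inner)
    have "e t = e 0"
    proof (cases "t = 0")
      case False
      show ?thesis
      proof (rule DERIV_isconst_end[of 0 t e])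
        show "0 < t" using t False by simp
        have "continuous_on {0..} (\<lambda>s. state_iso (S s x))"
          by (rule orbit_image_continuous[OF xX J_add J_scaleR]) auto
        then show "continuous_on {0..t} e"
          unfolding e_def by (intro continuous_intros) (auto elim: continuous_on_subset)
        fix s :: real assume s: "0 < s" "s < t"
        have "((\<lambda>s. state_iso (S s x)) has_vector_derivative state_iso (S s y)) (at s)"
          by (rule generator_has_derivative[OF xy s(1) J_add J_scaleR]) auto
        note d = bounded_bilinear.has_vector_derivative[OF bounded_bilinear_inner this this]
        have "inner (state_iso (S s x)) (state_iso (S s y)) = 0"
        proof -
          have "inner (J (v s)) (J (vt s)) = - inner (f s) (vt s)"
            using St[of s] s by (intro Green) auto
          then show ?thesis using St[of s] s by (simp add: state_iso_def inner_prod_def inner_commute)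
        qed
        then show "(e has_real_derivative 0) (at s)"
          using d unfolding e_def has_real_derivative_iff_has_vector_derivative by (simp add: inner_commute)
      qed
    qed simp
    then have "e t = E" using xX by (simp add: e_def E_def power2_norm_eq_inner S_0)
    then show ?thesis using es[OF t] by simp
  qed
  define G where "G t = inner (vt t) (ext_B (v t))" for t
  have Gb: "\<bar>G t\<bar> \<le> E / 2" if t: "0 \<le> t" for t
  proof -
    have "\<bar>G t\<bar> \<le> norm (vt t) * norm (ext_B (v t))" unfolding G_def by (rule Cauchy_Schwarz_ineq2)
    also have "\<dots> \<le> norm (vt t) * norm (J (v t))" using St[OF t] by (intro mult_left_mono norm_ext_B_le) auto
    also have "\<dots> \<le> E / 2" using sum_squares_bound[of "norm (vt t)" "norm (J (v t))"] E[OF t] by simp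
    finally show ?thesis .
  qed
  have lin1: "snd (a + b) = snd a + snd b" "snd (c *\<^sub>R a) = c *\<^sub>R snd a" "norm (snd a) \<le> norm (state_iso a)" for a b :: "L2 \<times> L2" and c
    by (auto simp: state_iso_def norm_prod_def real_le_rsqrt)
  have lin2: "ext_B (fst (a + b)) = ext_B (fst a) + ext_B (fst b)" "ext_B (fst (c *\<^sub>R a)) = c *\<^sub>R ext_B (fst a)"
     "norm (ext_B (fst a)) \<le> norm (state_iso a)" if "a \<in> ?X" "b \<in> ?X" for a b c
  proof -
    have "fst a \<in> H_space \<alpha> \<mu>" "fst b \<in> H_space \<alpha> \<mu>" using that by (auto simp: state_space_def)
    moreover from this have "norm (ext_B (fst a)) \<le> norm (J (fst a))" by (intro norm_ext_B_le)
    moreover have "norm (J (fst a)) \<le> norm (state_iso a)" unfolding state_iso_def by (simp add: norm_prod_def real_le_rsqrt)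
    ultimately show "ext_B (fst (a + b)) = ext_B (fst a) + ext_B (fst b)" "ext_B (fst (c *\<^sub>R a)) = c *\<^sub>R ext_B (fst a)"
     "norm (ext_B (fst a)) \<le> norm (state_iso a)" by (auto simp: ext_B_add ext_B_scaleR)
  qed
  \<comment> \<open>The derivative of \<open>G\<close>: kinetic and elastic parts carry the same
    factor (2 - \<alpha>)/4 and add up to the conserved E.\<close>
  define g where "g t = (\<tau> t)\<^sup>2 / 2 - (2 - \<alpha>) / 4 * E" for t
  have "(g has_integral (G T - G 0)) {0..T}"
  \<comment> \<open>The interior version is used because traces are given for 0 < t < T only, while
    \<open>G\<close> is continuous up to both ends.\<close>
  proof (rule fundamental_theorem_of_calculus_interior)
    have c1: "continuous_on {0..} (\<lambda>t. snd (S t x))"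
      by (rule orbit_image_continuous[OF xX]) (auto simp: lin1)
    have c2: "continuous_on {0..} (\<lambda>t. ext_B (fst (S t x)))"
      by (rule orbit_image_continuous[OF xX, of "\<lambda>a. ext_B (fst a)"]) (use lin2 in auto)
    have "continuous_on {0..T} (\<lambda>t. inner (snd (S t x)) (ext_B (fst (S t x))))"
      by (intro continuous_on_inner continuous_on_subset[OF c1] continuous_on_subset[OF c2]) auto
    then show "continuous_on {0..T} G" by (rule continuous_on_eq) (use St in \<open>auto simp: G_def\<close>)
    fix t assume t: "t \<in> {0<..<T}"
    have "((\<lambda>s. snd (S s x)) has_vector_derivative snd (S t y)) (at t)"
      by (rule generator_has_derivative[OF xy]) (use t in \<open>auto simp: lin1\<close>)
    moreover have "((\<lambda>s. ext_B (fst (S s x))) has_vector_derivative ext_B (fst (S t y))) (at t)"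
      by (rule generator_has_derivative[OF xy, of _ "\<lambda>a. ext_B (fst a)"]) (use t lin2 in auto)
    ultimately have "((\<lambda>s. inner (snd (S s x)) (ext_B (fst (S s x)))) has_vector_derivative
        inner (snd (S t x)) (ext_B (fst (S t y))) + inner (snd (S t y)) (ext_B (fst (S t x)))) (at t)"
      by (rule bounded_bilinear.has_vector_derivative[OF bounded_bilinear_inner])
    then have d: "((\<lambda>s. inner (snd (S s x)) (ext_B (fst (S s x)))) has_vector_derivative
        inner (vt t) (ext_B (vt t)) + inner (f t) (ext_B (v t))) (at t)"
      using St[of t] t by simp
    have "inner (f t) (ext_B (v t)) = (\<tau> t)\<^sup>2 / 2 - (2 - \<alpha>) / 4 * (norm (J (v t)))\<^sup>2"
      using St[of t] t tr[OF t] by (intro Rellich) auto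
    moreover have "inner (vt t) (ext_B (vt t)) = - ((2 - \<alpha>) / 4) * (norm (vt t))\<^sup>2"
      using St[of t] t by (intro inner_ext_B_self) auto
    ultimately have "inner (vt t) (ext_B (vt t)) + inner (f t) (ext_B (v t))
        = (\<tau> t)\<^sup>2 / 2 - (2 - \<alpha>) / 4 * ((norm (J (v t)))\<^sup>2 + (norm (vt t))\<^sup>2)"
      by (simp add: field_simps)
    then have "inner (vt t) (ext_B (vt t)) + inner (f t) (ext_B (v t)) = g t"
      using E[of t] t by (simp add: g_def)
    with d have d': "((\<lambda>s. inner (snd (S s x)) (ext_B (fst (S s x)))) has_vector_derivative g t) (at t)" by simp
    show "(G has_vector_derivative g t) (at t)"
      by (rule has_vector_derivative_transform_within_open[OF d', of "{0<..<T}"])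
         (use t St in \<open>auto simp: G_def\<close>)
  qed (use T in simp)
  moreover have "(g has_integral ((LINT t|lebesgue_on {0<..<T}. (\<tau> t)\<^sup>2) / 2 - (2 - \<alpha>) / 4 * E * T)) {0..T}"
  proof -
    have "((\<lambda>t. (\<tau> t)\<^sup>2) has_integral (LINT t|lebesgue_on {0<..<T}. (\<tau> t)\<^sup>2)) {0<..<T}"
      using \<tau> by (intro has_integral_integral_lebesgue_on) (auto simp: square_integrable_on_def)
    then have "((\<lambda>t. (\<tau> t)\<^sup>2) has_integral (LINT t|lebesgue_on {0<..<T}. (\<tau> t)\<^sup>2)) {0..T}"
      by (simp add: has_integral_Icc_iff_Ioo)
    from has_integral_diff[OF has_integral_divide[OF this, of 2] has_integral_const_real[of "(2 - \<alpha>) / 4 * E" 0 T]]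
    show ?thesis using T by (simp add: g_def[abs_def] mult_ac)
  qed
  ultimately have "G T - G 0 = (LINT t|lebesgue_on {0<..<T}. (\<tau> t)\<^sup>2) / 2 - (2 - \<alpha>) / 4 * E * T"
    by (rule has_integral_unique)
  \<comment> \<open>Each end costs at most E/2.\<close>
  moreover have "- E \<le> G T - G 0" using Gb[of T] Gb[of 0] T by auto
  ultimately show ?thesis
    by (simp add: E_def[symmetric] x_def[symmetric] field_simps)
qed

end

section \<open>Passage from classical to mild solutions\<close>

lemma integral_square_le_perturbed:
  assumes "f square_integrable_on S" "g square_integrable_on S" "0 < \<delta>"
  shows "(LINT t|lebesgue_on S. (f t)\<^sup>2) \<le> (1 + \<delta>) * (LINT t|lebesgue_on S. (g t)\<^sup>2)
           + (1 + 1 / \<delta>) * (LINT t|lebesgue_on S. (f t - g t)\<^sup>2)"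
proof -
  have i: "integrable (lebesgue_on S) (\<lambda>t. (f t)\<^sup>2)" "integrable (lebesgue_on S) (\<lambda>t. (g t)\<^sup>2)"
    "integrable (lebesgue_on S) (\<lambda>t. (f t - g t)\<^sup>2)"
    using assms square_integrable_on_diff[OF assms(1,2)] by (auto simp: square_integrable_on_def)
  have "(LINT t|lebesgue_on S. (f t)\<^sup>2) \<le> (LINT t|lebesgue_on S. (1 + \<delta>) * (g t)\<^sup>2 + (1 + 1 / \<delta>) * (f t - g t)\<^sup>2)"
  proof (rule integral_mono)
    fix t
    \<comment> \<open>Young's inequality for the cross term 2 g (f - g), written as a
      square.\<close>
    have "0 \<le> (\<delta> * g t - (f t - g t))\<^sup>2 / \<delta>" using assms(3) by simp
    also have "\<dots> = (1 + \<delta>) * (g t)\<^sup>2 + (1 + 1 / \<delta>) * (f t - g t)\<^sup>2 - (f t)\<^sup>2"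
      using assms(3) by (simp add: field_simps power2_eq_square)
    finally show "(f t)\<^sup>2 \<le> (1 + \<delta>) * (g t)\<^sup>2 + (1 + 1 / \<delta>) * (f t - g t)\<^sup>2" by simp
  qed (use i in auto)
  also have "\<dots> = (1 + \<delta>) * (LINT t|lebesgue_on S. (g t)\<^sup>2) + (1 + 1 / \<delta>) * (LINT t|lebesgue_on S. (f t - g t)\<^sup>2)"
    using i by simp
  finally show ?thesis .
qed

theorem theorem4p1:
  fixes \<alpha> \<mu> T :: real and u0 u1 :: L2 and u ut :: "real \<Rightarrow> L2" and ux1 :: "real \<Rightarrow> real"
  assumes "0 \<le> \<alpha>" "\<alpha> < 2" "\<alpha> \<noteq> 1"
    and "\<mu> \<le> mu_crit \<alpha>"
    and "mild_solution \<alpha> \<mu> u0 u1 u ut"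
    and "T > 0"
    and "boundary_trace \<alpha> \<mu> T u0 u1 ux1"
  shows "(LINT t|lebesgue_on {0<..<T}. (ux1 t)\<^sup>2) \<ge> ((2 - \<alpha>) * T - 4) * energy \<alpha> \<mu> u ut 0"
proof -
  interpret degenerate_singular \<alpha> \<mu> using assms by unfold_locales
  let ?X = "state_space \<alpha> \<mu>" and ?N = "state_norm \<alpha> \<mu>" and ?c = "(2 - \<alpha>) * T - 4"
  obtain S where S: "C0_semigroup ?X ?N S" and u: "\<And>t. 0 \<le> t \<Longrightarrow> (u t, ut t) = S t (u0, u1)" and X: "(u0, u1) \<in> ?X"
    using assms(5) unfolding mild_solution_def by blast
  interpret normed_semigroup ?X state_iso ?N S by (rule normed_semigroup_state_space[OF S])
  have "(u 0, ut 0) = (u0, u1)" using u[of 0] S_0[OF X] by simp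
  \<comment> \<open>The semigroup fixes the data at time 0, so the energy there is half the squared
    norm of the initial state.\<close>
  then have energy: "energy \<alpha> \<mu> u ut 0 = (norm (state_iso (u0, u1)))\<^sup>2 / 2"
    using X by (auto simp: energy_def state_iso_def norm_prod_def state_space_def H_norm_eq)
  obtain v0 v1 v vt \<tau> where cl: "\<And>n. classical_solution \<alpha> \<mu> (v0 n) (v1 n) (v n) (vt n)"
    and lim: "(\<lambda>n::nat. ?N (v0 n - u0, v1 n - u1)) \<longlonglongrightarrow> 0"
    and tr: "\<And>n t. t \<in> {0<..<T} \<Longrightarrow> deriv_at_1 (v n t) (\<tau> n t)"
    and \<tau>: "\<And>n. \<tau> n square_integrable_on {0<..<T}"
    and \<tau>lim: "(\<lambda>n. LINT t|lebesgue_on {0<..<T}. (\<tau> n t - ux1 t)\<^sup>2) \<longlonglongrightarrow> 0"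
    and ux1: "ux1 square_integrable_on {0<..<T}"
    using assms(7) unfolding boundary_trace_def by blast
  have vX: "(v0 n, v1 n) \<in> ?X" for n using cl[of n] by (simp add: classical_solution_def mild_solution_def)
  have "?N (v0 n - u0, v1 n - u1) = norm (state_iso (v0 n, v1 n) - state_iso (u0, u1))" for n
    using N_eq[OF in_X(3)[OF vX X], of n] J_diff[OF vX X, of n] by simp
  with lim have "(\<lambda>n. state_iso (v0 n, v1 n)) \<longlonglongrightarrow> state_iso (u0, u1)"
    by (simp add: tendsto_norm_zero_iff LIM_zero_iff)
  \<comment> \<open>Limits are compared directly, so the factor (2 - \<alpha>) T - 4 may have either
    sign.\<close>
  then have El: "(\<lambda>n. ?c * ((norm (state_iso (v0 n, v1 n)))\<^sup>2 / 2)) \<longlonglongrightarrow> ?c * energy \<alpha> \<mu> u ut 0"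
    unfolding energy by (intro tendsto_intros) auto
  define I where "I = (LINT t|lebesgue_on {0<..<T}. (ux1 t)\<^sup>2)"
  \<comment> \<open>With \<delta> fixed, the term carrying 1/\<delta> disappears as n grows; only
    afterwards can \<delta> be sent to 0.\<close>
  have bound: "?c * energy \<alpha> \<mu> u ut 0 \<le> (1 + \<delta>) * I" if \<delta>: "0 < \<delta>" for \<delta>
  proof (rule LIMSEQ_le[OF El])
    show "(\<lambda>n. (1 + \<delta>) * I + (1 + 1 / \<delta>) * (LINT t|lebesgue_on {0<..<T}. (\<tau> n t - ux1 t)\<^sup>2)) \<longlonglongrightarrow> (1 + \<delta>) * I"
      using tendsto_add[OF tendsto_const[of "(1 + \<delta>) * I"] tendsto_mult_right_zero[OF \<tau>lim, of "1 + 1 / \<delta>"]] by simp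
    have "?c * ((norm (state_iso (v0 n, v1 n)))\<^sup>2 / 2)
        \<le> (1 + \<delta>) * I + (1 + 1 / \<delta>) * (LINT t|lebesgue_on {0<..<T}. (\<tau> n t - ux1 t)\<^sup>2)" for n
      using order_trans[OF classical_observability[OF cl assms(6) tr \<tau>] integral_square_le_perturbed[OF \<tau> ux1 \<delta>]]
      by (simp only: I_def)
    then show "\<exists>N. \<forall>n\<ge>N. ?c * ((norm (state_iso (v0 n, v1 n)))\<^sup>2 / 2)
        \<le> (1 + \<delta>) * I + (1 + 1 / \<delta>) * (LINT t|lebesgue_on {0<..<T}. (\<tau> n t - ux1 t)\<^sup>2)" by blast
  qed
  have "((\<lambda>\<delta>. (1 + \<delta>) * I) \<longlongrightarrow> (1 + 0) * I) (at_right 0)" by (intro tendsto_intros)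
  moreover have "\<forall>\<^sub>F \<delta> in at_right 0. ?c * energy \<alpha> \<mu> u ut 0 \<le> (1 + \<delta>) * I"
    unfolding eventually_at_right_field using bound by (intro exI[of _ 1]) auto
  ultimately have "?c * energy \<alpha> \<mu> u ut 0 \<le> (1 + 0) * I"
    by (rule tendsto_lowerbound) simp
  then show ?thesis by (simp add: I_def)
qed

end
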